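(* Let $M$ be a compact connected manifold without boundary, and let $L=L(x,v,u):TM\times\mathbb{R}\to\mathbb{R}$ be a Tonelli Lagrangian of contact type, i.e. $L$ is of class $C^2$ and: (L1) $L_{vv}(x,v,u)>0$ for all $(x,v,u)\in TM\times\mathbb{R}$; (L2) there exist a super-linear continuous function $\theta_0:[0,+\infty)\to[0,+\infty)$ and a constant $c_0\geqslant 0$ such that $L(x,v,0)\geqslant\theta_0(|v|_x)-c_0$ for all $(x,v)\in TM$; (L3) there exists $\kappa>0$ such that $|L_u(x,v,u)|\leqslant\kappa$ for all $(x,v,u)\in TM\times\mathbb{R}$. Assume moreover that there exists $0<\lambda\leqslant\kappa$ such that $$\lambda\leqslant L_u(x,v,u)\leqslant\kappa,\qquad\forall (x,v,u)\in TM\times\mathbb{R}.$$ Let $\{T_t\}_{t\geqslant0}$ be the contact-type Lax-Oleinik semigroup on $C(M)$ associated with $L$. Then: (1) For any compact subset of the form $K=\{\phi_0+\delta : \delta\in[0,a]\}\subset C(M)$, where $\phi_0\in C(M)$ and $a>0$, it holds that $g(K)\geqslant\lambda$. (2) $h_{\rm top}(T_t)\geqslant\lambda$.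
   Context: $M$ is equipped with a Riemannian metric, $|\cdot|_x$ denotes the induced norm on $T_xM$, and super-linear means $\theta_0(r)/r\to+\infty$ as $r\to+\infty$. $C(M)$ is the space of continuous real-valued functions on $M$ with norm $\|f\|=\max_{x\in M}|f(x)|$. Lax-Oleinik semigroup: $T_0=\mathrm{id}$, and for $t>0$, $\phi\in C(M)$, $x\in M$, $$(T_t\phi)(x)=\inf_{\xi\in\mathcal{A}_{t,x}}\Big\{\phi(\xi(0))+\int_0^tL(\xi(s),\dot\xi(s),u_\xi(s))\,ds\Big\},$$ where $\mathcal{A}_{t,x}$ is the set of absolutely continuous arcs $\xi:[0,t]\to M$ with $\xi(t)=x$, and $u_\xi:[0,t]\to\mathbb{R}$ is the unique (absolutely continuous) solution of the Carathéodory equation $\dot u_\xi(s)=L(\xi(s),\dot\xi(s),u_\xi(s))$, $u_\xi(0)=\phi(\xi(0))$ (arcs for which $s\mapsto L(\xi(s),\dot\xi(s),0)$ is not integrable contribute $+\infty$). Under (L1)-(L3), $\{T_t\}_{t\geqslant 0}$ is a continuous semigroup on $C(M)$. Topological entropy: for a continuous semigroup $\{T_t\}_{t\geqslant0}$ on a complete metric space $(X,d)$ (here $X=C(M)$ with the metric induced by the norm), let $B(x,t,\varepsilon)=\{y\in X: d(T_s(y),T_s(x))<\varepsilon \text{ for all } s\in[0,t]\}$. For $K\subset X$ compact, let $g_t(\varepsilon,K)$ be the smallest cardinality of a set $E\subset X$ with $K\subset\bigcup_{x\in E}B(x,t,\varepsilon)$. Define $$g(K)=\lim_{\varepsilon\to0^+}\limsup_{t\to\infty}\frac1t\log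 g_t(\varepsilon,K),\qquad h_{\rm top}(T_t)=\sup_{K}g(K),$$ the supremum being over all compact subsets $K$ of $X$. *)

theory Defs
  imports "HOL-Analysis.Analysis"
begin

section \<open>Functions of class C^k on open sets\<close>

fun Ck_on :: "nat \<Rightarrow> 'v::real_normed_vector set \<Rightarrow> ('v \<Rightarrow> 'w::real_normed_vector) \<Rightarrow> bool" where
  "Ck_on 0 S f \<longleftrightarrow> continuous_on S f"
| "Ck_on (Suc k) S f \<longleftrightarrow> (\<forall>x\<in>S. f differentiable (at x)) \<and>
     (\<forall>h. Ck_on k S (\<lambda>x. frechet_derivative f (at x) h))"

definition smooth_on :: "'v::real_normed_vector set \<Rightarrow> ('v \<Rightarrow> 'w::real_normed_vector) \<Rightarrow> bool" where
  "smooth_on S f \<longleftrightarrow> (\<forall>k. Ck_on k S f)"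

section \<open>Smooth manifolds, tangent vectors, Riemannian metrics\<close>

text \<open>The manifold is the whole type \<open>'a\<close>; its smooth structure is the one generated by an atlas of
  charts into a Euclidean space \<open>'e\<close>. A chart \<open>(U, \<phi>)\<close> only depends on \<open>\<phi>\<close> restricted to \<open>U\<close>.\<close>

type_synonym ('a, 'e) chart = "'a set \<times> ('a \<Rightarrow> 'e)"

definition is_chart :: "('a::topological_space, 'e::euclidean_space) chart \<Rightarrow> bool" where
  "is_chart c \<longleftrightarrow> open (fst c) \<and> open (snd c ` fst c) \<and>
     homeomorphism (fst c) (snd c ` fst c) (snd c) (inv_into (fst c) (snd c))"

definition chart_inv :: "('a, 'e) chart \<Rightarrow> 'e \<Rightarrow> 'a" where
  "chart_inv c = inv_into (fst c) (snd c)"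

definition smooth_atlas :: "('a::topological_space, 'e::euclidean_space) chart set \<Rightarrow> bool" where
  "smooth_atlas \<A> \<longleftrightarrow> (\<forall>c\<in>\<A>. is_chart c) \<and> (\<Union>c\<in>\<A>. fst c) = UNIV \<and>
     (\<forall>c\<in>\<A>. \<forall>c'\<in>\<A>. smooth_on (snd c ` (fst c \<inter> fst c')) (snd c' \<circ> chart_inv c))"

text \<open>Second countability is automatic for a compact locally Euclidean space.\<close>

definition compact_connected_manifold ::
    "('a::t2_space, 'e::euclidean_space) chart set \<Rightarrow> bool" where
  "compact_connected_manifold \<A> \<longleftrightarrow>
     compact (UNIV :: 'a set) \<and> connected (UNIV :: 'a set) \<and> smooth_atlas \<A>"

text \<open>A tangent vector at \<open>x\<close> is the family of its coordinate vectors in all the charts around \<open>x\<close>,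
  related by the differentials of the transition maps (and \<open>0\<close> for all other arguments, so that
  it is determined by its coordinates).\<close>

type_synonym ('a, 'e) tangent = "('a, 'e) chart \<Rightarrow> 'e"

definition tangent_space ::
    "('a, 'e::euclidean_space) chart set \<Rightarrow> 'a \<Rightarrow> ('a, 'e) tangent set" where
  "tangent_space \<A> x = {v.
     (\<forall>c\<in>\<A>. \<forall>c'\<in>\<A>. x \<in> fst c \<and> x \<in> fst c' \<longrightarrow>
        v c' = frechet_derivative (snd c' \<circ> chart_inv c) (at (snd c x)) (v c)) \<and>
     (\<forall>c. \<not> (c \<in> \<A> \<and> x \<in> fst c) \<longrightarrow> v c = 0)}"

text \<open>The tangent vector at \<open>x\<close> whose coordinate vector in the chart \<open>c\<close> is \<open>w\<close>.\<close>

definition tangent_of ::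
    "('a, 'e::euclidean_space) chart set \<Rightarrow> ('a, 'e) chart \<Rightarrow> 'a \<Rightarrow> 'e \<Rightarrow> ('a, 'e) tangent" where
  "tangent_of \<A> c x w = (\<lambda>c'. if c' \<in> \<A> \<and> x \<in> fst c'
     then frechet_derivative (snd c' \<circ> chart_inv c) (at (snd c x)) w else 0)"

definition riemannian_metric ::
    "('a, 'e::euclidean_space) chart set \<Rightarrow>
     ('a \<Rightarrow> ('a, 'e) tangent \<Rightarrow> ('a, 'e) tangent \<Rightarrow> real) \<Rightarrow> bool" where
  "riemannian_metric \<A> g \<longleftrightarrow> (\<forall>c\<in>\<A>.
     (\<forall>x\<in>fst c.
        bilinear (\<lambda>w w'. g x (tangent_of \<A> c x w) (tangent_of \<A> c x w')) \<and>
        (\<forall>w w'. g x (tangent_of \<A> c x w) (tangent_of \<A> c x w')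
              = g x (tangent_of \<A> c x w') (tangent_of \<A> c x w)) \<and>
        (\<forall>w. w \<noteq> 0 \<longrightarrow> 0 < g x (tangent_of \<A> c x w) (tangent_of \<A> c x w))) \<and>
     (\<forall>w w'. smooth_on (snd c ` fst c) (\<lambda>q.
        g (chart_inv c q) (tangent_of \<A> c (chart_inv c q) w)
                          (tangent_of \<A> c (chart_inv c q) w'))))"

definition riemannian_norm ::
    "('a \<Rightarrow> ('a, 'e) tangent \<Rightarrow> ('a, 'e) tangent \<Rightarrow> real) \<Rightarrow> 'a \<Rightarrow> ('a, 'e) tangent \<Rightarrow> real" where
  "riemannian_norm g x v = sqrt (g x v v)"

section \<open>Tonelli Lagrangians of contact type\<close>

text \<open>A function on TM times the reals is a function of \<open>x\<close>, \<open>v\<close> and \<open>u\<close> whose values matter only for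
  \<open>v \<in> tangent_space \<A> x\<close>.\<close>

type_synonym ('a, 'e) lagrangian = "'a \<Rightarrow> ('a, 'e) tangent \<Rightarrow> real \<Rightarrow> real"

definition local_lagrangian ::
    "('a, 'e::euclidean_space) chart set \<Rightarrow> ('a, 'e) lagrangian \<Rightarrow> ('a, 'e) chart \<Rightarrow>
     'e \<Rightarrow> 'e \<Rightarrow> real \<Rightarrow> real" where
  "local_lagrangian \<A> L c q w u = L (chart_inv c q) (tangent_of \<A> c (chart_inv c q) w) u"

definition C2_lagrangian ::
    "('a, 'e::euclidean_space) chart set \<Rightarrow> ('a, 'e) lagrangian \<Rightarrow> bool" where
  "C2_lagrangian \<A> L \<longleftrightarrow> (\<forall>c\<in>\<A>. Ck_on 2 ((snd c ` fst c) \<times> UNIV \<times> UNIV)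
     (\<lambda>(q, w, u). local_lagrangian \<A> L c q w u))"

text \<open>Positive definiteness of the Hessian along the fibres. It does not depend on the chart,
  because coordinate changes act linearly on each fibre.\<close>

definition L1_convex ::
    "('a, 'e::euclidean_space) chart set \<Rightarrow> ('a, 'e) lagrangian \<Rightarrow> bool" where
  "L1_convex \<A> L \<longleftrightarrow> (\<forall>c\<in>\<A>. \<forall>q\<in>snd c ` fst c. \<forall>w u h. h \<noteq> 0 \<longrightarrow>
     0 < frechet_derivative
           (\<lambda>w'. frechet_derivative (\<lambda>w''. local_lagrangian \<A> L c q w'' u) (at w') h) (at w) h)"

definition L2_superlinear ::
    "('a, 'e::euclidean_space) chart set \<Rightarrow>
     ('a \<Rightarrow> ('a, 'e) tangent \<Rightarrow> ('a, 'e) tangent \<Rightarrow> real) \<Rightarrow> ('a, 'e) lagrangian \<Rightarrow> bool" where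
  "L2_superlinear \<A> g L \<longleftrightarrow> (\<exists>(\<theta>\<^sub>0 :: real \<Rightarrow> real) c\<^sub>0.
     continuous_on {0..} \<theta>\<^sub>0 \<and> (\<forall>r\<ge>0. 0 \<le> \<theta>\<^sub>0 r) \<and>
     filterlim (\<lambda>r. \<theta>\<^sub>0 r / r) at_top at_top \<and> 0 \<le> c\<^sub>0 \<and>
     (\<forall>x. \<forall>v\<in>tangent_space \<A> x. \<theta>\<^sub>0 (riemannian_norm g x v) - c\<^sub>0 \<le> L x v 0))"

section \<open>The contact-type Lax-Oleinik semigroup\<close>

definition abs_continuous_on :: "real \<Rightarrow> real \<Rightarrow> (real \<Rightarrow> 'b::metric_space) \<Rightarrow> bool" where
  "abs_continuous_on a b f \<longleftrightarrow> (\<forall>\<epsilon>>0. \<exists>\<delta>>0. \<forall>I :: (real \<times> real) set.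
     finite I \<and> (\<forall>(r, s)\<in>I. a \<le> r \<and> r \<le> s \<and> s \<le> b) \<and>
     disjoint_family_on (\<lambda>(r, s). {r<..<s}) I \<and> (\<Sum>(r, s)\<in>I. s - r) < \<delta>
     \<longrightarrow> (\<Sum>(r, s)\<in>I. dist (f r) (f s)) < \<epsilon>)"

text \<open>Arcs are functions on all of the reals; only their values on \<open>{0..t}\<close> matter.\<close>

definition ac_arcs ::
    "('a::topological_space, 'e::euclidean_space) chart set \<Rightarrow> real \<Rightarrow> 'a \<Rightarrow> (real \<Rightarrow> 'a) set" where
  "ac_arcs \<A> t x = {\<xi>. continuous_on {0..t} \<xi> \<and> \<xi> t = x \<and>
     (\<forall>c\<in>\<A>. \<forall>a b. 0 \<le> a \<and> a \<le> b \<and> b \<le> t \<and> \<xi> ` {a..b} \<subseteq> fst c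
        \<longrightarrow> abs_continuous_on a b (snd c \<circ> \<xi>))}"

definition velocity ::
    "('a, 'e::euclidean_space) chart set \<Rightarrow> (real \<Rightarrow> 'a) \<Rightarrow> real \<Rightarrow> ('a, 'e) tangent" where
  "velocity \<A> \<xi> s = (\<lambda>c. if c \<in> \<A> \<and> \<xi> s \<in> fst c
     then vector_derivative (snd c \<circ> \<xi>) (at s) else 0)"

definition caratheodory_solution ::
    "('a, 'e::euclidean_space) chart set \<Rightarrow> ('a, 'e) lagrangian \<Rightarrow> real \<Rightarrow> (real \<Rightarrow> 'a) \<Rightarrow> real \<Rightarrow>
     (real \<Rightarrow> real) \<Rightarrow> bool" where
  "caratheodory_solution \<A> L t \<xi> u\<^sub>0 u \<longleftrightarrow> abs_continuous_on 0 t u \<and> u 0 = u\<^sub>0 \<and>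
     (AE s in lebesgue. s \<in> {0..t} \<longrightarrow>
        (u has_real_derivative L (\<xi> s) (velocity \<A> \<xi> s) (u s)) (at s within {0..t}))"

text \<open>Under (L1)-(L3), if \<open>L(\<xi>, \<xi>', 0)\<close> is integrable, the solution is unique on \<open>{0..t}\<close>. Its values
  elsewhere are irrelevant, but unconstrained, hence \<open>SOME\<close> and not \<open>THE\<close>.\<close>

definition u_arc ::
    "('a, 'e::euclidean_space) chart set \<Rightarrow> ('a, 'e) lagrangian \<Rightarrow> real \<Rightarrow> ('a \<Rightarrow> real) \<Rightarrow>
     (real \<Rightarrow> 'a) \<Rightarrow> real \<Rightarrow> real" where
  "u_arc \<A> L t \<phi> \<xi> = (SOME u. caratheodory_solution \<A> L t \<xi> (\<phi> (\<xi> 0)) u)"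

definition action ::
    "('a, 'e::euclidean_space) chart set \<Rightarrow> ('a, 'e) lagrangian \<Rightarrow> real \<Rightarrow> ('a \<Rightarrow> real) \<Rightarrow>
     (real \<Rightarrow> 'a) \<Rightarrow> ereal" where
  "action \<A> L t \<phi> \<xi> =
     (if set_integrable lebesgue {0..t} (\<lambda>s. L (\<xi> s) (velocity \<A> \<xi> s) 0)
      then ereal (\<phi> (\<xi> 0) +
             (LINT s:{0..t}|lebesgue. L (\<xi> s) (velocity \<A> \<xi> s) (u_arc \<A> L t \<phi> \<xi> s)))
      else \<infinity>)"

text \<open>The infimum is finite under (L1)-(L3).\<close>

definition lax_oleinik ::
    "('a::topological_space, 'e::euclidean_space) chart set \<Rightarrow> ('a, 'e) lagrangian \<Rightarrow> real \<Rightarrow>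
     ('a \<Rightarrow> real) \<Rightarrow> 'a \<Rightarrow> real" where
  "lax_oleinik \<A> L t \<phi> = (if t = 0 then \<phi>
     else (\<lambda>x. real_of_ereal (INF \<xi>\<in>ac_arcs \<A> t x. action \<A> L t \<phi> \<xi>)))"

section \<open>Topological entropy of a semigroup on a metric space\<close>

definition bowen_ball ::
    "'x metric \<Rightarrow> (real \<Rightarrow> 'x \<Rightarrow> 'x) \<Rightarrow> 'x \<Rightarrow> real \<Rightarrow> real \<Rightarrow> 'x set" where
  "bowen_ball X T x t \<epsilon> = {y \<in> mspace X. \<forall>s\<in>{0..t}. mdist X (T s y) (T s x) < \<epsilon>}"

text \<open>\<open>\<infinity>\<close> if no finite set spans.\<close>

definition spanning_number ::
    "'x metric \<Rightarrow> (real \<Rightarrow> 'x \<Rightarrow> 'x) \<Rightarrow> real \<Rightarrow> real \<Rightarrow> 'x set \<Rightarrow> enat" where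
  "spanning_number X T t \<epsilon> K =
     (INF E \<in> {E. finite E \<and> E \<subseteq> mspace X \<and> K \<subseteq> (\<Union>x\<in>E. bowen_ball X T x t \<epsilon>)}. enat (card E))"

fun log_enat :: "enat \<Rightarrow> ereal" where
  "log_enat (enat n) = (if n = 0 then -\<infinity> else ereal (ln (real n)))"
| "log_enat \<infinity> = \<infinity>"

definition entropy_on ::
    "'x metric \<Rightarrow> (real \<Rightarrow> 'x \<Rightarrow> 'x) \<Rightarrow> 'x set \<Rightarrow> ereal" where
  "entropy_on X T K = Lim (at_right 0)
     (\<lambda>\<epsilon>::real. Limsup at_top (\<lambda>t::real. ereal (1 / t) * log_enat (spanning_number X T t \<epsilon> K)))"

definition h_top :: "'x metric \<Rightarrow> (real \<Rightarrow> 'x \<Rightarrow> 'x) \<Rightarrow> ereal" where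
  "h_top X T = (SUP K \<in> {K. compactin (mtopology_of X) K}. entropy_on X T K)"

text \<open>C(M) with the supremum metric.\<close>

abbreviation CM :: "('a::topological_space \<Rightarrow> real) metric" where
  "CM \<equiv> cfunspace euclidean euclidean_metric"

end

theory Submission
  imports Defs
begin

text \<open>The lower bound comes from one estimate: the semigroup expands vertical translations. If
  \<open>T\<close> denotes the semigroup, then \<open>T t (\<phi> + \<delta>) \<ge> T t \<phi> + \<delta> * exp
  (\<lambda> * t)\<close> for \<open>\<delta> \<ge> 0\<close>. Fix an arc \<open>\<xi>\<close> and let
  \<open>u\<close> solve \<open>u' = L(\<xi>, \<xi>', u)\<close> with \<open>u 0 = \<phi> (\<xi> 0)\<close>. As
  \<open>L\<close> grows in its last variable at least at rate \<open>\<lambda>\<close>, the function \<open>u s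
  + \<delta> * exp (\<lambda> * s)\<close> is a subsolution of the same equation, so the solution that starts at
  \<open>\<phi> (\<xi> 0) + \<delta>\<close> stays above it (\<open>u_arc_expansion\<close>). The action of an
  arc is the final value of its solution (\<open>action_eq_u_arc\<close>), and the infimum over all arcs gives
  the estimate (\<open>lax_oleinik_expansion\<close>).

Consequently two points \<open>\<phi>\<^sub>0 + \<delta>\<close> and \<open>\<phi>\<^sub>0 + \<delta>'\<close>
  of the segment are at distance at least \<open>exp (\<lambda> * t) * \<bar>\<delta> - \<delta>'\<bar>\<close>
  at time \<open>t\<close>. A Bowen ball of radius \<open>\<epsilon>\<close> therefore contains only points of
  the segment whose parameters lie in an interval of length \<open>4 * \<epsilon> * exp (- \<lambda> *
  t)\<close>, and at least \<open>a * exp (\<lambda> * t) / (4 * \<epsilon>)\<close> balls are needed to cover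
  the segment (\<open>entropy_on_expanding_arc\<close>). The exponential growth rate of this number is
  \<open>\<lambda>\<close>. The second claim is the first one for the compact segment of the constants between 0
  and 1.

Most of the work is to make sense of the solution along an arc that is only absolutely continuous. Such an arc
  must have a velocity at almost every time, otherwise the values of \<open>L\<close> along it would be
  arbitrary; this is Lebesgue's differentiability theorem (\<open>abs_continuous_on_differentiable\<close>),
  which is derived here from Vitali's covering theorem and the differentiability of indefinite integrals. The
  same covering argument shows that an absolutely continuous function with nonnegative derivative almost
  everywhere increases, which gives the fundamental theorem of calculus and the comparison principle. Solutions
  exist by Picard iteration (\<open>caratheodory_existence\<close>), once \<open>L\<close> is known to be
  measurable along the arc (\<open>lagrangian_along_arc_measurable\<close>). Finally the infimum that defines
  the semigroup is finite: it is bounded below because \<open>L(x, v, 0)\<close> is, and above by the arcs at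
  rest (\<open>action_INF_bounds\<close>).\<close>

section \<open>Vitali coverings and absolutely continuous functions\<close>

text \<open>Absolute continuity is defined through finite families of pairs of end points, whereas covering
  theorems and additivity are available for divisions into closed intervals; this lemma translates between the
  two.\<close>

lemma abs_continuous_on_division:
  fixes f :: "real \<Rightarrow> 'b::metric_space"
  assumes "abs_continuous_on a b f" "0 < e"
  obtains d where "0 < d"
    "\<And>D. \<lbrakk>D division_of \<Union>D; \<Union>D \<subseteq> {a..b}; (\<Sum>K\<in>D. measure lborel K) < d\<rbrakk>
       \<Longrightarrow> (\<Sum>K\<in>D. dist (f (Inf K)) (f (Sup K))) < e"
proof -
  obtain d where d: "0 < d" and ac: "\<And>I :: (real \<times> real) set.
     finite I \<Longrightarrow> (\<forall>(r, s)\<in>I. a \<le> r \<and> r \<le> s \<and> s \<le> b) \<Longrightarrow>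
     disjoint_family_on (\<lambda>(r, s). {r<..<s}) I \<Longrightarrow> (\<Sum>(r, s)\<in>I. s - r) < d
     \<Longrightarrow> (\<Sum>(r, s)\<in>I. dist (f r) (f s)) < e"
    using assms unfolding abs_continuous_on_def by meson
  have "(\<Sum>K\<in>D. dist (f (Inf K)) (f (Sup K))) < e"
    if D: "D division_of \<Union>D" "\<Union>D \<subseteq> {a..b}" "(\<Sum>K\<in>D. measure lborel K) < d" for D
  proof -
    have form: "\<exists>u v. u \<le> v \<and> K = {u..v}" if "K \<in> D" for K
    proof -
      obtain u v where "K = cbox u v" "K \<noteq> {}" using division_ofD(3,4)[OF D(1) \<open>K \<in> D\<close>] by blast
      then show ?thesis by auto
    qed
    let ?h = "\<lambda>K::real set. (Inf K, Sup K)"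
    have inj: "inj_on ?h D"
    proof (rule inj_onI)
      fix K K' assume "K \<in> D" "K' \<in> D" "?h K = ?h K'"
      then show "K = K'" using form[of K] form[of K'] by auto
    qed
    have "(\<Sum>(r, s)\<in>?h ` D. dist (f r) (f s)) < e"
    proof (rule ac)
      show "finite (?h ` D)" using D(1) by blast
      have "a \<le> Inf K \<and> Inf K \<le> Sup K \<and> Sup K \<le> b" if K: "K \<in> D" for K
      proof -
        obtain u v where uv: "u \<le> v" "K = {u..v}" using form K by blast
        moreover have "K \<subseteq> {a..b}" using D(2) K by blast
        ultimately show ?thesis by auto
      qed
      then show "\<forall>(r, s)\<in>?h ` D. a \<le> r \<and> r \<le> s \<and> s \<le> b" by auto
      show "disjoint_family_on (\<lambda>(r, s). {r<..<s}) (?h ` D)"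
        unfolding disjoint_family_on_def
      proof (intro ballI impI, elim imageE, simp only: prod.case)
        fix m n K K' assume K: "K \<in> D" "K' \<in> D" and ne: "(Inf K, Sup K) \<noteq> (Inf K', Sup K')"
        obtain u v where uv: "u \<le> v" "K = {u..v}" using form K by blast
        obtain u' v' where uv': "u' \<le> v'" "K' = {u'..v'}" using form K by blast
        have "interior K \<inter> interior K' = {}" using division_ofD(5)[OF D(1) K] ne by blast
        then show "{Inf K<..<Sup K} \<inter> {Inf K'<..<Sup K'} = {}"
          using uv uv' by simp
      qed
      have "(\<Sum>(r, s)\<in>?h ` D. s - r) = (\<Sum>K\<in>D. Sup K - Inf K)"
        by (simp add: sum.reindex[OF inj])
      also have "\<dots> = (\<Sum>K\<in>D. measure lborel K)"
        using form by (intro sum.cong refl) fastforce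
      finally show "(\<Sum>(r, s)\<in>?h ` D. s - r) < d" using D(3) by simp
    qed
    then show ?thesis by (simp add: sum.reindex[OF inj])
  qed
  then show ?thesis using d that by blast
qed

lemma division_sum_additive:
  fixes f :: "real \<Rightarrow> real"
  assumes "a \<le> b" "D division_of {a..b}"
  shows "(\<Sum>K\<in>D. f (Sup K) - f (Inf K)) = f b - f a"
proof -
  have D: "D division_of {a..b}" by fact
  define p where "p = (\<lambda>K. (Inf K, K)) ` D"
  have form: "\<exists>u v. u \<le> v \<and> K = {u..v}" if "K \<in> D" for K
  proof -
    obtain u v where "K = cbox u v" "K \<noteq> {}" using division_ofD(3,4)[OF D(1) \<open>K \<in> D\<close>] by blast
    then show ?thesis by auto
  qed
  have "p tagged_division_of {a..b}"
  proof (rule tagged_division_ofI)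
    show "finite p" using D unfolding p_def by blast
    show "\<And>x K. (x, K) \<in> p \<Longrightarrow> x \<in> K" "\<And>x K. (x, K) \<in> p \<Longrightarrow> \<exists>a b. K = cbox a b"
      using form unfolding p_def by fastforce+
    show "\<And>x K. (x, K) \<in> p \<Longrightarrow> K \<subseteq> {a..b}" using division_ofD(2)[OF D] unfolding p_def by auto
    show "\<And>x1 K1 x2 K2. (x1, K1) \<in> p \<Longrightarrow> (x2, K2) \<in> p \<Longrightarrow> (x1, K1) \<noteq> (x2, K2) \<Longrightarrow> interior K1 \<inter> interior K2 = {}"
      using division_ofD(5)[OF D] unfolding p_def by fastforce
    show "\<Union>{K. \<exists>x. (x, K) \<in> p} = {a..b}" using division_ofD(6)[OF D] unfolding p_def by (auto simp: image_iff)
  qed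
  from additive_tagged_division_1[OF assms(1) this, of f] show ?thesis
    unfolding p_def by (subst (asm) sum.reindex) (auto simp: inj_on_def)
qed

text \<open>Vitali's covering theorem in the form needed for interval functions: if almost every point lies in
  arbitrarily short intervals with a property \<open>P\<close>, then the whole interval has a finite division of
  which all members satisfy \<open>P\<close>, up to a part of small total length.\<close>

lemma Vitali_division:
  fixes a b :: real
  assumes ab: "a \<le> b" and e: "0 < e" and N: "negligible N"
    and cov: "\<And>x d. \<lbrakk>a < x; x < b; x \<notin> N; 0 < d\<rbrakk> \<Longrightarrow> \<exists>r s. P r s \<and> r < x \<and> x < s \<and> s - r < d"
  obtains D D' where "D division_of {a..b}" "D' \<subseteq> D"
    "\<And>K. K \<in> D' \<Longrightarrow> \<exists>r s. P r s \<and> r < s \<and> K = {r..s}" "(\<Sum>K\<in>D - D'. measure lborel K) < e"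
proof -
  define I where "I = {(r, s). P r s \<and> a \<le> r \<and> r < s \<and> s \<le> b}"
  define cc where "cc = (\<lambda>(r, s). (r + s) / 2 :: real)"
  define rr where "rr = (\<lambda>(r, s). (s - r) / 2 :: real)"
  have ball: "ball (cc i) (rr i) = {fst i<..<snd i}" for i
    by (cases i) (auto simp: cc_def rr_def ball_def dist_real_def abs_less_iff field_simps)
  obtain C where C: "countable C" "C \<subseteq> I"
     "pairwise (\<lambda>i j. disjnt (ball (cc i) (rr i)) (ball (cc j) (rr j))) C"
     "negligible (({a<..<b} - N) - (\<Union>i \<in> C. ball (cc i) (rr i)))"
  proof (rule Vitali_covering_theorem_balls[of "{a<..<b} - N" I cc rr])
    fix x d assume x: "x \<in> {a<..<b} - N" and d: "0 < (d::real)"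
    \<comment> \<open>intervals around \<open>x\<close> that are shorter than \<open>?d\<close> stay inside \<open>{a..b}\<close>\<close>
    let ?d = "Min {d, x - a, b - x}"
    have "0 < ?d" using x d by auto
    then obtain r s where rs: "P r s" "r < x" "x < s" "s - r < ?d"
      using cov[of x ?d] x by auto
    then have "(r, s) \<in> I" by (auto simp: I_def)
    moreover have "rr (r, s) < d" using rs by (auto simp: rr_def)
    ultimately show "\<exists>i. i \<in> I \<and> x \<in> ball (cc i) (rr i) \<and> rr i < d"
      using rs by (intro exI[of _ "(r, s)"]) (simp add: ball)
  qed
  let ?B = "\<lambda>i. {fst i<..<snd i :: real}"
  have C3: "pairwise (\<lambda>i j. disjnt (?B i) (?B j)) C"
    and C4: "negligible (({a<..<b} - N) - (\<Union>i \<in> C. ?B i))"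
    using C(3,4) by (simp_all add: ball)
  have sub: "?B i \<subseteq> {a<..<b}" if "i \<in> C" for i using C(2) that by (fastforce simp: I_def)
  have Bm: "?B i \<in> lmeasurable" for i by simp
  have UB: "(\<Union>i\<in>C. ?B i) \<in> lmeasurable"
    by (rule fmeasurableI2[of "{a<..<b}"]) (use sub C(1) in \<open>auto intro!: sets.countable_UN'\<close>)
  have "measure lebesgue (\<Union>i\<in>C. ?B i) = measure lebesgue {a<..<b}"
  proof (rule measure_negligible_symdiff)
    show "{a<..<b} \<in> lmeasurable" by simp
    have "((\<Union>i\<in>C. ?B i) - {a<..<b}) = {}" using sub by blast
    moreover have "{a<..<b} - (\<Union>i\<in>C. ?B i) \<subseteq> (({a<..<b} - N) - (\<Union>i \<in> C. ?B i)) \<union> N" by blast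
    ultimately show "negligible (({a<..<b} - (\<Union>i\<in>C. ?B i)) \<union> ((\<Union>i\<in>C. ?B i) - {a<..<b}))"
      using C4 N by (metis Un_empty_right negligible_Un negligible_subset)
  qed
  also have "\<dots> = b - a" using ab by simp
  finally have mU: "measure lebesgue (\<Union>i\<in>C. ?B i) = b - a" .
  obtain F where F: "F \<subseteq> ?B ` C" "finite F" "measure lebesgue (\<Union>i\<in>C. ?B i) - e < measure lebesgue (\<Union>F)"
  proof (rule measure_countable_Union_approachable[of "?B ` C" e "b - a"])
    show "countable (?B ` C)" using C(1) by simp
    show "measure lebesgue (\<Union>D') \<le> b - a" if "D' \<subseteq> ?B ` C" "finite D'" for D'
    proof -
      have "measure lebesgue (\<Union>D') \<le> measure lebesgue (\<Union>i\<in>C. ?B i)"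
        using that by (intro measure_mono_fmeasurable UB) (auto intro!: sets.finite_Union)
      then show ?thesis using mU by simp
    qed
  qed (use e in auto)
  obtain C' where C': "C' \<subseteq> C" "finite C'" "F = ?B ` C'"
    using finite_subset_image[OF F(2,1)] by blast
  define D' where "D' = (\<lambda>i. {fst i..snd i}) ` C'"
  have lt: "fst i < snd i" "a \<le> fst i" "snd i \<le> b" "P (fst i) (snd i)" if "i \<in> C'" for i
    using C(2) C'(1) that by (auto simp: I_def)
  have div: "D' division_of \<Union>D'"
  proof (rule division_ofI)
    show "finite D'" using C' by (simp add: D'_def)
    show "\<And>K. K \<in> D' \<Longrightarrow> K \<subseteq> \<Union>D'" by blast
    show "\<And>K. K \<in> D' \<Longrightarrow> K \<noteq> {}" "\<And>K. K \<in> D' \<Longrightarrow> \<exists>a b. K = cbox a b"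
      using lt by (fastforce simp: D'_def)+
    show "interior K1 \<inter> interior K2 = {}" if K: "K1 \<in> D'" "K2 \<in> D'" "K1 \<noteq> K2" for K1 K2
    proof -
      obtain i j where "i \<in> C'" "j \<in> C'" "K1 = {fst i..snd i}" "K2 = {fst j..snd j}" "i \<noteq> j"
        using K by (auto simp: D'_def)
      moreover from this have "disjnt (?B i) (?B j)" using C3 C'(1) unfolding pairwise_def by blast
      ultimately show ?thesis by (simp add: disjnt_def)
    qed
  qed simp
  have sub': "\<Union>D' \<subseteq> cbox a b" using lt by (fastforce simp: D'_def)
  obtain D where D: "D' \<subseteq> D" "D division_of cbox a b"
    using partial_division_extend_interval[OF div sub'] by blast
  have "(\<Sum>K\<in>D'. measure lborel K) = (\<Sum>i\<in>C'. snd i - fst i)"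
  proof -
    have "inj_on (\<lambda>i. {fst i..snd i}) C'"
      using lt by (fastforce intro!: inj_onI simp: prod_eq_iff)
    then show ?thesis unfolding D'_def using lt(1)
      by (subst sum.reindex) (auto intro!: sum.cong simp: less_imp_le)
  qed
  also have "\<dots> = (\<Sum>i\<in>C'. measure lebesgue (?B i))" using lt(1)
    by (intro sum.cong) (auto simp: less_imp_le)
  also have "\<dots> = measure lebesgue (\<Union>i\<in>C'. ?B i)"
    using C' C3 by (intro measure_UNION'[symmetric] Bm) (auto intro: pairwise_subset)
  finally have "(\<Sum>K\<in>D'. measure lborel K) > b - a - e" using F(3) C'(3) mU by simp
  moreover have "(\<Sum>K\<in>D. measure lborel K) = b - a"
    using additive_content_division[OF D(2)] ab by simp
  moreover have "(\<Sum>K\<in>D - D'. measure lborel K) = (\<Sum>K\<in>D. measure lborel K) - (\<Sum>K\<in>D'. measure lborel K)"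
    using D by (intro sum_diff) auto
  ultimately have "(\<Sum>K\<in>D - D'. measure lborel K) < e" by simp
  moreover have "\<exists>r s. P r s \<and> r < s \<and> K = {r..s}" if "K \<in> D'" for K
    using that lt unfolding D'_def by blast
  ultimately show thesis using D that[of D D'] by simp
qed

text \<open>The increment of \<open>f\<close> is the sum of its increments over a division as in the previous
  lemma. On the good intervals these are nonnegative, and absolute continuity makes the contribution of the
  others small.\<close>

lemma abs_continuous_on_mono_Vitali:
  fixes f :: "real \<Rightarrow> real"
  assumes ab: "a \<le> b" and f: "abs_continuous_on a b f" and N: "negligible N"
    and cov: "\<And>x d. \<lbrakk>a < x; x < b; x \<notin> N; 0 < d\<rbrakk> \<Longrightarrow> \<exists>r s. f r \<le> f s \<and> r < x \<and> x < s \<and> s - r < d"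
  shows "f a \<le> f b"
proof (rule field_le_epsilon)
  fix e :: real assume "0 < e"
  then obtain d where d: "0 < d"
    "\<And>D. \<lbrakk>D division_of \<Union>D; \<Union>D \<subseteq> {a..b}; (\<Sum>K\<in>D. measure lborel K) < d\<rbrakk>
       \<Longrightarrow> (\<Sum>K\<in>D. dist (f (Inf K)) (f (Sup K))) < e"
    using abs_continuous_on_division[OF f] by blast
  obtain D D' where D: "D division_of {a..b}" "D' \<subseteq> D"
    "\<And>K. K \<in> D' \<Longrightarrow> \<exists>r s. f r \<le> f s \<and> r < s \<and> K = {r..s}" "(\<Sum>K\<in>D - D'. measure lborel K) < d"
  proof (rule Vitali_division[OF ab d(1) N, of "\<lambda>r s. f r \<le> f s"])
    show "\<exists>r s. f r \<le> f s \<and> r < x \<and> x < s \<and> s - r < h"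
      if "a < x" "x < b" "x \<notin> N" "0 < h" for x h using cov that by blast
  next
    fix D D' assume "D division_of {a..b}" "D' \<subseteq> D"
      "\<And>K. K \<in> D' \<Longrightarrow> \<exists>r s. f r \<le> f s \<and> r < s \<and> K = {r..s}" "(\<Sum>K\<in>D - D'. measure lborel K) < d"
    then show thesis by (rule that)
  qed
  have fin: "finite D" using D(1) by blast
  have div: "(D - D') division_of \<Union>(D - D')" using D(1) division_of_subset by blast
  have sub: "\<Union>(D - D') \<subseteq> {a..b}" using division_ofD(6)[OF D(1)] by blast
  have "(\<Sum>K\<in>D - D'. dist (f (Inf K)) (f (Sup K))) < e" using d(2)[OF div sub D(4)] .
  moreover have "(\<Sum>K\<in>D - D'. f (Sup K) - f (Inf K)) \<ge> - (\<Sum>K\<in>D - D'. dist (f (Inf K)) (f (Sup K)))"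
    unfolding sum_negf[symmetric] by (intro sum_mono) (simp add: dist_real_def)
  moreover have "(\<Sum>K\<in>D'. f (Sup K) - f (Inf K)) \<ge> 0"
    using D(3) by (intro sum_nonneg) fastforce
  moreover have "(\<Sum>K\<in>D. f (Sup K) - f (Inf K)) = f b - f a"
    by (rule division_sum_additive[OF ab D(1)])
  moreover have "(\<Sum>K\<in>D. f (Sup K) - f (Inf K)) = (\<Sum>K\<in>D - D'. f (Sup K) - f (Inf K)) + (\<Sum>K\<in>D'. f (Sup K) - f (Inf K))"
    by (rule sum.subset_diff[OF D(2) fin])
  ultimately show "f a \<le> f b + e" by linarith
qed

section \<open>Indefinite Lebesgue integrals\<close>

lemma abs_continuous_on_subinterval:
  "abs_continuous_on a b f \<Longrightarrow> a \<le> c \<Longrightarrow> d \<le> b \<Longrightarrow> abs_continuous_on c d f"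
  unfolding abs_continuous_on_def
  by (erule all_forward imp_forward ex_forward conj_forward asm_rl | fastforce)+

text \<open>Sums, differences, coordinates and Lipschitz functions are instances of one principle: a function
  inherits absolute continuity from functions that control its increments.\<close>

lemma abs_continuous_on_dominated:
  fixes f :: "real \<Rightarrow> 'b::metric_space" and g :: "real \<Rightarrow> 'c::metric_space" and h :: "real \<Rightarrow> 'd::metric_space"
  assumes f: "abs_continuous_on a b f" and g: "abs_continuous_on a b g" and C: "0 \<le> C"
    and dom: "\<And>x y. \<lbrakk>a \<le> x; x \<le> y; y \<le> b\<rbrakk> \<Longrightarrow> dist (h x) (h y) \<le> C * (dist (f x) (f y) + dist (g x) (g y))"
  shows "abs_continuous_on a b h"
  unfolding abs_continuous_on_def
proof (intro allI impI)
  fix e :: real assume e: "0 < e"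
  define e' where "e' = e / (2 * (C + 1))"
  have e': "0 < e'" using e C by (simp add: e'_def)
  obtain d1 where d1: "0 < d1" "\<And>I :: (real \<times> real) set.
     finite I \<and> (\<forall>(r, s)\<in>I. a \<le> r \<and> r \<le> s \<and> s \<le> b) \<and>
     disjoint_family_on (\<lambda>(r, s). {r<..<s}) I \<and> (\<Sum>(r, s)\<in>I. s - r) < d1
     \<Longrightarrow> (\<Sum>(r, s)\<in>I. dist (f r) (f s)) < e'" using f e' unfolding abs_continuous_on_def by meson
  obtain d2 where d2: "0 < d2" "\<And>I :: (real \<times> real) set.
     finite I \<and> (\<forall>(r, s)\<in>I. a \<le> r \<and> r \<le> s \<and> s \<le> b) \<and>
     disjoint_family_on (\<lambda>(r, s). {r<..<s}) I \<and> (\<Sum>(r, s)\<in>I. s - r) < d2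
     \<Longrightarrow> (\<Sum>(r, s)\<in>I. dist (g r) (g s)) < e'" using g e' unfolding abs_continuous_on_def by meson
  show "\<exists>\<delta>>0. \<forall>I. finite I \<and> (\<forall>(r, s)\<in>I. a \<le> r \<and> r \<le> s \<and> s \<le> b) \<and>
     disjoint_family_on (\<lambda>(r, s). {r<..<s}) I \<and> (\<Sum>(r, s)\<in>I. s - r) < \<delta>
     \<longrightarrow> (\<Sum>(r, s)\<in>I. dist (h r) (h s)) < e"
  proof (intro exI[of _ "min d1 d2"] conjI allI impI)
    show "0 < min d1 d2" using d1 d2 by simp
    fix I :: "(real \<times> real) set"
    assume I: "finite I \<and> (\<forall>(r, s)\<in>I. a \<le> r \<and> r \<le> s \<and> s \<le> b) \<and>
      disjoint_family_on (\<lambda>(r, s). {r<..<s}) I \<and> (\<Sum>(r, s)\<in>I. s - r) < min d1 d2"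
    have "(\<Sum>(r, s)\<in>I. dist (h r) (h s)) \<le> (\<Sum>(r, s)\<in>I. C * (dist (f r) (f s) + dist (g r) (g s)))"
      using I by (intro sum_mono) (auto intro!: dom)
    also have "\<dots> = C * ((\<Sum>(r, s)\<in>I. dist (f r) (f s)) + (\<Sum>(r, s)\<in>I. dist (g r) (g s)))"
      by (simp add: sum_distrib_left[symmetric] sum.distrib[symmetric] case_prod_unfold)
    also have "\<dots> \<le> C * (e' + e')"
      using d1(2)[of I] d2(2)[of I] I C by (intro mult_left_mono add_mono) auto
    also have "e' + e' = e / (C + 1)" using C by (simp add: e'_def divide_simps)
    also have "C * (e / (C + 1)) = e * (C / (C + 1))" by simp
    also have "\<dots> < e * 1" using C e by (intro mult_strict_left_mono) auto
    also have "\<dots> = e" by simp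
    finally show "(\<Sum>(r, s)\<in>I. dist (h r) (h s)) < e" .
  qed
qed

lemma abs_continuous_on_ident: "abs_continuous_on a b (\<lambda>x::real. x)"
  unfolding abs_continuous_on_def
proof (intro allI impI)
  fix e :: real assume "0 < e"
  have "(\<Sum>(r, s)\<in>I. dist r s) = (\<Sum>(r, s)\<in>I. s - r)" if "\<forall>(r, s)\<in>I. a \<le> r \<and> r \<le> s \<and> s \<le> b" for I
    using that by (intro sum.cong) (auto simp: dist_real_def)
  then show "\<exists>\<delta>>0. \<forall>I. finite I \<and> (\<forall>(r, s)\<in>I. a \<le> r \<and> r \<le> s \<and> s \<le> b) \<and>
     disjoint_family_on (\<lambda>(r, s). {r<..<s}) I \<and> (\<Sum>(r, s)\<in>I. s - r) < \<delta>
     \<longrightarrow> (\<Sum>(r, s)\<in>I. dist r s) < e" using \<open>0 < e\<close> by (intro exI[of _ e]) auto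
qed

lemma abs_continuous_on_lipschitz:
  fixes h :: "real \<Rightarrow> 'd::metric_space"
  assumes "0 \<le> C" "\<And>x y. \<lbrakk>a \<le> x; x \<le> y; y \<le> b\<rbrakk> \<Longrightarrow> dist (h x) (h y) \<le> C * (y - x)"
  shows "abs_continuous_on a b h"
proof (rule abs_continuous_on_dominated[OF abs_continuous_on_ident abs_continuous_on_ident assms(1)])
  fix x y assume xy: "a \<le> x" "x \<le> y" "y \<le> b"
  have "C * (y - x) \<le> C * (dist x y + dist x y)" using assms(1) xy by (intro mult_left_mono) (auto simp: dist_real_def)
  then show "dist (h x) (h y) \<le> C * (dist x y + dist x y)" using assms(2)[OF xy] by linarith
qed

lemma DERIV_imp_abs_continuous_on:
  fixes f :: "real \<Rightarrow> real"
  assumes d: "\<And>x S. (f has_real_derivative f' x) (at x within S)" and c: "continuous_on {a..b} f'"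
  shows "abs_continuous_on a b f"
proof -
  have "bounded (f' ` {a..b})" by (intro compact_imp_bounded compact_continuous_image c) simp
  then obtain C where C: "\<forall>x\<in>{a..b}. \<bar>f' x\<bar> \<le> C" unfolding bounded_iff by auto
  show ?thesis
  proof (rule abs_continuous_on_lipschitz[of "max C 0"])
    fix x y assume xy: "a \<le> x" "x \<le> y" "y \<le> b"
    have "norm (f x - f y) \<le> max C 0 * norm (x - y)"
      by (rule field_differentiable_bound[of "{a..b}" f f'])
         (use d C xy in \<open>auto simp: le_max_iff_disj\<close>)
    then show "dist (f x) (f y) \<le> max C 0 * (y - x)" using xy by (simp add: dist_norm)
  qed simp
qed

lemma abs_continuous_on_add:
  fixes f g :: "real \<Rightarrow> 'b::real_normed_vector"
  assumes "abs_continuous_on a b f" "abs_continuous_on a b g"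
  shows "abs_continuous_on a b (\<lambda>x. f x + g x)"
  by (rule abs_continuous_on_dominated[OF assms, of 1]) (simp_all add: dist_triangle_add)

lemma abs_continuous_on_diff:
  fixes f g :: "real \<Rightarrow> 'b::real_normed_vector"
  assumes "abs_continuous_on a b f" "abs_continuous_on a b g"
  shows "abs_continuous_on a b (\<lambda>x. f x - g x)"
proof (rule abs_continuous_on_dominated[OF assms, of 1])
  fix x y
  show "dist (f x - g x) (f y - g y) \<le> 1 * (dist (f x) (f y) + dist (g x) (g y))"
    using dist_triangle_add[of "f x" "- g x" "f y" "- g y"]
    by (simp add: dist_norm[of "- g x" "- g y"] dist_norm[of "g x" "g y"] norm_minus_commute)
qed simp

lemma abs_continuous_on_continuous:
  fixes f :: "real \<Rightarrow> 'b::metric_space"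
  assumes "abs_continuous_on a b f"
  shows "continuous_on {a..b} f"
  unfolding continuous_on_iff
proof (intro ballI allI impI)
  fix x e :: real assume x: "x \<in> {a..b}" and e: "0 < e"
  obtain d where d: "0 < d" and ac: "\<And>I :: (real \<times> real) set.
     finite I \<and> (\<forall>(r, s)\<in>I. a \<le> r \<and> r \<le> s \<and> s \<le> b) \<and>
     disjoint_family_on (\<lambda>(r, s). {r<..<s}) I \<and> (\<Sum>(r, s)\<in>I. s - r) < d
     \<Longrightarrow> (\<Sum>(r, s)\<in>I. dist (f r) (f s)) < e" using assms e unfolding abs_continuous_on_def by meson
  have "dist (f y) (f x) < e" if y: "y \<in> {a..b}" "dist y x < d" for y
  proof (cases "x \<le> y")
    case True
    then show ?thesis using ac[of "{(x, y)}"] x y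
      by (auto simp: disjoint_family_on_def dist_real_def dist_commute)
  next
    case False
    then show ?thesis using ac[of "{(y, x)}"] x y
      by (auto simp: disjoint_family_on_def dist_real_def dist_commute)
  qed
  then show "\<exists>d>0. \<forall>y\<in>{a..b}. dist y x < d \<longrightarrow> dist (f y) (f x) < e" using d by blast
qed

text \<open>Derivatives are used through intervals that contain the point in their interior, since these are
  the intervals that a Vitali covering provides.\<close>

lemma has_real_derivative_straddle:
  fixes F :: "real \<Rightarrow> real"
  assumes "(F has_real_derivative D) (at x)" "0 < e"
  obtains d where "0 < d"
    "\<And>r s. \<lbrakk>r < x; x < s; s - r < d\<rbrakk> \<Longrightarrow> \<bar>F s - F r - D * (s - r)\<bar> \<le> e * (s - r)"
proof -
  have "(F has_derivative (*) D) (at x)" using assms(1) by (simp add: has_field_derivative_def)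
  then obtain d where d: "0 < d" and D: "\<And>y. norm (y - x) < d \<Longrightarrow> norm (F y - F x - D * (y - x)) \<le> e * norm (y - x)"
    using assms(2) unfolding has_derivative_at_alt by blast
  have "\<bar>F s - F r - D * (s - r)\<bar> \<le> e * (s - r)" if "r < x" "x < s" "s - r < d" for r s
  proof -
    have 1: "\<bar>F s - F x - D * (s - x)\<bar> \<le> e * (s - x)" using D[of s] that by auto
    have 2: "\<bar>F r - F x - D * (r - x)\<bar> \<le> e * (x - r)" using D[of r] that by auto
    have 3: "F s - F r - D * (s - r) = (F s - F x - D * (s - x)) - (F r - F x - D * (r - x))"
      by (simp add: algebra_simps)
    have "e * (s - r) = e * (s - x) + e * (x - r)" by (simp add: algebra_simps)
    then show ?thesis unfolding 3 using 1 2 by linarith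
  qed
  then show thesis using that d by blast
qed

lemma AE_lebesgue_neq: "AE x in lebesgue. x \<noteq> (c::real)"
  by (rule AE_completion) (rule AE_lborel_singleton)

lemma set_integral_atLeastAtMost_diff:
  fixes g :: "real \<Rightarrow> real"
  assumes g: "set_integrable lebesgue {a..b} g" and rs: "a \<le> r" "r \<le> s" "s \<le> b"
  shows "(LINT x:{a..s}|lebesgue. g x) - (LINT x:{a..r}|lebesgue. g x) = (LINT x:{r<..s}|lebesgue. g x)"
proof -
  have i1: "set_integrable lebesgue {a..r} g" by (rule set_integrable_subset[OF g]) (use rs in auto)
  have i2: "set_integrable lebesgue {r<..s} g" by (rule set_integrable_subset[OF g]) (use rs in auto)
  have "{a..s} = {a..r} \<union> {r<..s}" using rs by auto
  moreover have "{a..r} \<inter> {r<..s} = {}" by auto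
  ultimately show ?thesis using set_integral_Un[OF _ i1 i2] by simp
qed

text \<open>Truncation at height \<open>n\<close>: by dominated convergence the part of
  \<open>\<bar>g\<bar>\<close> above height \<open>n\<close> has small integral for large \<open>n\<close>, and
  the part below it contributes at most \<open>n\<close> times the total length of the intervals.\<close>

lemma indefinite_integral_abs_continuous:
  fixes g :: "real \<Rightarrow> real"
  assumes g: "set_integrable lebesgue {a..b} g"
  shows "abs_continuous_on a b (\<lambda>x. LINT s:{a..x}|lebesgue. g s)"
  unfolding abs_continuous_on_def
proof (intro allI impI)
  fix e :: real assume e: "0 < e"
  define G where "G = (\<lambda>s. indicator {a..b} s * g s)"
  have G: "integrable lebesgue G" using g by (simp add: set_integrable_def G_def)
  have Gm [measurable]: "G \<in> borel_measurable lebesgue" using G by auto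
  let ?t = "\<lambda>n::nat. \<lambda>s. indicator {s. \<bar>G s\<bar> > real n} s * \<bar>G s\<bar>"
  have tm: "?t n \<in> borel_measurable lebesgue" for n
    by (rule borel_measurable_times) (auto intro!: borel_measurable_indicator)
  have "(\<lambda>n. integral\<^sup>L lebesgue (?t n)) \<longlonglongrightarrow> integral\<^sup>L lebesgue (\<lambda>s::real. 0::real)"
  proof (rule integral_dominated_convergence[where w = "\<lambda>s. \<bar>G s\<bar>"])
    show "AE s in lebesgue. (\<lambda>n. ?t n s) \<longlonglongrightarrow> 0"
    proof (rule AE_I2)
      fix s
      have "\<forall>\<^sub>F n in sequentially. ?t n s = 0"
      proof -
        obtain m where "\<bar>G s\<bar> \<le> real m" using real_arch_simple by blast
        then show ?thesis by (intro eventually_sequentiallyI[of m]) (auto simp: indicator_def)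
      qed
      then show "(\<lambda>n. ?t n s) \<longlonglongrightarrow> 0" by (rule tendsto_eventually)
    qed
    show "AE s in lebesgue. norm (?t n s) \<le> \<bar>G s\<bar>" for n by (auto simp: indicator_def)
  qed (use G tm in auto)
  then have "\<forall>\<^sub>F n in sequentially. integral\<^sup>L lebesgue (?t n) < e / 2"
    using e by (intro order_tendstoD(2)[of _ 0]) simp_all
  then obtain n where n: "integral\<^sup>L lebesgue (?t n) < e / 2" by (auto simp: eventually_sequentially)
  have ti: "integrable lebesgue (?t n)"
    by (rule Bochner_Integration.integrable_bound[OF G tm]) (auto simp: indicator_def)
  show "\<exists>\<delta>>0. \<forall>I. finite I \<and> (\<forall>(r, s)\<in>I. a \<le> r \<and> r \<le> s \<and> s \<le> b) \<and>
     disjoint_family_on (\<lambda>(r, s). {r<..<s}) I \<and> (\<Sum>(r, s)\<in>I. s - r) < \<delta>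
     \<longrightarrow> (\<Sum>(r, s)\<in>I. dist (LINT x:{a..r}|lebesgue. g x) (LINT x:{a..s}|lebesgue. g x)) < e"
  proof (intro exI[of _ "e / (2 * (real n + 1))"] conjI allI impI)
    show "0 < e / (2 * (real n + 1))" using e by simp
    fix I :: "(real \<times> real) set"
    assume I: "finite I \<and> (\<forall>(r, s)\<in>I. a \<le> r \<and> r \<le> s \<and> s \<le> b) \<and>
      disjoint_family_on (\<lambda>(r, s). {r<..<s}) I \<and> (\<Sum>(r, s)\<in>I. s - r) < e / (2 * (real n + 1))"
    let ?w = "\<lambda>(r, s) x. indicator {r<..<s} x * \<bar>G x\<bar> :: real"
    have wi: "integrable lebesgue (?w i)" for i
      using integrable_mult_indicator[of "{fst i<..<snd i}" lebesgue "\<lambda>x. \<bar>G x\<bar>"] G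
      by (simp add: split_beta)
    have "(\<Sum>(r, s)\<in>I. dist (LINT x:{a..r}|lebesgue. g x) (LINT x:{a..s}|lebesgue. g x)) \<le> (\<Sum>i\<in>I. integral\<^sup>L lebesgue (?w i))"
    proof (rule sum_mono)
      fix i assume "i \<in> I"
      obtain r s where i: "i = (r, s)" by (cases i)
      have rs: "a \<le> r" "r \<le> s" "s \<le> b" using I \<open>i \<in> I\<close> i by auto
      have "dist (LINT x:{a..r}|lebesgue. g x) (LINT x:{a..s}|lebesgue. g x) = \<bar>LINT x:{r<..s}|lebesgue. g x\<bar>"
        using set_integral_atLeastAtMost_diff[OF g rs] by (simp add: dist_real_def)
      also have "(LINT x:{r<..s}|lebesgue. g x) = integral\<^sup>L lebesgue (\<lambda>x. indicator {r<..s} x * G x)"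
        unfolding set_lebesgue_integral_def G_def using rs
        by (intro Bochner_Integration.integral_cong) (auto simp: indicator_def)
      also have "\<bar>\<dots>\<bar> \<le> integral\<^sup>L lebesgue (\<lambda>x. \<bar>indicator {r<..s} x * G x\<bar>)" by simp
      also have "\<dots> = integral\<^sup>L lebesgue (?w (r, s))"
      proof (rule integral_cong_AE)
        show "AE x in lebesgue. \<bar>indicator {r<..s} x * G x\<bar> = ?w (r, s) x"
          using AE_lebesgue_neq[of s] by eventually_elim (auto simp: indicator_def)
        show "(\<lambda>x. \<bar>indicator {r<..s} x * G x\<bar>) \<in> borel_measurable lebesgue"
          using integrable_mult_indicator[of "{r<..s}" lebesgue G] G by auto
        show "?w (r, s) \<in> borel_measurable lebesgue" using wi[of "(r, s)"] by blast
      qed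
      finally show "(case i of (r, s) \<Rightarrow> dist (LINT x:{a..r}|lebesgue. g x) (LINT x:{a..s}|lebesgue. g x)) \<le> integral\<^sup>L lebesgue (?w i)"
        by (simp add: i dist_real_def)
    qed
    also have "\<dots> = integral\<^sup>L lebesgue (\<lambda>x. \<Sum>i\<in>I. ?w i x)"
      using wi by (intro Bochner_Integration.integral_sum[symmetric])
    also have "\<dots> \<le> integral\<^sup>L lebesgue (\<lambda>x. ?t n x + (\<Sum>(r, s)\<in>I. real n * indicator {r<..<s} x))"
    proof (rule integral_mono)
      show "integrable lebesgue (\<lambda>x. \<Sum>i\<in>I. ?w i x)" using wi by auto
      show "integrable lebesgue (\<lambda>x. ?t n x + (\<Sum>(r, s)\<in>I. real n * indicator {r<..<s} x))"
        by (intro Bochner_Integration.integrable_add ti Bochner_Integration.integrable_sum)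
           (auto simp: split_beta intro!: integrable_real_indicator emeasure_bounded_finite[unfolded infinity_ennreal_def])
      fix x
      show "(\<Sum>i\<in>I. ?w i x) \<le> ?t n x + (\<Sum>(r, s)\<in>I. real n * indicator {r<..<s} x)"
      proof (cases "\<exists>i\<in>I. x \<in> {fst i<..<snd i}")
        case True
        then obtain i where i: "i \<in> I" "x \<in> {fst i<..<snd i}" by blast
        have other: "x \<notin> {fst j<..<snd j}" if "j \<in> I - {i}" for j
          using I i that unfolding disjoint_family_on_def by (fastforce simp: split_beta)
        have "(\<Sum>j\<in>I. ?w j x) = ?w i x + (\<Sum>j\<in>I - {i}. ?w j x)" using I i by (intro sum.remove) auto
        also have "(\<Sum>j\<in>I - {i}. ?w j x) = 0"
          using other by (intro sum.neutral) (simp add: split_beta)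
        also have "?w i x + 0 \<le> ?t n x + real n" using i by (auto simp: indicator_def split_beta)
        finally have A: "(\<Sum>j\<in>I. ?w j x) \<le> ?t n x + real n" .
        have "real n = real n * indicator {fst i<..<snd i} x" using i by simp
        also have "\<dots> \<le> (\<Sum>(r, s)\<in>I. real n * indicator {r<..<s} x)"
          using member_le_sum[of i I "\<lambda>i. real n * indicator {fst i<..<snd i} x"] I i by (auto simp: split_beta)
        finally show ?thesis using A by linarith
      next
        case False
        then have "(\<Sum>i\<in>I. ?w i x) = 0" by (intro sum.neutral) (simp add: split_beta)
        moreover have "0 \<le> (\<Sum>(r, s)\<in>I. real n * indicator {r<..<s} x)" by (auto intro!: sum_nonneg)
        ultimately show ?thesis by simp
      qed
    qed
    also have "\<dots> = integral\<^sup>L lebesgue (?t n) + integral\<^sup>L lebesgue (\<lambda>x. \<Sum>(r, s)\<in>I. real n * indicator {r<..<s} x)"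
      by (intro Bochner_Integration.integral_add ti Bochner_Integration.integrable_sum)
           (auto simp: split_beta intro!: integrable_real_indicator emeasure_bounded_finite[unfolded infinity_ennreal_def])
    also have "integral\<^sup>L lebesgue (\<lambda>x. \<Sum>(r, s)\<in>I. real n * indicator {r<..<s} x) = (\<Sum>i\<in>I. real n * (snd i - fst i))"
      unfolding split_beta using I
      by (subst Bochner_Integration.integral_sum) (auto intro!: sum.cong integrable_real_indicator simp: split_beta)
    also have "\<dots> = real n * (\<Sum>(r, s)\<in>I. s - r)" by (simp add: sum_distrib_left split_beta)
    also have "\<dots> \<le> (real n + 1) * (e / (2 * (real n + 1)))"
      using I e by (intro mult_mono) (auto intro!: sum_nonneg)
    also have "(real n + 1) * (e / (2 * (real n + 1))) = e / 2" by (simp add: field_simps)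
    finally show "(\<Sum>(r, s)\<in>I. dist (LINT x:{a..r}|lebesgue. g x) (LINT x:{a..s}|lebesgue. g x)) < e"
      using n by simp
  qed
qed

text \<open>Lebesgue's differentiation theorem for cubes gives the derivative from the right. The derivative
  from the left is the derivative from the right of the reflected function.\<close>

lemma indefinite_integral_derivative:
  fixes g :: "real \<Rightarrow> real"
  assumes g: "set_integrable lebesgue {a..b} g"
  obtains N where "negligible N"
    "\<And>x. \<lbrakk>a < x; x < b; x \<notin> N\<rbrakk> \<Longrightarrow> ((\<lambda>x. LINT s:{a..x}|lebesgue. g s) has_real_derivative g x) (at x)"
proof -
  define G where "G = (\<lambda>s. indicator {a..b} s * g s)"
  have G: "integrable lebesgue G" using g by (simp add: set_integrable_def G_def)
  have Gi: "G integrable_on cbox c d" for c d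
    using integrable_mult_indicator[OF _ G, of "cbox c d"] set_lebesgue_integral_eq_integral(1)[of "cbox c d" G]
    by (auto simp: set_integrable_def)
  have Ri: "(\<lambda>s. G (- s)) integrable_on cbox c d" for c d
    using Henstock_Kurzweil_Integration.integrable_reflect_real[where f = G and a = "-d" and b = "-c"] Gi[of "-d" "-c"] by simp
  obtain N1 where N1: "negligible N1" "\<And>x e. \<lbrakk>x \<notin> N1; 0 < e\<rbrakk> \<Longrightarrow>
       \<exists>d>0. \<forall>h. 0 < h \<and> h < d \<longrightarrow> norm(integral (cbox x (x + h *\<^sub>R One)) G /\<^sub>R h ^ DIM(real) - G x) < e"
    using integrable_ccontinuous_explicit[OF Gi] by metis
  obtain N2 where N2: "negligible N2" "\<And>x e. \<lbrakk>x \<notin> N2; 0 < e\<rbrakk> \<Longrightarrow>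
       \<exists>d>0. \<forall>h. 0 < h \<and> h < d \<longrightarrow> norm(integral (cbox x (x + h *\<^sub>R One)) (\<lambda>s. G (- s)) /\<^sub>R h ^ DIM(real) - G (- x)) < e"
    using integrable_ccontinuous_explicit[OF Ri] by metis
  define N where "N = N1 \<union> uminus ` N2"
  have "negligible N" unfolding N_def using N1(1) negligible_differentiable_image_negligible[OF _ N2(1), of uminus]
    by (auto intro!: derivative_intros)
  moreover have "((\<lambda>x. LINT s:{a..x}|lebesgue. g s) has_real_derivative g x) (at x)"
    if x: "a < x" "x < b" "x \<notin> N" for x
  proof -
    let ?P = "\<lambda>x. LINT s:{a..x}|lebesgue. g s"
    have Gx: "G x = g x" using x by (simp add: G_def)
    have P: "?P v - ?P u = integral {u..v} G" if "a \<le> u" "u \<le> v" "v \<le> b" for u v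
    proof -
      have "?P v - ?P u = (LINT x:{u<..v}|lebesgue. g x)" by (rule set_integral_atLeastAtMost_diff[OF g that])
      also have "\<dots> = (LINT x:{u..v}|lebesgue. g x)"
        unfolding set_lebesgue_integral_def
      proof (rule integral_cong_AE)
        show "AE x in lebesgue. indicator {u<..v} x *\<^sub>R g x = indicator {u..v} x *\<^sub>R g x"
          using AE_lebesgue_neq[of u] by eventually_elim (auto simp: indicator_def)
        show "(\<lambda>x. indicator {u<..v} x *\<^sub>R g x) \<in> borel_measurable lebesgue"
          "(\<lambda>x. indicator {u..v} x *\<^sub>R g x) \<in> borel_measurable lebesgue"
          using set_integrable_subset[OF g, of "{u<..v}"] set_integrable_subset[OF g, of "{u..v}"] \<open>a \<le> u\<close> \<open>v \<le> b\<close>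
          unfolding set_integrable_def by (intro borel_measurable_integrable; simp add: subset_iff)+
      qed
      also have "\<dots> = integral {u..v} g"
        by (rule set_lebesgue_integral_eq_integral(2), rule set_integrable_subset[OF g]) (use that in auto)
      also have "\<dots> = integral {u..v} G"
        using that by (intro integral_cong) (auto simp: G_def)
      finally show ?thesis .
    qed
    have "\<exists>d>0. \<forall>h. h \<noteq> 0 \<and> norm (h - 0) < d \<longrightarrow> norm ((?P (x + h) - ?P x) / h - g x) < e" if e: "0 < e" for e
    proof -
      obtain d1 where d1: "0 < d1" "\<And>h. 0 < h \<Longrightarrow> h < d1 \<Longrightarrow> norm (integral {x..x + h} G / h - g x) < e"
        using N1(2)[of x e] e x(3) by (auto simp: N_def Gx divide_inverse_commute)
      have "- x \<notin> N2" using x(3) by (auto simp: N_def image_iff)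
      then obtain d2 where d2: "0 < d2" "\<And>h. 0 < h \<Longrightarrow> h < d2 \<Longrightarrow> norm (integral {-x..-x + h} (\<lambda>s. G (- s)) / h - g x) < e"
        using N2(2)[of "-x" e] e by (auto simp: Gx divide_inverse_commute)
      let ?d = "Min {d1, d2, x - a, b - x}"
      have "norm ((?P (x + h) - ?P x) / h - g x) < e" if h: "h \<noteq> 0" "norm (h - 0) < ?d" for h
      proof (cases "0 < h")
        case True
        then show ?thesis using P[of x "x + h"] d1(2)[of h] h x by auto
      next
        case False
        have eq: "integral {-x..-x + (-h)} (\<lambda>s. G (- s)) = integral {x+h..x} G"
          using Henstock_Kurzweil_Integration.integral_reflect_real[where f = G and a = "x+h" and b = x] by (simp add: algebra_simps)
        have "(?P (x + h) - ?P x) / h = integral {x+h..x} G / (- h)"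
          using P[of "x + h" x] False h x by (simp add: field_simps)
        then show ?thesis using d2(2)[of "-h"] False h unfolding eq by auto
      qed
      moreover have "0 < ?d" using d1 d2 x by auto
      ultimately show ?thesis by blast
    qed
    then show ?thesis unfolding DERIV_def LIM_eq by blast
  qed
  ultimately show thesis using that by blast
qed

section \<open>Differentiability almost everywhere\<close>

text \<open>The bound \<open>- e\<close> on the slopes becomes a nonnegative slope after adding a linear
  function, so that the monotonicity criterion applies; the linear function is then made small.\<close>

lemma abs_continuous_on_derivative_nonneg:
  fixes f :: "real \<Rightarrow> real"
  assumes ab: "a \<le> b" and f: "abs_continuous_on a b f" and N: "negligible N"
    and der: "\<And>x e. \<lbrakk>a < x; x < b; x \<notin> N; 0 < e\<rbrakk> \<Longrightarrow>
      \<forall>d>0. \<exists>r s. - e * (s - r) \<le> f s - f r \<and> r < x \<and> x < s \<and> s - r < d"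
  shows "f a \<le> f b"
proof (rule field_le_epsilon)
  fix e :: real assume e: "0 < e"
  define e' where "e' = e / (b - a + 1)"
  have e': "0 < e'" using e ab by (simp add: e'_def)
  have "f a + e' * a \<le> f b + e' * b"
  proof (rule abs_continuous_on_mono_Vitali[OF ab _ N])
    show "abs_continuous_on a b (\<lambda>x. f x + e' * x)"
      using e' by (intro abs_continuous_on_add f abs_continuous_on_lipschitz[of e'])
        (auto simp: dist_real_def abs_mult simp flip: right_diff_distrib)
    fix x d assume "a < x" "x < b" "x \<notin> N" "0 < (d::real)"
    from der[OF this(1-3) e'] this(4) obtain r s where
      "- e' * (s - r) \<le> f s - f r" "r < x" "x < s" "s - r < d" by blast
    then show "\<exists>r s. f r + e' * r \<le> f s + e' * s \<and> r < x \<and> x < s \<and> s - r < d"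
      by (intro exI[of _ r] exI[of _ s]) (simp add: algebra_simps)
  qed
  moreover have "e' * (b - a) \<le> e" using ab e by (simp add: e'_def field_simps mult_left_mono)
  ultimately show "f a \<le> f b + e" by (simp add: algebra_simps)
qed

lemma integrable_indicator_interval:
  "integrable lebesgue (indicator {u..v::real} :: real \<Rightarrow> real)"
  "integrable lebesgue (indicator {u<..v::real} :: real \<Rightarrow> real)"
  by (intro integrable_real_indicator; auto intro!: emeasure_bounded_finite[unfolded infinity_ennreal_def])+

lemma set_integral_degenerate: "(LINT x:{a..a::real}|lebesgue. g x) = (0::real)"
  unfolding set_lebesgue_integral_def
proof (rule integral_eq_zero_AE)
  show "AE x in lebesgue. indicator {a..a} x *\<^sub>R g x = 0"
    using AE_lebesgue_neq[of a] by eventually_elim (auto simp: indicator_def)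
qed

text \<open>The upper derivate of \<open>f\<close> at \<open>x\<close>: the upper limit of the slopes over
  short intervals with \<open>x\<close> in their interior.\<close>

definition upper_slope :: "(real \<Rightarrow> real) \<Rightarrow> real \<Rightarrow> ereal" where
  "upper_slope f x = (INF n. SUP (r, s) \<in> {(r, s). r < x \<and> x < s \<and> s - r < 1 / (real n + 1)}.
     ereal ((f s - f r) / (s - r)))"

text \<open>For every \<open>f\<close> the supremum of the slopes over the intervals around \<open>x\<close>
  is lower semicontinuous in \<open>x\<close>: a good interval for \<open>x\<close> is good for all of its
  interior points.\<close>

lemma upper_slope_measurable [measurable]: "upper_slope f \<in> borel_measurable borel"
proof -
  have "(\<lambda>x. SUP (r, s) \<in> {(r, s). r < x \<and> x < s \<and> s - r < 1 / (real n + 1)}.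
      ereal ((f s - f r) / (s - r))) \<in> borel_measurable borel" (is "?u \<in> _") for n
  proof (rule borel_measurableI_greater)
    fix y :: ereal
    have "{x. y < ?u x} = (\<Union>(r, s) \<in> {(r, s). s - r < 1 / (real n + 1) \<and> y < ereal ((f s - f r) / (s - r))}. {r<..<s})"
      by (auto simp: less_SUP_iff) blast
    then have "open {x. y < ?u x}" by (auto intro!: open_UN)
    then show "{x \<in> space borel. y < ?u x} \<in> sets borel" by simp
  qed
  then show ?thesis unfolding upper_slope_def by measurable
qed

lemma upper_slope_greaterD:
  assumes "ereal q < upper_slope f x" "0 < d"
  shows "\<exists>r s. q * (s - r) < f s - f r \<and> r < x \<and> x < s \<and> s - r < d"
proof -
  obtain n where n: "1 / (real n + 1) < d"
    using reals_Archimedean[OF assms(2)] by (auto simp: inverse_eq_divide add.commute)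
  have "ereal q < (SUP (r, s) \<in> {(r, s). r < x \<and> x < s \<and> s - r < 1 / (real n + 1)}. ereal ((f s - f r) / (s - r)))"
    using assms(1) unfolding upper_slope_def by (meson INF_lower UNIV_I less_le_trans)
  then obtain r s where rs: "r < x" "x < s" "s - r < 1 / (real n + 1)" "q < (f s - f r) / (s - r)"
    by (auto simp: less_SUP_iff)
  have "q * (s - r) < f s - f r" using rs by (simp add: pos_less_divide_eq)
  moreover have "s - r < d" using rs(3) n by linarith
  ultimately show ?thesis using rs by blast
qed

lemma upper_slope_lessD:
  assumes "upper_slope f x < ereal q"
  obtains d where "0 < d" "\<And>r s. \<lbrakk>r < x; x < s; s - r < d\<rbrakk> \<Longrightarrow> f s - f r < q * (s - r)"
proof -
  obtain n where n: "(SUP (r, s) \<in> {(r, s). r < x \<and> x < s \<and> s - r < 1 / (real n + 1)}. ereal ((f s - f r) / (s - r))) < ereal q"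
    using assms unfolding upper_slope_def by (auto simp: INF_less_iff)
  have "f s - f r < q * (s - r)" if "r < x" "x < s" "s - r < 1 / (real n + 1)" for r s
  proof -
    have "ereal ((f s - f r) / (s - r)) \<le> (SUP (r, s) \<in> {(r, s). r < x \<and> x < s \<and> s - r < 1 / (real n + 1)}. ereal ((f s - f r) / (s - r)))"
      using that by (intro SUP_upper2[of "(r, s)"]) auto
    then have "ereal ((f s - f r) / (s - r)) < ereal q" using n by (rule le_less_trans)
    then show ?thesis using that by (simp add: pos_divide_less_eq)
  qed
  then show thesis using that[of "1 / (real n + 1)"] by simp
qed

text \<open>Why an absolutely continuous function of variation at most 1 is an indefinite integral. Its upper
  derivate \<open>U\<close> is integrable: if \<open>\<psi>\<close> is \<open>\<bar>U\<bar>\<close> cut off at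
  height \<open>n\<close>, almost every point lies in arbitrarily short intervals over which the increment of
  \<open>\<integral>\<psi>\<close> is at most \<open>\<bar>\<Delta>f\<bar>\<close> plus the length, and a Vitali
  division bounds \<open>\<integral>\<psi>\<close> by the variation of \<open>f\<close> plus constants,
  uniformly in \<open>n\<close>. The difference \<open>f - \<integral>U\<close> then has upper derivate 0 almost
  everywhere, and the monotonicity criterion, which asks only for some short intervals around each point,
  applies to it and to its negative. So the difference is constant.\<close>

lemma abs_continuous_on_eq_integral_short:
  fixes f :: "real \<Rightarrow> real"
  assumes ab: "a \<le> b" and f: "abs_continuous_on a b f"
    and var: "\<And>D. \<lbrakk>D division_of \<Union>D; \<Union>D \<subseteq> {a..b}\<rbrakk> \<Longrightarrow> (\<Sum>K\<in>D. dist (f (Inf K)) (f (Sup K))) \<le> 1"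
  obtains g where "set_integrable lebesgue {a..b} g"
    "\<And>x. x \<in> {a..b} \<Longrightarrow> f x = f a + (LINT s:{a..x}|lebesgue. g s)"
proof -
  define U where "U = upper_slope f"
  have Um [measurable]: "U \<in> borel_measurable borel" unfolding U_def by simp
  \<comment> \<open>\<open>\<bar>U\<bar>\<close> cut off at height \<open>n\<close>\<close>
  define \<psi> where "\<psi> = (\<lambda>n::nat. \<lambda>x. real_of_ereal (min \<bar>U x\<bar> (ereal (real n))))"
  have \<psi>m [measurable]: "\<psi> n \<in> borel_measurable borel" for n unfolding \<psi>_def by measurable
  have \<psi>e: "ereal (\<psi> n x) = min \<bar>U x\<bar> (ereal (real n))" for n x
    unfolding \<psi>_def by (cases "U x") (auto simp: min_def)
  have \<psi>0: "0 \<le> \<psi> n x" "\<psi> n x \<le> real n" for n x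
    unfolding \<psi>_def by (cases "U x"; auto simp: min_def)+
  have \<psi>i: "set_integrable lebesgue {a..b} (\<psi> n)" for n
    unfolding set_integrable_def
  proof (rule Bochner_Integration.integrable_bound)
    show "integrable lebesgue (\<lambda>x. indicator {a..b} x *\<^sub>R real n)"
      by (simp add: integrable_indicator_interval)
    show "(\<lambda>x. indicator {a..b} x *\<^sub>R \<psi> n x) \<in> borel_measurable lebesgue"
      by (intro measurable_completion) simp
    show "AE x in lebesgue. norm (indicator {a..b} x *\<^sub>R \<psi> n x) \<le> norm (indicator {a..b} x *\<^sub>R real n)"
      using \<psi>0 by (intro AE_I2) (auto simp: indicator_def)
  qed
  have bound: "(LINT x:{a..b}|lebesgue. \<psi> n x) \<le> 2 + (b - a)" for n
  proof -
    let ?P = "\<lambda>x. LINT s:{a..x}|lebesgue. \<psi> n s"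
    obtain N where N: "negligible N" "\<And>x. \<lbrakk>a < x; x < b; x \<notin> N\<rbrakk> \<Longrightarrow> (?P has_real_derivative \<psi> n x) (at x)"
      using indefinite_integral_derivative[OF \<psi>i] by blast
    have cov: "\<exists>r s. ?P s - ?P r \<le> \<bar>f s - f r\<bar> + (s - r) \<and> r < x \<and> x < s \<and> s - r < d"
      if x: "a < x" "x < b" "x \<notin> N" "0 < d" for x d
    proof -
      obtain d0 where d0: "0 < d0" "\<And>r s. \<lbrakk>r < x; x < s; s - r < d0\<rbrakk> \<Longrightarrow> \<bar>?P s - ?P r - \<psi> n x * (s - r)\<bar> \<le> (1/2) * (s - r)"
        using has_real_derivative_straddle[OF N(2)[OF x(1-3)], of "1/2"] by auto
      have "\<exists>r s. (\<psi> n x - 1/2) * (s - r) \<le> \<bar>f s - f r\<bar> \<and> r < x \<and> x < s \<and> s - r < min d d0"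
      proof -
        have "ereal (\<psi> n x - 1/2) < \<bar>U x\<bar>"
        proof -
          have "ereal (\<psi> n x - 1/2) < ereal (\<psi> n x)" by simp
          also have "\<dots> \<le> \<bar>U x\<bar>" unfolding \<psi>e by simp
          finally show ?thesis .
        qed
        \<comment> \<open>a steep upward interval exists in the first case; in the second all short intervals are steep downward\<close>
        then consider "ereal (\<psi> n x - 1/2) < U x" | "U x < ereal (- (\<psi> n x - 1/2))"
          by (cases "U x") (auto simp: abs_if split: if_splits)
        then show ?thesis
        proof cases
          case 1
          then obtain r s where rs: "(\<psi> n x - 1/2) * (s - r) < f s - f r" "r < x" "x < s" "s - r < min d d0"
            using upper_slope_greaterD[of "\<psi> n x - 1/2" f x "min d d0"] x d0(1) unfolding U_def by auto
          have "(\<psi> n x - 1/2) * (s - r) \<le> \<bar>f s - f r\<bar>" using rs(1) by linarith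
          then show ?thesis using rs by blast
        next
          case 2
          then obtain d1 where d1: "0 < d1" "\<And>r s. \<lbrakk>r < x; x < s; s - r < d1\<rbrakk> \<Longrightarrow> f s - f r < (- (\<psi> n x - 1/2)) * (s - r)"
            using upper_slope_lessD unfolding U_def by blast
          define h where "h = Min {d, d0, d1} / 3"
          have h: "0 < h" "3 * h \<le> d" "3 * h \<le> d0" "3 * h \<le> d1" using d1 d0 x by (auto simp: h_def)
          have "f (x + h) - f (x - h) < (- (\<psi> n x - 1/2)) * ((x + h) - (x - h))"
            using h by (intro d1(2)) auto
          then show ?thesis using h
            by (intro exI[of _ "x - h"] exI[of _ "x + h"]) (auto simp: algebra_simps)
        qed
      qed
      then obtain r s where rs: "(\<psi> n x - 1/2) * (s - r) \<le> \<bar>f s - f r\<bar>" "r < x" "x < s" "s - r < min d d0" by blast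
      have "\<bar>?P s - ?P r - \<psi> n x * (s - r)\<bar> \<le> (1/2) * (s - r)" using d0(2) rs by simp
      then have 1: "?P s - ?P r \<le> \<psi> n x * (s - r) + (1/2) * (s - r)" by linarith
      have 2: "\<psi> n x * (s - r) - (1/2) * (s - r) \<le> \<bar>f s - f r\<bar>" using rs(1) by (simp add: left_diff_distrib)
      have "A \<le> B + q" if "A \<le> p + (1/2) * q" "p - (1/2) * q \<le> B" for A B p q :: real using that by linarith
      from this[OF 1 2] show ?thesis using rs by (intro exI[of _ r] exI[of _ s]) auto
    qed
    obtain D D' where D: "D division_of {a..b}" "D' \<subseteq> D"
      "\<And>K. K \<in> D' \<Longrightarrow> \<exists>r s. ?P s - ?P r \<le> \<bar>f s - f r\<bar> + (s - r) \<and> r < s \<and> K = {r..s}"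
      "(\<Sum>K\<in>D - D'. measure lborel K) < 1 / (real n + 1)"
    proof (rule Vitali_division[OF ab _ N(1), of "1 / (real n + 1)" "\<lambda>r s. ?P s - ?P r \<le> \<bar>f s - f r\<bar> + (s - r)"])
      show "\<exists>r s. ?P s - ?P r \<le> \<bar>f s - f r\<bar> + (s - r) \<and> r < x \<and> x < s \<and> s - r < d"
        if "a < x" "x < b" "x \<notin> N" "0 < d" for x d using cov[OF that] .
    next
      fix D D' assume "D division_of {a..b}" "D' \<subseteq> D"
      "\<And>K. K \<in> D' \<Longrightarrow> \<exists>r s. ?P s - ?P r \<le> \<bar>f s - f r\<bar> + (s - r) \<and> r < s \<and> K = {r..s}"
      "(\<Sum>K\<in>D - D'. measure lborel K) < 1 / (real n + 1)"
      then show thesis by (rule that)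
    qed simp
    have fin: "finite D" "finite D'" using D(1,2) by (auto intro: finite_subset)
    have form: "\<exists>u v. u \<le> v \<and> K = {u..v} \<and> a \<le> u \<and> v \<le> b" if "K \<in> D" for K
    proof -
      obtain u v where "K = cbox u v" "K \<noteq> {}" using division_ofD(3,4)[OF D(1) \<open>K \<in> D\<close>] by blast
      moreover have "K \<subseteq> {a..b}" using division_ofD(2)[OF D(1) \<open>K \<in> D\<close>] .
      ultimately show ?thesis by auto
    qed
    have div: "D' division_of \<Union>D'" using D(1,2) division_of_subset by blast
    have sub: "\<Union>D' \<subseteq> {a..b}" using division_ofD(6)[OF D(1)] D(2) by blast
    have "?P b - ?P a = (\<Sum>K\<in>D. ?P (Sup K) - ?P (Inf K))"
      using division_sum_additive[OF ab D(1), of ?P] by simp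
    also have "\<dots> = (\<Sum>K\<in>D - D'. ?P (Sup K) - ?P (Inf K)) + (\<Sum>K\<in>D'. ?P (Sup K) - ?P (Inf K))"
      by (rule sum.subset_diff[OF D(2) fin(1)])
    also have "(\<Sum>K\<in>D - D'. ?P (Sup K) - ?P (Inf K)) \<le> (\<Sum>K\<in>D - D'. real n * measure lborel K)"
    proof (rule sum_mono)
      fix K assume "K \<in> D - D'"
      then obtain u v where uv: "u \<le> v" "K = {u..v}" "a \<le> u" "v \<le> b" using form by blast
      have "?P v - ?P u = (LINT x:{u<..v}|lebesgue. \<psi> n x)"
        by (rule set_integral_atLeastAtMost_diff[OF \<psi>i uv(3,1,4)])
      also have "\<dots> \<le> (LINT x:{u<..v}|lebesgue. real n)"
      proof (rule set_integral_mono)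
        show "set_integrable lebesgue {u<..v} (\<psi> n)" by (rule set_integrable_subset[OF \<psi>i]) (use uv in auto)
        show "set_integrable lebesgue {u<..v} (\<lambda>_. real n)"
          by (simp add: set_integrable_def integrable_indicator_interval)
      qed (use \<psi>0 in auto)
      also have "\<dots> = real n * measure lborel K" using uv by (simp add: set_lebesgue_integral_def)
      finally show "?P (Sup K) - ?P (Inf K) \<le> real n * measure lborel K" using uv by simp
    qed
    also have "\<dots> = real n * (\<Sum>K\<in>D - D'. measure lborel K)" by (simp add: sum_distrib_left)
    also have "\<dots> \<le> real n * (1 / (real n + 1))" using D(4) by (intro mult_left_mono) auto
    also have "\<dots> \<le> 1" by (simp add: field_simps)
    also have "(\<Sum>K\<in>D'. ?P (Sup K) - ?P (Inf K)) \<le> (\<Sum>K\<in>D'. dist (f (Inf K)) (f (Sup K)) + measure lborel K)"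
      by (rule sum_mono) (use D(3) in \<open>force simp: dist_real_def abs_minus_commute\<close>)
    also have "\<dots> = (\<Sum>K\<in>D'. dist (f (Inf K)) (f (Sup K))) + (\<Sum>K\<in>D'. measure lborel K)"
      by (rule sum.distrib)
    also have "(\<Sum>K\<in>D'. measure lborel K) \<le> b - a"
      using subadditive_content_division[OF div, of a b] sub ab by simp
    also have "(\<Sum>K\<in>D'. dist (f (Inf K)) (f (Sup K))) \<le> 1" by (rule var[OF div sub])
    finally have "?P b - ?P a \<le> 1 + (1 + (b - a))" by simp
    moreover have "?P a = 0" by (rule set_integral_degenerate)
    ultimately show ?thesis by simp
  qed
  \<comment> \<open>monotone convergence turns the uniform bound into finiteness almost everywhere and integrability\<close>
  define T where "T = (\<lambda>x. SUP n. ennreal (indicator {a..b} x * \<psi> n x))"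
  have Tm: "T \<in> borel_measurable lebesgue" unfolding T_def by (intro measurable_completion) simp
  have "(\<integral>\<^sup>+ x. T x \<partial>lebesgue) = (SUP n. \<integral>\<^sup>+ x. ennreal (indicator {a..b} x * \<psi> n x) \<partial>lebesgue)"
    unfolding T_def
  proof (rule nn_integral_monotone_convergence_SUP)
    show "incseq (\<lambda>n x. ennreal (indicator {a..b} x * \<psi> n x))"
    proof (intro incseq_SucI le_funI ennreal_leI mult_left_mono)
      fix n x
      have "ereal (\<psi> n x) \<le> ereal (\<psi> (Suc n) x)" unfolding \<psi>e by (intro min.mono) auto
      then show "\<psi> n x \<le> \<psi> (Suc n) x" by simp
    qed auto
    show "(\<lambda>x. ennreal (indicator {a..b} x * \<psi> n x)) \<in> borel_measurable lebesgue" for n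
      by (intro measurable_completion) simp
  qed
  also have "\<dots> \<le> ennreal (2 + (b - a))"
  proof (rule SUP_least)
    fix n
    have "(\<integral>\<^sup>+ x. ennreal (indicator {a..b} x * \<psi> n x) \<partial>lebesgue) = ennreal (LINT x:{a..b}|lebesgue. \<psi> n x)"
      using \<psi>i[of n] \<psi>0 unfolding set_integrable_def set_lebesgue_integral_def
      by (subst nn_integral_eq_integral) auto
    also have "\<dots> \<le> ennreal (2 + (b - a))" using bound by (intro ennreal_leI)
    finally show "(\<integral>\<^sup>+ x. ennreal (indicator {a..b} x * \<psi> n x) \<partial>lebesgue) \<le> ennreal (2 + (b - a))" .
  qed
  finally have Tfin: "(\<integral>\<^sup>+ x. T x \<partial>lebesgue) < \<infinity>" by (simp add: le_less_trans)
  then have "AE x in lebesgue. T x \<noteq> \<infinity>" by (intro nn_integral_PInf_AE Tm) simp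
  then obtain N0 where N0: "N0 \<in> null_sets lebesgue" "\<And>x. x \<notin> N0 \<Longrightarrow> T x \<noteq> \<infinity>"
    by (auto elim!: AE_E3)
  have fin: "\<bar>U x\<bar> \<noteq> \<infinity>" if "a \<le> x" "x \<le> b" "x \<notin> N0" for x
  proof
    assume inf: "\<bar>U x\<bar> = \<infinity>"
    have "\<psi> n x = real n" for n using inf unfolding \<psi>_def by (cases "U x") auto
    then have "T x = (SUP n. ennreal (real n))" using that unfolding T_def by simp
    also have "\<dots> = \<infinity>" by (simp add: ennreal_SUP_of_nat_eq_top flip: ennreal_of_nat_eq_real_of_nat)
    finally show False using N0(2) that by auto
  qed
  define g where "g = (\<lambda>x. real_of_ereal (U x))"
  have gi: "set_integrable lebesgue {a..b} g"
    unfolding set_integrable_def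
  proof (rule integrableI_bounded)
    show "(\<lambda>x. indicator {a..b} x *\<^sub>R g x) \<in> borel_measurable lebesgue"
      unfolding g_def by (intro measurable_completion) simp
    have "(\<integral>\<^sup>+ x. ennreal (norm (indicator {a..b} x *\<^sub>R g x)) \<partial>lebesgue) \<le> (\<integral>\<^sup>+ x. T x \<partial>lebesgue)"
    proof (rule nn_integral_mono)
      fix x :: real
      obtain n where n: "\<bar>g x\<bar> \<le> real n" using real_arch_simple by blast
      have "\<bar>g x\<bar> \<le> \<psi> n x" using n unfolding g_def \<psi>_def by (cases "U x") (auto simp: min_def)
      then have "ennreal (norm (indicator {a..b} x *\<^sub>R g x)) \<le> ennreal (indicator {a..b} x * \<psi> n x)"
        by (intro ennreal_leI) (auto simp: indicator_def)
      also have "\<dots> \<le> T x" unfolding T_def by (rule SUP_upper) simp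
      finally show "ennreal (norm (indicator {a..b} x *\<^sub>R g x)) \<le> T x" .
    qed
    then show "(\<integral>\<^sup>+ x. ennreal (norm (indicator {a..b} x *\<^sub>R g x)) \<partial>lebesgue) < \<infinity>"
      using Tfin by (rule le_less_trans)
  qed
  let ?G = "\<lambda>x. LINT s:{a..x}|lebesgue. g s"
  obtain N where N: "negligible N" "\<And>x. \<lbrakk>a < x; x < b; x \<notin> N\<rbrakk> \<Longrightarrow> (?G has_real_derivative g x) (at x)"
    using indefinite_integral_derivative[OF gi] by blast
  have NN: "negligible (N \<union> N0)" using N(1) N0(1) by (auto simp: negligible_iff_null_sets)
  have Gac: "abs_continuous_on a b ?G" by (rule indefinite_integral_abs_continuous[OF gi])
  have Ga: "?G a = 0" by (rule set_integral_degenerate)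
  have eq: "f y = f a + ?G y" if y: "y \<in> {a..b}" for y
  proof -
    have ay: "a \<le> y" using y by simp
    have h: "abs_continuous_on a y (\<lambda>x. f x - ?G x)"
      by (rule abs_continuous_on_subinterval[OF abs_continuous_on_diff[OF f Gac]]) (use y in auto)
    have h': "abs_continuous_on a y (\<lambda>x. ?G x - f x)"
      by (rule abs_continuous_on_subinterval[OF abs_continuous_on_diff[OF Gac f]]) (use y in auto)
    have U: "U x = ereal (g x)" if "a \<le> x" "x \<le> b" "x \<notin> N \<union> N0" for x
      using fin[of x] that by (auto simp: g_def ereal_real)
    have "f a - ?G a \<le> f y - ?G y"
    proof (rule abs_continuous_on_derivative_nonneg[OF ay h NN], intro allI impI)
      fix x e d :: real assume x: "a < x" "x < y" "x \<notin> N \<union> N0" "0 < e" and d: "0 < d"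
      obtain d0 where d0: "0 < d0" "\<And>r s. \<lbrakk>r < x; x < s; s - r < d0\<rbrakk> \<Longrightarrow> \<bar>?G s - ?G r - g x * (s - r)\<bar> \<le> (e/2) * (s - r)"
        using has_real_derivative_straddle[OF N(2), of x "e/2"] x y by auto
      have "ereal (g x - e/2) < U x" using U[of x] x y by simp
      then obtain r s where rs: "(g x - e/2) * (s - r) < f s - f r" "r < x" "x < s" "s - r < min d d0"
        using upper_slope_greaterD[of "g x - e/2" f x "min d d0"] d d0 unfolding U_def by auto
      have "\<bar>?G s - ?G r - g x * (s - r)\<bar> \<le> (e/2) * (s - r)" using d0(2)[of r s] rs by simp
      then have 1: "?G s - ?G r - g x * (s - r) \<le> (e/2) * (s - r)" by (rule abs_le_D1)
      have 2: "g x * (s - r) - (e/2) * (s - r) < f s - f r" using rs(1) by (simp add: left_diff_distrib)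
      have "- e * (s - r) = - ((e/2) * (s - r) + (e/2) * (s - r))" by (simp flip: distrib_right)
      then have "- e * (s - r) \<le> (f s - ?G s) - (f r - ?G r)" using 1 2 by argo
      then show "\<exists>r s. - e * (s - r) \<le> (f s - ?G s) - (f r - ?G r) \<and> r < x \<and> x < s \<and> s - r < d"
        using rs by auto
    qed
    moreover have "?G a - f a \<le> ?G y - f y"
    proof (rule abs_continuous_on_derivative_nonneg[OF ay h' NN], intro allI impI)
      fix x e d :: real assume x: "a < x" "x < y" "x \<notin> N \<union> N0" "0 < e" and d: "0 < d"
      obtain d0 where d0: "0 < d0" "\<And>r s. \<lbrakk>r < x; x < s; s - r < d0\<rbrakk> \<Longrightarrow> \<bar>?G s - ?G r - g x * (s - r)\<bar> \<le> (e/2) * (s - r)"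
        using has_real_derivative_straddle[OF N(2), of x "e/2"] x y by auto
      have "U x < ereal (g x + e/2)" using U[of x] x y by simp
      then obtain d1 where d1: "0 < d1" "\<And>r s. \<lbrakk>r < x; x < s; s - r < d1\<rbrakk> \<Longrightarrow> f s - f r < (g x + e/2) * (s - r)"
        using upper_slope_lessD unfolding U_def by blast
      define k where "k = Min {d, d0, d1} / 3"
      have k: "0 < k" "3 * k \<le> d" "3 * k \<le> d0" "3 * k \<le> d1" using d1 d0 d by (auto simp: k_def)
      define r s where "r = x - k" and "s = x + k"
      have rs: "r < x" "x < s" "s - r < d" "s - r < d0" "s - r < d1" using k by (auto simp: r_def s_def)
      have "\<bar>?G s - ?G r - g x * (s - r)\<bar> \<le> (e/2) * (s - r)" using d0(2)[of r s] rs by simp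
      then have 1: "- (?G s - ?G r - g x * (s - r)) \<le> (e/2) * (s - r)" by (rule abs_le_D2)
      have 2: "f s - f r < g x * (s - r) + (e/2) * (s - r)" using d1(2)[of r s] rs by (simp add: distrib_right)
      have "- e * (s - r) = - ((e/2) * (s - r) + (e/2) * (s - r))" by (simp flip: distrib_right)
      then have "- e * (s - r) \<le> (?G s - f s) - (?G r - f r)" using 1 2 by argo
      then show "\<exists>r s. - e * (s - r) \<le> (?G s - f s) - (?G r - f r) \<and> r < x \<and> x < s \<and> s - r < d"
        using rs by blast
    qed
    ultimately show ?thesis using Ga by simp
  qed
  show thesis by (rule that[OF gi eq])
qed

lemma negligible_imp_AE: "negligible N \<Longrightarrow> AE x in lebesgue. x \<notin> N"
  by (simp add: negligible_iff_null_sets AE_not_in)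

lemma AE_imp_negligible:
  assumes "AE x in lebesgue. P (x::real)"
  obtains N where "negligible N" "\<And>x. x \<notin> N \<Longrightarrow> P x"
  using assms by (auto elim!: AE_E3 simp: negligible_iff_null_sets)

text \<open>Lebesgue's differentiability theorem. On short intervals the variation is at most 1, so the
  function is an indefinite integral there; countably many such intervals with rational end points cover the
  open interval.\<close>

lemma abs_continuous_on_differentiable_real:
  fixes f :: "real \<Rightarrow> real"
  assumes f: "abs_continuous_on a b f"
  shows "AE x in lebesgue. a < x \<and> x < b \<longrightarrow> f differentiable (at x)"
proof -
  obtain d where d: "0 < d"
    "\<And>D. \<lbrakk>D division_of \<Union>D; \<Union>D \<subseteq> {a..b}; (\<Sum>K\<in>D. measure lborel K) < d\<rbrakk>
       \<Longrightarrow> (\<Sum>K\<in>D. dist (f (Inf K)) (f (Sup K))) < 1"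
    using abs_continuous_on_division[OF f zero_less_one] by blast
  define Q where "Q = {(p, q). p \<in> \<rat> \<and> q \<in> \<rat> \<and> a \<le> p \<and> p < q \<and> q \<le> b \<and> q - p < d}"
  have Q: "countable Q" by (rule countable_subset[of _ "\<rat> \<times> \<rat>"]) (auto simp: Q_def countable_rat)
  have "AE x in lebesgue. \<forall>pq\<in>Q. x \<in> {fst pq<..<snd pq} \<longrightarrow> f differentiable (at x)"
    unfolding AE_ball_countable[OF Q]
  proof
    fix pq assume "pq \<in> Q"
    then obtain p q where pq: "pq = (p, q)" "a \<le> p" "p < q" "q \<le> b" "q - p < d" by (auto simp: Q_def)
    have fpq: "abs_continuous_on p q f" by (rule abs_continuous_on_subinterval[OF f]) (use pq in auto)
    obtain g where g: "set_integrable lebesgue {p..q} g"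
      "\<And>x. x \<in> {p..q} \<Longrightarrow> f x = f p + (LINT s:{p..x}|lebesgue. g s)"
    proof (rule abs_continuous_on_eq_integral_short[OF _ fpq])
      fix D assume D: "D division_of \<Union>D" "\<Union>D \<subseteq> {p..q}"
      have "(\<Sum>K\<in>D. measure lborel K) \<le> q - p"
        using subadditive_content_division[OF D(1), of p q] D(2) pq by simp
      then have "(\<Sum>K\<in>D. dist (f (Inf K)) (f (Sup K))) < 1"
        using D pq by (intro d(2)) auto
      then show "(\<Sum>K\<in>D. dist (f (Inf K)) (f (Sup K))) \<le> 1" by simp
    next
      show "p \<le> q" using pq by simp
    qed (rule that)
    obtain N where N: "negligible N"
      "\<And>x. \<lbrakk>p < x; x < q; x \<notin> N\<rbrakk> \<Longrightarrow> ((\<lambda>x. LINT s:{p..x}|lebesgue. g s) has_real_derivative g x) (at x)"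
      using indefinite_integral_derivative[OF g(1)] by blast
    have "f differentiable (at x)" if x: "p < x" "x < q" "x \<notin> N" for x
    proof -
      have "((\<lambda>x. f p + (LINT s:{p..x}|lebesgue. g s)) has_real_derivative g x) (at x)"
        using N(2)[OF x] by (auto intro!: derivative_eq_intros)
      then have "(f has_real_derivative g x) (at x)"
        by (rule has_field_derivative_transform_within_open[of _ _ _ "{p<..<q}"]) (use x in \<open>auto simp: g(2)[symmetric]\<close>)
      then show ?thesis using real_differentiable_def by blast
    qed
    note diff = this
    show "AE x in lebesgue. x \<in> {fst pq<..<snd pq} \<longrightarrow> f differentiable (at x)"
      using negligible_imp_AE[OF N(1)] by eventually_elim (simp add: pq diff)
  qed
  then show ?thesis
  proof eventually_elim
    case (elim x)
    show ?case
    proof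
      assume x: "a < x \<and> x < b"
      obtain p where p: "p \<in> \<rat>" "max a (x - d/2) < p" "p < x" using Rats_dense_in_real[of "max a (x - d/2)" x] x d(1) by auto
      obtain q where q: "q \<in> \<rat>" "x < q" "q < min b (x + d/2)" using Rats_dense_in_real[of x "min b (x + d/2)"] x d(1) by auto
      have "(p, q) \<in> Q" using p q by (auto simp: Q_def)
      then show "f differentiable (at x)" using elim p q by force
    qed
  qed
qed

lemma abs_continuous_on_differentiable:
  fixes f :: "real \<Rightarrow> 'e::euclidean_space"
  assumes f: "abs_continuous_on a b f"
  shows "AE x in lebesgue. a < x \<and> x < b \<longrightarrow> f differentiable (at x)"
proof -
  have "AE x in lebesgue. \<forall>i\<in>Basis. a < x \<and> x < b \<longrightarrow> (\<lambda>y. f y \<bullet> i) differentiable (at x)"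
  proof (subst AE_ball_countable)
    show "countable (Basis :: 'e set)" by (intro countable_finite finite_Basis)
    show "\<forall>i\<in>Basis. AE x in lebesgue. a < x \<and> x < b \<longrightarrow> (\<lambda>y. f y \<bullet> i) differentiable (at x)"
    proof
      fix i :: 'e assume i: "i \<in> Basis"
      have "abs_continuous_on a b (\<lambda>y. f y \<bullet> i)"
      proof (rule abs_continuous_on_dominated[OF f f, of 1])
        fix x y
        have "dist (f x \<bullet> i) (f y \<bullet> i) \<le> dist (f x) (f y)"
          using Basis_le_norm[OF i, of "f x - f y"] by (simp add: dist_norm inner_diff_left)
        from add_mono[OF this zero_le_dist[of "f x" "f y"]]
        show "dist (f x \<bullet> i) (f y \<bullet> i) \<le> 1 * (dist (f x) (f y) + dist (f x) (f y))" by simp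
      qed simp
      then show "AE x in lebesgue. a < x \<and> x < b \<longrightarrow> (\<lambda>y. f y \<bullet> i) differentiable (at x)"
        by (rule abs_continuous_on_differentiable_real)
    qed
  qed
  then show ?thesis
    by eventually_elim (auto simp: differentiable_componentwise_within[of f])
qed

lemma abs_continuous_on_DERIV_nonneg:
  fixes f :: "real \<Rightarrow> real"
  assumes "a \<le> b" "abs_continuous_on a b f"
    and "AE x in lebesgue. a < x \<and> x < b \<longrightarrow> (\<exists>l\<ge>0. (f has_real_derivative l) (at x))"
  shows "f a \<le> f b"
proof -
  obtain N where N: "negligible N" "\<And>x. x \<notin> N \<Longrightarrow> a < x \<and> x < b \<longrightarrow> (\<exists>l\<ge>0. (f has_real_derivative l) (at x))"
    using AE_imp_negligible[OF assms(3)] by blast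
  show ?thesis
  proof (rule abs_continuous_on_derivative_nonneg[OF assms(1,2) N(1)], intro allI impI)
    fix x e d :: real assume x: "a < x" "x < b" "x \<notin> N" "0 < e" "0 < d"
    obtain l where l: "0 \<le> l" "(f has_real_derivative l) (at x)" using N x by blast
    obtain d0 where d0: "0 < d0" "\<And>r s. \<lbrakk>r < x; x < s; s - r < d0\<rbrakk> \<Longrightarrow> \<bar>f s - f r - l * (s - r)\<bar> \<le> e * (s - r)"
      using has_real_derivative_straddle[OF l(2) x(4)] by blast
    define k where "k = min d d0 / 3"
    have k: "0 < k" "3 * k \<le> d" "3 * k \<le> d0" using d0 x by (auto simp: k_def)
    have "\<bar>f (x + k) - f (x - k) - l * ((x + k) - (x - k))\<bar> \<le> e * ((x + k) - (x - k))"
      using k by (intro d0(2)) auto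
    moreover have "0 \<le> l * ((x + k) - (x - k))" using l k by (intro mult_nonneg_nonneg) auto
    ultimately have "- e * ((x + k) - (x - k)) \<le> f (x + k) - f (x - k)" by (simp only: abs_le_iff) linarith
    then show "\<exists>r s. - e * (s - r) \<le> f s - f r \<and> r < x \<and> x < s \<and> s - r < d"
      using k by (intro exI[of _ "x - k"] exI[of _ "x + k"]) auto
  qed
qed

text \<open>The fundamental theorem of calculus: \<open>f\<close> and the indefinite integral of its
  derivative differ by an absolutely continuous function whose derivative vanishes almost everywhere.\<close>

lemma abs_continuous_on_integral_derivative:
  fixes f g :: "real \<Rightarrow> real"
  assumes ab: "a \<le> b" and f: "abs_continuous_on a b f" and g: "set_integrable lebesgue {a..b} g"
    and der: "AE x in lebesgue. a < x \<and> x < b \<longrightarrow> (f has_real_derivative g x) (at x)"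
  shows "(LINT x:{a..b}|lebesgue. g x) = f b - f a"
proof -
  let ?G = "\<lambda>x. LINT s:{a..x}|lebesgue. g s"
  obtain N where N: "negligible N" "\<And>x. \<lbrakk>a < x; x < b; x \<notin> N\<rbrakk> \<Longrightarrow> (?G has_real_derivative g x) (at x)"
    using indefinite_integral_derivative[OF g] by blast
  have G: "abs_continuous_on a b ?G" by (rule indefinite_integral_abs_continuous[OF g])
  have "f a - ?G a \<le> f b - ?G b"
  proof (rule abs_continuous_on_DERIV_nonneg[OF ab abs_continuous_on_diff[OF f G]])
    show "AE x in lebesgue. a < x \<and> x < b \<longrightarrow> (\<exists>l\<ge>0. ((\<lambda>x. f x - ?G x) has_real_derivative l) (at x))"
      using der negligible_imp_AE[OF N(1)]
    proof eventually_elim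
      case (elim x)
      then show ?case using DERIV_diff[of f "g x" x UNIV ?G "g x"] N(2)[of x] by auto
    qed
  qed
  moreover have "?G a - f a \<le> ?G b - f b"
  proof (rule abs_continuous_on_DERIV_nonneg[OF ab abs_continuous_on_diff[OF G f]])
    show "AE x in lebesgue. a < x \<and> x < b \<longrightarrow> (\<exists>l\<ge>0. ((\<lambda>x. ?G x - f x) has_real_derivative l) (at x))"
      using der negligible_imp_AE[OF N(1)]
    proof eventually_elim
      case (elim x)
      then show ?case using DERIV_diff[of ?G "g x" x UNIV f "g x"] N(2)[of x] by auto
    qed
  qed
  ultimately show ?thesis using set_integral_degenerate[of a g] by simp
qed

section \<open>Caratheodory differential equations\<close>

text \<open>If \<open>w\<close> became positive, consider the last time \<open>\<tau>\<close> at which it is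
  not, and its maximum over an interval of length at most \<open>1 / (2 * k + 2)\<close> after
  \<open>\<tau>\<close>. Along this interval \<open>w\<close> grows at most at rate \<open>k\<close> times the
  maximum, so the maximum is at most half of itself.\<close>

lemma abs_continuous_on_gronwall_nonpos:
  fixes w :: "real \<Rightarrow> real"
  assumes T: "0 \<le> T" and w: "abs_continuous_on 0 T w" and w0: "w 0 \<le> 0" and k: "0 \<le> k"
    and der: "AE s in lebesgue. 0 < s \<and> s < T \<and> 0 < w s \<longrightarrow> (\<exists>l\<le>k * w s. (w has_real_derivative l) (at s))"
  shows "w T \<le> 0"
proof (rule ccontr)
  assume "\<not> w T \<le> 0"
  then have wT: "0 < w T" by simp
  have cont: "continuous_on {0..T} w" by (rule abs_continuous_on_continuous[OF w])
  define Z where "Z = {s \<in> {0..T}. w s \<le> 0}"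
  have "closed Z" unfolding Z_def
    using continuous_closed_preimage[OF cont, of "{..0}"] by (simp add: vimage_def Int_def)
  have "0 \<in> Z" using w0 T by (simp add: Z_def)
  then have Zne: "Z \<noteq> {}" "bdd_above Z" by (auto simp: Z_def)
  define \<tau> where "\<tau> = Sup Z"
  have \<tau>Z: "\<tau> \<in> Z" unfolding \<tau>_def using closed_contains_Sup[OF Zne \<open>closed Z\<close>] .
  then have \<tau>: "0 \<le> \<tau>" "\<tau> < T" "w \<tau> \<le> 0" using wT by (auto simp: Z_def order_le_less)
  have pos: "0 < w s" if "\<tau> < s" "s \<le> T" for s
    using cSup_upper[OF _ Zne(2), of s] that \<tau> unfolding \<tau>_def[symmetric] by (fastforce simp: Z_def)
  \<comment> \<open>the length of \<open>{\<tau>..c}\<close> is such that \<open>k * (c - \<tau>) \<le> 1 / 2\<close>\<close>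
  define c where "c = min T (\<tau> + 1 / (2 * k + 2))"
  have c: "\<tau> < c" "c \<le> T" "c - \<tau> \<le> 1 / (2 * k + 2)" using \<tau> k by (auto simp: c_def)
  have "continuous_on {\<tau>..c} w" by (rule continuous_on_subset[OF cont]) (use \<tau> c in auto)
  then obtain x where x: "x \<in> {\<tau>..c}" "\<And>y. y \<in> {\<tau>..c} \<Longrightarrow> w y \<le> w x"
    using continuous_attains_sup[of "{\<tau>..c}" w] c by auto
  have wx: "0 < w x" using x(2)[of c] pos[of c] c by simp
  then have \<tau>x: "\<tau> < x" "x \<le> T" using x(1) \<tau> c by (auto simp: order_le_less)
  have "k * w x * \<tau> - w \<tau> \<le> k * w x * x - w x"
  proof (rule abs_continuous_on_DERIV_nonneg[where f = "\<lambda>s. k * w x * s - w s"])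
    have "abs_continuous_on \<tau> x (\<lambda>s. k * w x * s)"
      using k wx by (intro abs_continuous_on_lipschitz[of "k * w x"]) (auto simp: dist_real_def abs_mult simp flip: right_diff_distrib)
    then show "abs_continuous_on \<tau> x (\<lambda>s. k * w x * s - w s)"
      by (rule abs_continuous_on_diff) (rule abs_continuous_on_subinterval[OF w]; use \<tau> \<tau>x in auto)
    show "AE s in lebesgue. \<tau> < s \<and> s < x \<longrightarrow> (\<exists>l\<ge>0. ((\<lambda>s. k * w x * s - w s) has_real_derivative l) (at s))"
      using der
    proof eventually_elim
      case (elim s)
      show ?case
      proof
        assume s: "\<tau> < s \<and> s < x"
        then have "0 < w s" using pos \<tau>x by auto
        then obtain l where l: "l \<le> k * w s" "(w has_real_derivative l) (at s)" using elim s \<tau> \<tau>x by auto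
        have "k * w s \<le> k * w x" using x s k by (intro mult_left_mono x(2)) auto
        moreover have "((\<lambda>s. k * w x * s - w s) has_real_derivative k * w x - l) (at s)"
          by (auto intro!: derivative_eq_intros l(2))
        ultimately show "\<exists>l\<ge>0. ((\<lambda>s. k * w x * s - w s) has_real_derivative l) (at s)"
          using l(1) by (intro exI[of _ "k * w x - l"]) simp
      qed
    qed
  qed (use \<tau>x in simp)
  then have "w x \<le> w x * (k * (x - \<tau>))" using \<tau>(3) by (simp add: algebra_simps)
  also have "\<dots> \<le> w x * (1 / 2)"
  proof (rule mult_left_mono)
    have "k * (x - \<tau>) \<le> k * (1 / (2 * k + 2))" using k x c by (intro mult_left_mono) auto
    also have "\<dots> \<le> 1 / 2" using k by (simp add: field_simps)
    finally show "k * (x - \<tau>) \<le> 1 / 2" .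
  qed (use wx in simp)
  finally show False using wx by simp
qed

text \<open>The comparison principle for sub- and supersolutions: where \<open>v\<close> exceeds
  \<open>u\<close>, the difference grows at most at rate \<open>k\<close> times itself, so it cannot become
  positive.\<close>

lemma caratheodory_comparison:
  fixes F :: "real \<Rightarrow> real \<Rightarrow> real"
  assumes T: "0 \<le> T" and k: "0 \<le> k"
    and v: "abs_continuous_on 0 T v" and u: "abs_continuous_on 0 T u" and init: "v 0 \<le> u 0"
    and lip: "AE s in lebesgue. 0 < s \<and> s < T \<longrightarrow> (\<forall>x y. x \<le> y \<longrightarrow> F s y - F s x \<le> k * (y - x))"
    and dv: "AE s in lebesgue. 0 < s \<and> s < T \<longrightarrow> (\<exists>l\<le>F s (v s). (v has_real_derivative l) (at s))"
    and du: "AE s in lebesgue. 0 < s \<and> s < T \<longrightarrow> (\<exists>l\<ge>F s (u s). (u has_real_derivative l) (at s))"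
  shows "v T \<le> u T"
proof -
  have "v T - u T \<le> 0"
  proof (rule abs_continuous_on_gronwall_nonpos[OF T abs_continuous_on_diff[OF v u] _ k])
    show "AE s in lebesgue. 0 < s \<and> s < T \<and> 0 < v s - u s \<longrightarrow>
      (\<exists>l\<le>k * (v s - u s). ((\<lambda>s. v s - u s) has_real_derivative l) (at s))"
      using lip dv du
    proof eventually_elim
      case (elim s)
      show ?case
      proof
        assume s: "0 < s \<and> s < T \<and> 0 < v s - u s"
        obtain l where l: "l \<le> F s (v s)" "(v has_real_derivative l) (at s)" using elim s by blast
        obtain m where m: "m \<ge> F s (u s)" "(u has_real_derivative m) (at s)" using elim s by blast
        have "F s (v s) - F s (u s) \<le> k * (v s - u s)" using elim s by auto
        then show "\<exists>l\<le>k * (v s - u s). ((\<lambda>s. v s - u s) has_real_derivative l) (at s)"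
          using DERIV_diff[OF l(2) m(2)] l(1) m(1) by (intro exI[of _ "l - m"]) auto
      qed
    qed
  qed (use init in simp)
  then show ?thesis by simp
qed

lemma integral_exp_weight:
  fixes k :: real
  assumes s: "0 \<le> s" 
  shows "set_integrable lebesgue {0..s} (\<lambda>r. k * exp (2 * k * r))"
    and "(LINT r:{0..s}|lebesgue. k * exp (2 * k * r)) = (exp (2 * k * s) - 1) / 2"
proof -
  show 1: "set_integrable lebesgue {0..s} (\<lambda>r. k * exp (2 * k * r))"
    by (rule absolutely_integrable_continuous_real) (intro continuous_intros)
  have der: "((\<lambda>r. exp (2 * k * r) / 2) has_real_derivative k * exp (2 * k * r)) (at r within S)" for r S
    by (auto intro!: derivative_eq_intros)
  have "integral {0..s} (\<lambda>r. k * exp (2 * k * r)) = exp (2 * k * s) / 2 - exp (2 * k * 0) / 2"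
    by (intro integral_unique fundamental_theorem_of_calculus s)
       (use der in \<open>auto simp: has_real_derivative_iff_has_vector_derivative\<close>)
  then show "(LINT r:{0..s}|lebesgue. k * exp (2 * k * r)) = (exp (2 * k * s) - 1) / 2"
    using set_lebesgue_integral_eq_integral(2)[OF 1] by (simp add: diff_divide_distrib)
qed

text \<open>The hypotheses under which \<open>u' = F(s, u)\<close> has solutions in the sense of Caratheodory.
  Measurability is stated along continuous functions, which is the form in which it is used and can be verified
  for a Lagrangian along an arc.\<close>

locale caratheodory =
  fixes F :: "real \<Rightarrow> real \<Rightarrow> real" and T k :: real
  assumes T: "0 \<le> T" and k: "0 \<le> k"
    and meas: "\<And>u. continuous_on {0..T} u \<Longrightarrow> (\<lambda>s. indicator {0..T} s * F s (u s)) \<in> borel_measurable lebesgue"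
    and int0: "set_integrable lebesgue {0..T} (\<lambda>s. F s 0)"
    and lip: "AE s in lebesgue. 0 < s \<and> s < T \<longrightarrow> (\<forall>x y. \<bar>F s x - F s y\<bar> \<le> k * \<bar>x - y\<bar>)"
begin

lemma integrable_along:
  assumes u: "continuous_on {0..T} u"
  shows "set_integrable lebesgue {0..T} (\<lambda>s. F s (u s))"
  unfolding set_integrable_def
proof (rule Bochner_Integration.integrable_bound)
  have "set_integrable lebesgue {0..T} (\<lambda>s. k * \<bar>u s\<bar>)"
    by (rule absolutely_integrable_continuous_real) (intro continuous_intros u)
  then show "integrable lebesgue (\<lambda>s. \<bar>indicator {0..T} s *\<^sub>R F s 0\<bar> + indicator {0..T} s *\<^sub>R (k * \<bar>u s\<bar>))"
    using int0 unfolding set_integrable_def by (intro Bochner_Integration.integrable_add integrable_abs)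
  show "(\<lambda>s. indicator {0..T} s *\<^sub>R F s (u s)) \<in> borel_measurable lebesgue" using meas[OF u] by simp
  show "AE s in lebesgue. norm (indicator {0..T} s *\<^sub>R F s (u s)) \<le>
      norm (\<bar>indicator {0..T} s *\<^sub>R F s 0\<bar> + indicator {0..T} s *\<^sub>R (k * \<bar>u s\<bar>))"
    using lip AE_lebesgue_neq[of 0] AE_lebesgue_neq[of T]
  proof eventually_elim
    case (elim s)
    show ?case
    proof (cases "s \<in> {0..T}")
      case True
      then have "0 < s \<and> s < T" using elim(2,3) by auto
      then have "\<bar>F s (u s) - F s 0\<bar> \<le> k * \<bar>u s - 0\<bar>" using elim(1) by blast
      moreover have "0 \<le> k * \<bar>u s\<bar>" using k by simp
      ultimately show ?thesis using True by simp
    qed simp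
  qed
qed

text \<open>In terms of \<open>w s = exp (- 2 * k * s) * u s\<close> the Picard operator contracts the
  supremum distance by the factor 1/2 on the whole time interval, however long: the weight \<open>exp (2 * k *
  r)\<close> integrates to at most \<open>exp (2 * k * s) / (2 * k)\<close>, which absorbs the Lipschitz
  constant.\<close>

lemma picard_contraction:
  assumes w: "continuous_on {0..T} w" and w': "continuous_on {0..T} w'" and s: "0 \<le> s" "s \<le> T"
    and d: "\<And>r. \<bar>w r - w' r\<bar> \<le> d"
  shows "\<bar>exp (- (2 * k * s)) * (u0 + (LINT r:{0..s}|lebesgue. F r (exp (2 * k * r) * w r)))
        - exp (- (2 * k * s)) * (u0 + (LINT r:{0..s}|lebesgue. F r (exp (2 * k * r) * w' r)))\<bar> \<le> 1 / 2 * d"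
proof -
  let ?u = "\<lambda>r. exp (2 * k * r) * w r" and ?u' = "\<lambda>r. exp (2 * k * r) * w' r"
  have cu: "continuous_on {0..T} ?u" "continuous_on {0..T} ?u'" by (intro continuous_intros w w')+
  have i: "set_integrable lebesgue {0..s} (\<lambda>r. F r (?u r))" "set_integrable lebesgue {0..s} (\<lambda>r. F r (?u' r))"
    by (rule set_integrable_subset[OF integrable_along]; use cu s in auto)+
  have d0: "0 \<le> d" using d[of 0] by linarith
  have eq: "(LINT r:{0..s}|lebesgue. F r (?u r)) - (LINT r:{0..s}|lebesgue. F r (?u' r))
      = (LINT r:{0..s}|lebesgue. F r (?u r) - F r (?u' r))"
    by (rule set_integral_diff(2)[OF i, symmetric])
  have "\<bar>(LINT r:{0..s}|lebesgue. F r (?u r)) - (LINT r:{0..s}|lebesgue. F r (?u' r))\<bar>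
      \<le> (LINT r:{0..s}|lebesgue. \<bar>F r (?u r) - F r (?u' r)\<bar>)"
    unfolding eq unfolding set_lebesgue_integral_def
    using integral_abs_bound[of lebesgue "\<lambda>r. indicator {0..s} r *\<^sub>R (F r (?u r) - F r (?u' r))"]
    by (simp add: abs_mult)
  also have "\<dots> \<le> (LINT r:{0..s}|lebesgue. d * (k * exp (2 * k * r)))"
    unfolding set_lebesgue_integral_def
  proof (rule integral_mono_AE)
    have "set_integrable lebesgue {0..s} (\<lambda>r. \<bar>F r (?u r) - F r (?u' r)\<bar>)"
      by (intro set_integrable_abs set_integral_diff(1) i)
    then show "integrable lebesgue (\<lambda>r. indicator {0..s} r *\<^sub>R \<bar>F r (?u r) - F r (?u' r)\<bar>)"
      by (simp add: set_integrable_def)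
    have "set_integrable lebesgue {0..s} (\<lambda>r. d * (k * exp (2 * k * r)))"
      by (intro set_integrable_mult_right integral_exp_weight s)
    then show "integrable lebesgue (\<lambda>r. indicator {0..s} r *\<^sub>R (d * (k * exp (2 * k * r))))"
      by (simp add: set_integrable_def)
    show "AE r in lebesgue. indicator {0..s} r *\<^sub>R \<bar>F r (?u r) - F r (?u' r)\<bar>
        \<le> indicator {0..s} r *\<^sub>R (d * (k * exp (2 * k * r)))"
      using lip AE_lebesgue_neq[of 0] AE_lebesgue_neq[of T]
    proof eventually_elim
      case (elim r)
      show ?case
      proof (cases "r \<in> {0..s}")
        case True
        then have "0 < r \<and> r < T" using elim(2,3) s by auto
        then have "\<bar>F r (?u r) - F r (?u' r)\<bar> \<le> k * \<bar>?u r - ?u' r\<bar>" using elim(1) by blast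
        also have "\<bar>?u r - ?u' r\<bar> = exp (2 * k * r) * \<bar>w r - w' r\<bar>"
          by (simp add: abs_mult flip: right_diff_distrib)
        also have "k * (exp (2 * k * r) * \<bar>w r - w' r\<bar>) \<le> k * (exp (2 * k * r) * d)"
          using k d by (intro mult_left_mono) auto
        finally show ?thesis using True by (simp add: mult_ac)
      qed simp
    qed
  qed
  also have "\<dots> = d * ((exp (2 * k * s) - 1) / 2)"
    by (subst set_integral_mult_right) (simp only: integral_exp_weight(2)[OF s(1)])
  finally have "\<bar>(LINT r:{0..s}|lebesgue. F r (?u r)) - (LINT r:{0..s}|lebesgue. F r (?u' r))\<bar>
     \<le> d * ((exp (2 * k * s) - 1) / 2)" .
  then have "exp (- (2 * k * s)) * \<bar>(LINT r:{0..s}|lebesgue. F r (?u r)) - (LINT r:{0..s}|lebesgue. F r (?u' r))\<bar>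
     \<le> exp (- (2 * k * s)) * (d * ((exp (2 * k * s) - 1) / 2))" by (intro mult_left_mono) auto
  also have "\<dots> = d / 2 - exp (- (2 * k * s)) * d / 2"
    by (simp add: exp_minus field_simps)
  also have "\<dots> \<le> 1 / 2 * d" using d0 by simp
  finally show ?thesis by (simp add: abs_mult flip: right_diff_distrib)
qed

text \<open>The fixed point lives in the complete space of bounded continuous functions on the line; functions
  on the time interval are extended to it by constants.\<close>

lemma caratheodory_existence:
  obtains u where "abs_continuous_on 0 T u" "u 0 = u0"
    "AE s in lebesgue. s \<in> {0..T} \<longrightarrow> (u has_real_derivative F s (u s)) (at s within {0..T})"
proof -
  define h where "h = (\<lambda>(w :: real \<Rightarrow>\<^sub>C real) s. exp (- (2 * k * s)) *
    (u0 + (LINT r:{0..s}|lebesgue. F r (exp (2 * k * r) * w r))))"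
  have cw: "continuous_on {0..T} (\<lambda>r. exp (2 * k * r) * apply_bcontfun w r)" for w
    by (intro continuous_intros) simp
  have ac: "abs_continuous_on 0 T (\<lambda>s. LINT r:{0..s}|lebesgue. F r (exp (2 * k * r) * apply_bcontfun w r))" for w
    by (rule indefinite_integral_abs_continuous[OF integrable_along[OF cw]])
  have "\<exists>g :: real \<Rightarrow>\<^sub>C real. \<forall>x. g x = h w (clamp 0 T x)" for w
  proof -
    have "continuous_on (cbox 0 T) (h w)"
      unfolding h_def using abs_continuous_on_continuous[OF ac[of w]] by (auto intro!: continuous_intros)
    then show ?thesis by (rule continuous_on_cbox_bcontfunE) blast
  qed
  then obtain P where P: "\<And>w x. apply_bcontfun (P w) x = h w (clamp 0 T x)" by metis
  have "\<exists>!w. P w = w"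
  proof (rule banach_fix_type[of "1/2"])
    show "\<forall>w w'. dist (P w) (P w') \<le> 1 / 2 * dist w w'"
    proof (intro allI dist_bound)
      fix w w' :: "real \<Rightarrow>\<^sub>C real" and x
      have c: "0 \<le> clamp 0 T x" "clamp 0 T x \<le> T" using clamp_in_interval[of 0 T x] T by auto
      have "\<bar>h w (clamp 0 T x) - h w' (clamp 0 T x)\<bar> \<le> 1 / 2 * dist w w'"
        unfolding h_def
        using dist_bounded[of w _ w'] by (intro picard_contraction c) (auto simp: dist_real_def)
      then show "dist (P w x) (P w' x) \<le> 1 / 2 * dist w w'" by (simp add: P dist_real_def)
    qed
  qed auto
  then obtain w where w: "P w = w" by blast
  define u where "u = (\<lambda>s. u0 + (LINT r:{0..s}|lebesgue. F r (exp (2 * k * r) * w r)))"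
  \<comment> \<open>undoing the weight turns the fixed point equation into the integral equation\<close>
  have u: "exp (2 * k * s) * w s = u s" if "s \<in> {0..T}" for s
  proof -
    have "w s = h w s" using P[of w s] that by (simp add: w clamp_cancel_cbox)
    then show ?thesis by (simp add: h_def u_def exp_minus)
  qed
  have uac: "abs_continuous_on 0 T u" unfolding u_def
    by (intro abs_continuous_on_add ac abs_continuous_on_lipschitz[of 0]) auto
  have u_0: "u 0 = u0" unfolding u_def using set_integral_degenerate[of 0] by simp
  obtain N where N: "negligible N" "\<And>x. \<lbrakk>0 < x; x < T; x \<notin> N\<rbrakk> \<Longrightarrow>
    ((\<lambda>s. LINT r:{0..s}|lebesgue. F r (exp (2 * k * r) * w r)) has_real_derivative F x (exp (2 * k * x) * w x)) (at x)"
    using indefinite_integral_derivative[OF integrable_along[OF cw]] by blast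
  have "AE s in lebesgue. s \<in> {0..T} \<longrightarrow> (u has_real_derivative F s (u s)) (at s within {0..T})"
    using negligible_imp_AE[OF N(1)] AE_lebesgue_neq[of 0] AE_lebesgue_neq[of T]
  proof eventually_elim
    case (elim s)
    show ?case
    proof
      assume s: "s \<in> {0..T}"
      then have "((\<lambda>s. LINT r:{0..s}|lebesgue. F r (exp (2 * k * r) * w r)) has_real_derivative F s (u s)) (at s)"
        using N(2)[of s] elim u[OF s] by auto
      then have "(u has_real_derivative F s (u s)) (at s)" unfolding u_def by (auto intro!: derivative_eq_intros)
      then show "(u has_real_derivative F s (u s)) (at s within {0..T})" by (rule has_field_derivative_at_within)
    qed
  qed
  then show thesis using that[OF uac u_0] by blast
qed

end

section \<open>Entropy of a stretched arc\<close>

lemma log_enat_mono: "m \<le> n \<Longrightarrow> log_enat m \<le> log_enat n"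
  by (cases m; cases n) auto

text \<open>If no finite set spans, the infimum is infinite and so is its logarithm; otherwise the infimum is
  attained.\<close>

lemma log_enat_INF_ge:
  assumes c: "0 < c" and le: "\<And>E. E \<in> S \<Longrightarrow> c \<le> real (card E)"
  shows "ereal (ln c) \<le> log_enat (INF E\<in>S. enat (card E))"
proof (cases "S = {}")
  case True
  then show ?thesis by (simp add: top_enat_def)
next
  case False
  then obtain E where E: "E \<in> S" "(INF E\<in>S. enat (card E)) = enat (card E)"
    by (metis (no_types, lifting) imageE image_is_empty ex_in_conv wellorder_InfI)
  have "c \<le> real (card E)" by (rule le[OF E(1)])
  then show ?thesis using c by (simp add: E(2))
qed

lemma spanning_number_antimono:
  assumes "\<epsilon> \<le> \<epsilon>'"
  shows "spanning_number X T t \<epsilon>' K \<le> spanning_number X T t \<epsilon> K"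
proof -
  have "bowen_ball X T x t \<epsilon> \<subseteq> bowen_ball X T x t \<epsilon>'" for x
    using assms by (auto simp: bowen_ball_def)
  then show ?thesis unfolding spanning_number_def by (intro INF_superset_mono) blast+
qed

text \<open>The entropy is a \<open>Lim\<close>, which says something only if the limit exists. It does,
  because the spanning number decreases in \<open>\<epsilon>\<close>, and it is then a supremum.\<close>

lemma entropy_on_ge:
  assumes ge: "\<And>\<epsilon>. 0 < \<epsilon> \<Longrightarrow> h \<le> Limsup at_top (\<lambda>t::real. ereal (1 / t) * log_enat (spanning_number X T t \<epsilon> K))"
  shows "h \<le> entropy_on X T K"
proof -
  define f where "f = (\<lambda>\<epsilon>. Limsup at_top (\<lambda>t::real. ereal (1 / t) * log_enat (spanning_number X T t \<epsilon> K)))"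
  have anti: "f \<epsilon>' \<le> f \<epsilon>" if "\<epsilon> \<le> \<epsilon>'" for \<epsilon> \<epsilon>'
    unfolding f_def
  proof (rule Limsup_mono)
    show "\<forall>\<^sub>F t in at_top. ereal (1 / t) * log_enat (spanning_number X T t \<epsilon>' K)
        \<le> ereal (1 / t) * log_enat (spanning_number X T t \<epsilon> K)"
      using eventually_gt_at_top[of 0]
      by eventually_elim (intro ereal_mult_left_mono log_enat_mono spanning_number_antimono that, simp)
  qed
  have "(f \<longlongrightarrow> (SUP \<epsilon>\<in>{0<..}. f \<epsilon>)) (at_right 0)"
  proof (rule order_tendstoI)
    fix l assume "l < (SUP \<epsilon>\<in>{0<..}. f \<epsilon>)"
    then obtain \<epsilon>\<^sub>0 where e: "0 < \<epsilon>\<^sub>0" "l < f \<epsilon>\<^sub>0" by (auto simp: less_SUP_iff)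
    have "\<forall>\<^sub>F \<epsilon> in at_right 0. \<epsilon> \<in> {0<..<\<epsilon>\<^sub>0}" by (rule eventually_at_right_real[OF e(1)])
    then show "\<forall>\<^sub>F \<epsilon> in at_right 0. l < f \<epsilon>"
      by eventually_elim (use anti e(2) in \<open>auto intro: less_le_trans\<close>)
  next
    fix u assume u: "(SUP \<epsilon>\<in>{0<..}. f \<epsilon>) < u"
    have "\<forall>\<^sub>F \<epsilon> in at_right (0::real). \<epsilon> \<in> {0<..<1}" by (rule eventually_at_right_real) simp
    then show "\<forall>\<^sub>F \<epsilon> in at_right 0. f \<epsilon> < u"
      by eventually_elim (use u in \<open>auto intro: le_less_trans[OF SUP_upper]\<close>)
  qed
  then have "entropy_on X T K = (SUP \<epsilon>\<in>{0<..}. f \<epsilon>)"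
    unfolding entropy_on_def f_def by (intro tendsto_Lim) simp_all
  moreover have "h \<le> f 1" using ge[of 1] by (simp add: f_def)
  moreover have "f 1 \<le> (SUP \<epsilon>\<in>{0<..}. f \<epsilon>)" by (rule SUP_upper) simp
  ultimately show ?thesis by simp
qed

text \<open>If a parametrised arc is stretched at rate \<open>lam\<close>, two parameters in the same Bowen
  ball of radius \<open>\<epsilon>\<close> differ by at most \<open>2 * \<epsilon> * exp (- lam * t)\<close>,
  and comparing lengths bounds the number of balls from below. The triangle inequality appears as a hypothesis
  because \<open>T t\<close> may leave the space: only distances between images have to make sense.\<close>

lemma entropy_on_expanding_arc:
  fixes y :: "real \<Rightarrow> 'x"
  assumes a: "0 < a" and lam: "0 < lam"
    and expand: "\<And>t \<delta> \<delta>'. \<lbrakk>0 \<le> t; \<delta> \<in> {0..a}; \<delta>' \<in> {0..a}\<rbrakk> \<Longrightarrow>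
       exp (lam * t) * \<bar>\<delta> - \<delta>'\<bar> \<le> mdist X (T t (y \<delta>)) (T t (y \<delta>'))"
    and tri: "\<And>t \<delta> \<delta>' z. \<lbrakk>0 \<le> t; \<delta> \<in> {0..a}; \<delta>' \<in> {0..a}; z \<in> mspace X\<rbrakk> \<Longrightarrow>
       mdist X (T t (y \<delta>)) (T t (y \<delta>')) \<le> mdist X (T t (y \<delta>)) (T t z) + mdist X (T t (y \<delta>')) (T t z)"
  shows "ereal lam \<le> entropy_on X T {y \<delta> | \<delta>. \<delta> \<in> {0..a}}"
proof (rule entropy_on_ge)
  fix \<epsilon> :: real assume e: "0 < \<epsilon>"
  let ?K = "{y \<delta> | \<delta>. \<delta> \<in> {0..a}}"
  have card: "a * exp (lam * t) / (4 * \<epsilon>) \<le> real (card E)"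
    if t: "0 \<le> t" and E: "finite E" "E \<subseteq> mspace X" "?K \<subseteq> (\<Union>x\<in>E. bowen_ball X T x t \<epsilon>)" for t E
  proof -
    \<comment> \<open>the diameter of the set of parameters in one Bowen ball\<close>
    define r where "r = 2 * \<epsilon> * exp (- (lam * t))"
    have r: "0 < r" using e by (simp add: r_def)
    define S where "S = (\<lambda>x. {\<delta> \<in> {0..a}. y \<delta> \<in> bowen_ball X T x t \<epsilon>})"
    have near: "\<bar>\<delta> - \<delta>'\<bar> \<le> r" if "x \<in> E" "\<delta> \<in> S x" "\<delta>' \<in> S x" for x \<delta> \<delta>'
    proof -
      have d: "\<delta> \<in> {0..a}" "\<delta>' \<in> {0..a}" "x \<in> mspace X" using that E(2) by (auto simp: S_def)
      have "mdist X (T t (y \<delta>)) (T t x) < \<epsilon>" "mdist X (T t (y \<delta>')) (T t x) < \<epsilon>"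
        using that t by (auto simp: S_def bowen_ball_def)
      then have "exp (lam * t) * \<bar>\<delta> - \<delta>'\<bar> \<le> 2 * \<epsilon>" using expand[OF t d(1,2)] tri[OF t d] by linarith
      then show ?thesis by (simp add: r_def exp_minus field_simps)
    qed
    define c where "c = (\<lambda>x. SOME \<delta>. \<delta> \<in> S x)"
    have sub: "{0..a} \<subseteq> (\<Union>x\<in>E. cball (c x) r)"
    proof
      fix \<delta> assume \<delta>: "\<delta> \<in> {0..a}"
      then obtain x where x: "x \<in> E" "\<delta> \<in> S x" using E(3) by (auto simp: S_def)
      then have "c x \<in> S x" unfolding c_def by (metis someI)
      then show "\<delta> \<in> (\<Union>x\<in>E. cball (c x) r)" using near[OF x(1) _ x(2)] x(1) by (auto simp: dist_real_def)
    qed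
    have "a = measure lborel {0..a}" using a by simp
    also have "\<dots> \<le> measure lborel (\<Union>x\<in>E. cball (c x) r)"
    proof (rule measure_mono_fmeasurable[OF sub])
      show "(\<Union>x\<in>E. cball (c x) r) \<in> fmeasurable lborel"
        by (rule fmeasurable.finite_UN[OF E(1)]) (simp add: fmeasurable_def emeasure_lborel_Icc_eq cball_eq_atLeastAtMost)
    qed simp
    also have "\<dots> \<le> (\<Sum>x\<in>E. measure lborel (cball (c x) r))"
      by (rule measure_UNION_le[OF E(1)]) simp
    also have "\<dots> = real (card E) * (2 * r)" using r by (simp add: cball_eq_atLeastAtMost)
    finally have "a \<le> real (card E) * (4 * \<epsilon> * exp (- (lam * t)))" by (simp add: r_def mult_ac)
    then show ?thesis using e by (simp add: exp_minus field_simps)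
  qed
  \<comment> \<open>the constant \<open>ln (a / (4 * \<epsilon>))\<close> disappears after division by \<open>t\<close>\<close>
  have ln_eq: "ln (a * exp (lam * t) / (4 * \<epsilon>)) = lam * t + ln (a / (4 * \<epsilon>))" for t
    using a e by (simp add: ln_mult ln_div)
  have lower: "\<forall>\<^sub>F t in at_top. ereal (lam + ln (a / (4 * \<epsilon>)) / t) \<le> ereal (1 / t) * log_enat (spanning_number X T t \<epsilon> ?K)"
    using eventually_gt_at_top[of 0]
  proof eventually_elim
    case (elim t)
    have "ereal (ln (a * exp (lam * t) / (4 * \<epsilon>))) \<le> log_enat (spanning_number X T t \<epsilon> ?K)"
      unfolding spanning_number_def
      by (rule log_enat_INF_ge) (use a e card[of t] elim in auto)
    then have "ereal (1 / t) * ereal (lam * t + ln (a / (4 * \<epsilon>))) \<le> ereal (1 / t) * log_enat (spanning_number X T t \<epsilon> ?K)"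
      using elim unfolding ln_eq by (intro ereal_mult_left_mono) auto
    moreover have "1 / t * (lam * t + ln (a / (4 * \<epsilon>))) = lam + ln (a / (4 * \<epsilon>)) / t"
      using elim by (simp add: field_simps)
    ultimately show ?case by simp
  qed
  have "((\<lambda>t. lam + ln (a / (4 * \<epsilon>)) / t) \<longlongrightarrow> lam + 0) at_top"
    by (intro tendsto_intros tendsto_divide_0[OF tendsto_const] filterlim_at_top_imp_at_infinity filterlim_ident)
  then have "((\<lambda>t. ereal (lam + ln (a / (4 * \<epsilon>)) / t)) \<longlongrightarrow> ereal lam) at_top" by simp
  then have "ereal lam = Limsup at_top (\<lambda>t. ereal (lam + ln (a / (4 * \<epsilon>)) / t))"
    by (intro lim_imp_Limsup[symmetric]) simp_all
  also have "\<dots> \<le> Limsup at_top (\<lambda>t. ereal (1 / t) * log_enat (spanning_number X T t \<epsilon> ?K))"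
    by (rule Limsup_mono[OF lower])
  finally show "ereal lam \<le> Limsup at_top (\<lambda>t. ereal (1 / t) * log_enat (spanning_number X T t \<epsilon> ?K))" .
qed

text \<open>The metric of C(M) is the restriction of the supremum metric on the bounded functions. The
  following facts are therefore stated for bounded functions, which is what is known of the values of the
  semigroup.\<close>

lemma fspace_iff_bounded:
  "f \<in> Metric_space.fspace UNIV dist UNIV \<longleftrightarrow> bounded (range (f :: 'a \<Rightarrow> real))"
proof -
  show ?thesis by (simp add: Met_TC.fspace_def Met_TC.mbounded extensional_def bounded_def)
qed

lemma mdist_CM: "mdist (CM :: ('a::topological_space \<Rightarrow> real) metric) = Metric_space.fdist UNIV dist UNIV"
  by (simp add: mdist_cfunspace_eq_mdist_funspace)

lemma mdist_CM_ge:
  fixes f g :: "'a::topological_space \<Rightarrow> real"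
  assumes "bounded (range f)" "bounded (range g)"
  shows "\<bar>f x - g x\<bar> \<le> mdist CM f g"
proof -
  have fg: "f \<in> Met_TC.fspace UNIV" "g \<in> Met_TC.fspace UNIV" using assms by (simp_all add: fspace_iff_bounded)
  have "dist (f x) (g x) \<le> Sup ((\<lambda>x. dist (f x) (g x)) ` UNIV)"
    by (rule cSUP_upper[OF UNIV_I Met_TC.bdd_above_dist[OF fg]]) simp
  then show ?thesis using fg by (simp add: mdist_CM Met_TC.fdist_def dist_real_def)
qed

lemma mdist_CM_triangle:
  fixes f g h :: "'a::topological_space \<Rightarrow> real"
  assumes "bounded (range f)" "bounded (range g)" "bounded (range h)"
  shows "mdist CM f g \<le> mdist CM f h + mdist CM g h"
proof -
  interpret F: Metric_space "Met_TC.fspace (UNIV :: 'a set)" "Met_TC.fdist UNIV" by (rule Met_TC.Metric_space_funspace)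
  show ?thesis unfolding mdist_CM
    using F.triangle[of f h g] F.commute[of h g] assms by (simp add: fspace_iff_bounded)
qed

lemma mspace_CM_iff:
  "f \<in> mspace (CM :: ('a::topological_space \<Rightarrow> real) metric) \<longleftrightarrow> continuous_on UNIV f \<and> bounded (range f)"
  using fspace_iff_bounded[of f]
  by (auto simp: Metric_space.fspace_def[OF Met_TC.Metric_space_axioms])

lemma compactin_translates_of_zero:
  "compactin (mtopology_of (CM :: ('a::topological_space \<Rightarrow> real) metric)) {(\<lambda>x. 0 + \<delta>) | \<delta>. \<delta> \<in> {0..1}}"
proof -
  let ?c = "\<lambda>\<delta>::real. (\<lambda>x::'a. 0 + \<delta>)"
  interpret C: Metric_space "mspace (CM :: ('a \<Rightarrow> real) metric)" "mdist CM" by (rule Metric_space_mspace_mdist)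
  have mem: "?c \<delta> \<in> mspace CM" for \<delta> by (simp only: mspace_CM_iff) simp
  have d: "mdist CM (?c \<delta>) (?c \<delta>') = dist \<delta> \<delta>'" for \<delta> \<delta>'
    unfolding mdist_CM Met_TC.fdist_def by (simp add: fspace_iff_bounded)
  have "continuous_map euclidean (mtopology_of CM) ?c"
    unfolding mtopology_of_def C.continuous_map_to_metric
  proof (intro ballI allI impI)
    fix \<delta> \<epsilon> :: real assume "0 < \<epsilon>"
    show "\<exists>U. openin euclidean U \<and> \<delta> \<in> U \<and> (\<forall>\<delta>'\<in>U. ?c \<delta>' \<in> C.mball (?c \<delta>) \<epsilon>)"
    proof (intro exI[of _ "ball \<delta> \<epsilon>"] conjI ballI)
      fix \<delta>' assume "\<delta>' \<in> ball \<delta> \<epsilon>"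
      then show "?c \<delta>' \<in> C.mball (?c \<delta>) \<epsilon>"
        unfolding C.in_mball using mem[of \<delta>] mem[of \<delta>'] d[of \<delta> \<delta>'] by (metis mem_ball)
    qed (use \<open>0 < \<epsilon>\<close> in simp_all)
  qed
  moreover have "compactin euclidean {0..1::real}" by simp
  ultimately have "compactin (mtopology_of CM) (?c ` {0..1})" by (intro image_compactin)
  moreover have "?c ` {0..1} = {(\<lambda>x. 0 + \<delta>) | \<delta>. \<delta> \<in> {0..1}}" by auto
  ultimately show ?thesis by simp
qed

section \<open>Velocities of absolutely continuous arcs\<close>

lemma borel_measurable_lebesgue_AE:
  fixes f g :: "real \<Rightarrow> real"
  assumes f: "f \<in> borel_measurable lebesgue" and ae: "AE x in lebesgue. f x = g x"
  shows "g \<in> borel_measurable lebesgue"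
proof (rule measurableI)
  fix B :: "real set" assume B: "B \<in> sets borel"
  show "g -` B \<inter> space lebesgue \<in> sets lebesgue"
  proof (rule completion.in_sets_AE)
    show "AE x in lebesgue. x \<in> f -` B \<inter> space lebesgue \<longleftrightarrow> x \<in> g -` B \<inter> space lebesgue"
      using ae by eventually_elim simp
    show "f -` B \<inter> space lebesgue \<in> sets lebesgue" using f B by (rule measurable_sets)
  qed simp
qed simp

text \<open>The velocity of an arc is computed in charts, hence only on pieces of the time interval.
  Measurability on countably many pieces that cover all interior times is enough.\<close>

lemma borel_measurable_lebesgue_locally:
  fixes f :: "real \<Rightarrow> real"
  assumes t: "0 < t" and Q: "countable Q"
    and cov: "\<And>s. 0 < s \<Longrightarrow> s < t \<Longrightarrow> \<exists>p q. (p, q) \<in> Q \<and> p < s \<and> s < q"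
    and sub: "\<And>p q. (p, q) \<in> Q \<Longrightarrow> 0 \<le> p \<and> q \<le> t"
    and meas: "\<And>p q. (p, q) \<in> Q \<Longrightarrow> (\<lambda>s. indicator {p<..<q} s * f s) \<in> borel_measurable lebesgue"
  shows "(\<lambda>s. indicator {0..t} s * f s) \<in> borel_measurable lebesgue"
proof -
  let ?f = "\<lambda>s. indicator {0<..<t} s * f s"
  have "?f \<in> borel_measurable lebesgue"
  proof (rule measurable_piecewise_restrict[where C = "insert (- {0<..<t}) ((\<lambda>(p, q). {p<..<q}) ` Q)"])
    show "countable (insert (- {0<..<t}) ((\<lambda>(p, q). {p<..<q}) ` Q))" using Q by simp
    show "space lebesgue \<subseteq> \<Union> (insert (- {0<..<t}) ((\<lambda>(p, q). {p<..<q}) ` Q))" using cov by fastforce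
    fix \<Omega> assume "\<Omega> \<in> insert (- {0<..<t}) ((\<lambda>(p, q). {p<..<q}) ` Q)"
    then consider "\<Omega> = - {0<..<t}" | p q where "(p, q) \<in> Q" "\<Omega> = {p<..<q}" by auto
    note cases = this
    from cases have \<Omega>: "\<Omega> \<in> sets lebesgue" by cases auto
    then show "\<Omega> \<inter> space lebesgue \<in> sets lebesgue" by simp
    have "(\<lambda>s. indicator \<Omega> s *\<^sub>R ?f s) \<in> borel_measurable lebesgue"
    proof (use cases in cases)
      case 1
      then have "(\<lambda>s. indicator \<Omega> s *\<^sub>R ?f s) = (\<lambda>_. 0)" by (auto simp: indicator_def)
      then show ?thesis by simp
    next
      case 2
      then have "(\<lambda>s. indicator \<Omega> s *\<^sub>R ?f s) = (\<lambda>s. indicator {p<..<q} s * f s)"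
        using sub[OF 2(1)] by (auto simp: indicator_def)
      then show ?thesis using meas[OF 2(1)] by simp
    qed
    then show "?f \<in> borel_measurable (restrict_space lebesgue \<Omega>)"
      using \<Omega> by (subst borel_measurable_restrict_space_iff) auto
  qed
  moreover have "AE s in lebesgue. ?f s = indicator {0..t} s * f s"
    using AE_lebesgue_neq[of 0] AE_lebesgue_neq[of t] by eventually_elim (auto simp: indicator_def)
  ultimately show ?thesis by (rule borel_measurable_lebesgue_AE)
qed

text \<open>The derivative is almost everywhere the limit of the difference quotients for the steps \<open>1 /
  (n + 1)\<close>, which are continuous once \<open>y\<close> is extended by constants.\<close>

lemma AE_derivative_measurable:
  fixes y :: "real \<Rightarrow> 'e::euclidean_space"
  assumes pq: "p < q" and y: "abs_continuous_on p q y"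
  obtains D where "D \<in> borel_measurable borel"
    "AE s in lebesgue. p < s \<and> s < q \<longrightarrow> D s = vector_derivative y (at s)"
proof -
  define Y where "Y = (\<lambda>s. y (max p (min q s)))"
  have cY: "continuous_on UNIV Y" unfolding Y_def
    by (rule continuous_on_compose2[OF abs_continuous_on_continuous[OF y]])
       (use pq in \<open>auto intro!: continuous_intros\<close>)
  define D where "D = (\<lambda>s. lim (\<lambda>n::nat. (real n + 1) *\<^sub>R (Y (s + 1 / (real n + 1)) - Y s)))"
  have "(\<lambda>s. (real n + 1) *\<^sub>R (Y (s + 1 / (real n + 1)) - Y s)) \<in> borel_measurable borel" for n :: nat
    by (rule borel_measurable_continuous_onI)
       (auto intro!: continuous_intros continuous_on_compose2[OF cY])
  then have "D \<in> borel_measurable borel" unfolding D_def by (rule borel_measurable_lim_metric)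
  moreover have "AE s in lebesgue. p < s \<and> s < q \<longrightarrow> D s = vector_derivative y (at s)"
    using abs_continuous_on_differentiable[OF y]
  proof eventually_elim
    case (elim s)
    show ?case
    proof
      assume s: "p < s \<and> s < q"
      let ?V = "vector_derivative y (at s)"
      have "(y has_vector_derivative ?V) (at s)" using elim s by (simp add: vector_derivative_works)
      then have "(Y has_vector_derivative ?V) (at s)"
        by (rule has_vector_derivative_transform_within_open[of _ _ _ "{p<..<q}"]) (use s in \<open>auto simp: Y_def\<close>)
      then have "((\<lambda>h. norm (Y (s + h) - Y s - h *\<^sub>R ?V) / norm h) \<longlongrightarrow> 0) (at 0)"
        by (simp add: has_vector_derivative_def has_derivative_at)
      moreover have "\<forall>\<^sub>F h in at 0. norm (Y (s + h) - Y s - h *\<^sub>R ?V) / norm h = norm ((Y (s + h) - Y s) /\<^sub>R h - ?V)"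
        unfolding eventually_at_filter
      proof (intro always_eventually allI impI)
        fix h :: real assume h: "h \<noteq> 0"
        have eq: "(Y (s + h) - Y s) /\<^sub>R h - ?V = (Y (s + h) - Y s - h *\<^sub>R ?V) /\<^sub>R h"
          using h by (simp add: scaleR_diff_right)
        show "norm (Y (s + h) - Y s - h *\<^sub>R ?V) / norm h = norm ((Y (s + h) - Y s) /\<^sub>R h - ?V)"
          unfolding eq norm_scaleR abs_inverse divide_inverse real_norm_def by (rule mult.commute)
      qed
      ultimately have "((\<lambda>h. norm ((Y (s + h) - Y s) /\<^sub>R h - ?V)) \<longlongrightarrow> 0) (at 0)"
        by (rule Lim_transform_eventually)
      then have lim: "((\<lambda>h. (Y (s + h) - Y s) /\<^sub>R h) \<longlongrightarrow> ?V) (at 0)"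
        by (rule LIM_zero_cancel[OF tendsto_norm_zero_cancel])
      have "filterlim (\<lambda>n. 1 / (real n + 1)) (at 0) sequentially"
      proof (rule filterlim_atI)
        show "(\<lambda>n. 1 / (real n + 1)) \<longlonglongrightarrow> 0" using LIMSEQ_inverse_real_of_nat by (simp add: inverse_eq_divide add.commute)
      qed simp
      from filterlim_compose[OF lim this]
      have "(\<lambda>n. (real n + 1) *\<^sub>R (Y (s + 1 / (real n + 1)) - Y s)) \<longlonglongrightarrow> ?V" by simp
      then show "D s = ?V" unfolding D_def by (rule limI)
    qed
  qed
  ultimately show thesis by (rule that)
qed

lemma is_chartD:
  assumes "is_chart c"
  shows "open (fst c)" "open (snd c ` fst c)" "continuous_on (fst c) (snd c)"
    "\<And>x. x \<in> fst c \<Longrightarrow> chart_inv c (snd c x) = x"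
  using assms unfolding is_chart_def homeomorphism_def chart_inv_def by auto

locale manifold_atlas =
  fixes \<A> :: "('a::t2_space, 'e::euclidean_space) chart set"
  assumes manifold: "compact_connected_manifold \<A>"
begin

lemma chart: "c \<in> \<A> \<Longrightarrow> is_chart c"
  using manifold by (simp add: compact_connected_manifold_def smooth_atlas_def)

lemma chart_at: obtains c where "c \<in> \<A>" "x \<in> fst c"
  using manifold unfolding compact_connected_manifold_def smooth_atlas_def by blast

lemma transition_differentiable:
  assumes "c \<in> \<A>" "c' \<in> \<A>" "x \<in> fst c" "x \<in> fst c'"
  shows "(snd c' \<circ> chart_inv c) differentiable (at (snd c x))"
proof -
  have "smooth_on (snd c ` (fst c \<inter> fst c')) (snd c' \<circ> chart_inv c)"
    using manifold assms by (simp add: compact_connected_manifold_def smooth_atlas_def)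
  then have "Ck_on (Suc 0) (snd c ` (fst c \<inter> fst c')) (snd c' \<circ> chart_inv c)"
    unfolding smooth_on_def by blast
  then have "\<forall>q\<in>snd c ` (fst c \<inter> fst c'). (snd c' \<circ> chart_inv c) differentiable (at q)"
    unfolding Ck_on.simps by (rule conjunct1)
  moreover have "snd c x \<in> snd c ` (fst c \<inter> fst c')" using assms(3,4) by blast
  ultimately show ?thesis by (rule bspec)
qed

lemma zero_tangent: "(\<lambda>_. 0) \<in> tangent_space \<A> x"
  unfolding tangent_space_def mem_Collect_eq
proof (intro conjI ballI allI impI)
  fix c c' assume "c \<in> \<A>" "c' \<in> \<A>" "x \<in> fst c \<and> x \<in> fst c'"
  then have "(snd c' \<circ> chart_inv c) differentiable (at (snd c x))"
    using transition_differentiable[of c c' x] by blast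
  then show "0 = frechet_derivative (snd c' \<circ> chart_inv c) (at (snd c x)) 0"
    by (metis linear_0 linear_frechet_derivative)
qed simp

lemma tangent_eq_tangent_of:
  assumes "v \<in> tangent_space \<A> x" "c \<in> \<A>" "x \<in> fst c"
  shows "v = tangent_of \<A> c x (v c)"
proof
  fix c'
  show "v c' = tangent_of \<A> c x (v c) c'"
  proof (cases "c' \<in> \<A> \<and> x \<in> fst c'")
    case True
    then have "v c' = frechet_derivative (snd c' \<circ> chart_inv c) (at (snd c x)) (v c)"
      using assms unfolding tangent_space_def by blast
    then show ?thesis unfolding tangent_of_def if_P[OF True] .
  next
    case False
    then have "v c' = 0" using assms(1) unfolding tangent_space_def by blast
    then show ?thesis unfolding tangent_of_def if_not_P[OF False] .
  qed
qed

text \<open>The chain rule for a transition map. In particular differentiability of an arc at a time does not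
  depend on the chart.\<close>

lemma vector_derivative_chart_change:
  assumes c: "c \<in> \<A>" "\<xi> s \<in> fst c" and c': "c' \<in> \<A>" "\<xi> s \<in> fst c'"
    and \<xi>: "isCont \<xi> s" and d: "(snd c \<circ> \<xi>) differentiable (at s)"
  shows "(snd c' \<circ> \<xi> has_vector_derivative
     frechet_derivative (snd c' \<circ> chart_inv c) (at (snd c (\<xi> s))) (vector_derivative (snd c \<circ> \<xi>) (at s))) (at s)"
proof -
  let ?\<tau> = "snd c' \<circ> chart_inv c" and ?y = "snd c \<circ> \<xi>"
  let ?D = "frechet_derivative ?\<tau> (at (snd c (\<xi> s)))" and ?V = "vector_derivative ?y (at s)"
  have \<tau>: "(?\<tau> has_derivative ?D) (at (?y s))"
    using transition_differentiable[OF c(1) c'(1) c(2) c'(2)] frechet_derivative_works by auto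
  have y: "(?y has_derivative (\<lambda>h. h *\<^sub>R ?V)) (at s)"
    using d by (simp add: vector_derivative_works has_vector_derivative_def)
  have lin: "linear ?D" using \<tau> has_derivative_linear by blast
  have "((?\<tau> \<circ> ?y) has_derivative (?D \<circ> (\<lambda>h. h *\<^sub>R ?V))) (at s)" by (rule diff_chain_at[OF y \<tau>])
  moreover have "?D \<circ> (\<lambda>h. h *\<^sub>R ?V) = (\<lambda>h. h *\<^sub>R ?D ?V)" by (auto simp: linear_scale[OF lin])
  ultimately have 1: "((?\<tau> \<circ> ?y) has_derivative (\<lambda>h. h *\<^sub>R ?D ?V)) (at s)" by simp
  have "open (fst c)" by (rule is_chartD(1)[OF chart[OF c(1)]])
  then have ev: "\<forall>\<^sub>F r in at s. \<xi> r \<in> fst c"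
    using topological_tendstoD[OF \<xi>[unfolded isCont_def] _ c(2)] by blast
  have "((snd c' \<circ> \<xi>) has_derivative (\<lambda>h. h *\<^sub>R ?D ?V)) (at s)"
  proof (rule has_derivative_transform_eventually[OF 1])
    show "\<forall>\<^sub>F r in at s. (?\<tau> \<circ> ?y) r = (snd c' \<circ> \<xi>) r"
      using ev by eventually_elim (simp add: is_chartD(4)[OF chart[OF c(1)]])
  qed (use c(2) in \<open>simp_all add: is_chartD(4)[OF chart[OF c(1)]]\<close>)
  then show ?thesis by (simp add: has_vector_derivative_def)
qed

lemma velocity_tangent:
  assumes c: "c \<in> \<A>" "\<xi> s \<in> fst c" and \<xi>: "isCont \<xi> s" and d: "(snd c \<circ> \<xi>) differentiable (at s)"
  shows "velocity \<A> \<xi> s \<in> tangent_space \<A> (\<xi> s)"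
proof -
  have diff: "(snd c' \<circ> \<xi>) differentiable (at s)" if "c' \<in> \<A>" "\<xi> s \<in> fst c'" for c'
    by (rule differentiableI_vector[OF vector_derivative_chart_change[OF c that \<xi> d]])
  have change: "vector_derivative (snd c2 \<circ> \<xi>) (at s) = frechet_derivative (snd c2 \<circ> chart_inv c1) (at (snd c1 (\<xi> s)))
       (vector_derivative (snd c1 \<circ> \<xi>) (at s))"
    if "c1 \<in> \<A>" "\<xi> s \<in> fst c1" "c2 \<in> \<A>" "\<xi> s \<in> fst c2" for c1 c2
    by (rule vector_derivative_at[OF vector_derivative_chart_change[OF that \<xi> diff[OF that(1,2)]]])
  show ?thesis unfolding tangent_space_def mem_Collect_eq
  proof (intro conjI ballI allI impI)
    fix c1 c2 assume "c1 \<in> \<A>" "c2 \<in> \<A>" "\<xi> s \<in> fst c1 \<and> \<xi> s \<in> fst c2"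
    then show "velocity \<A> \<xi> s c2 = frechet_derivative (snd c2 \<circ> chart_inv c1) (at (snd c1 (\<xi> s))) (velocity \<A> \<xi> s c1)"
      using change[of c1 c2] by (simp add: velocity_def)
  next
    fix c assume "\<not> (c \<in> \<A> \<and> \<xi> s \<in> fst c)"
    then show "velocity \<A> \<xi> s c = 0" by (simp only: velocity_def if_False)
  qed
qed

text \<open>Countably many time intervals on each of which the arc stays in a single chart. The atlas itself
  may be uncountable, so the charts cannot be used as indices.\<close>

definition rational_chart_intervals :: "real \<Rightarrow> (real \<Rightarrow> 'a) \<Rightarrow> (real \<times> real) set" where
  "rational_chart_intervals t \<xi> =
     {(p, q). p \<in> \<rat> \<and> q \<in> \<rat> \<and> 0 \<le> p \<and> p < q \<and> q \<le> t \<and> (\<exists>c\<in>\<A>. \<xi> ` {p..q} \<subseteq> fst c)}"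

lemma countable_rational_chart_intervals: "countable (rational_chart_intervals t \<xi>)"
  by (rule countable_subset[of _ "\<rat> \<times> \<rat>"]) (auto simp: rational_chart_intervals_def countable_rat)

lemma isCont_arc: "\<xi> \<in> ac_arcs \<A> t x \<Longrightarrow> 0 < s \<Longrightarrow> s < t \<Longrightarrow> isCont \<xi> s"
  by (auto simp: ac_arcs_def intro: continuous_on_interior)

lemma rational_chart_intervals_cover:
  assumes \<xi>: "\<xi> \<in> ac_arcs \<A> t x" and s: "0 < s" "s < t"
  shows "\<exists>p q. (p, q) \<in> rational_chart_intervals t \<xi> \<and> p < s \<and> s < q"
proof -
  obtain c where c: "c \<in> \<A>" "\<xi> s \<in> fst c" by (rule chart_at)
  have "open (fst c)" by (rule is_chartD(1)[OF chart[OF c(1)]])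
  then have "\<forall>\<^sub>F r in nhds s. \<xi> r \<in> fst c"
    using topological_tendstoD[OF isCont_arc[OF \<xi> s, unfolded isCont_def tendsto_at_iff_tendsto_nhds] _ c(2)]
    by blast
  then obtain d where d: "0 < d" "\<And>r. dist r s < d \<Longrightarrow> \<xi> r \<in> fst c"
    unfolding eventually_nhds_metric by blast
  obtain p where p: "p \<in> \<rat>" "max 0 (s - d) < p" "p < s" using Rats_dense_in_real[of "max 0 (s - d)" s] s d by auto
  obtain q where q: "q \<in> \<rat>" "s < q" "q < min t (s + d)" using Rats_dense_in_real[of s "min t (s + d)"] s d by auto
  have "\<xi> ` {p..q} \<subseteq> fst c"
  proof clarify
    fix r assume "r \<in> {p..q}"
    then show "\<xi> r \<in> fst c" using p q by (intro d(2)) (auto simp: dist_real_def)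
  qed
  then have "(p, q) \<in> rational_chart_intervals t \<xi>" using p q c(1) by (auto simp: rational_chart_intervals_def)
  then show ?thesis using p q by blast
qed

lemma rational_chart_intervalsD:
  assumes "\<xi> \<in> ac_arcs \<A> t x" "(p, q) \<in> rational_chart_intervals t \<xi>"
  obtains c where "c \<in> \<A>" "\<xi> ` {p..q} \<subseteq> fst c" "abs_continuous_on p q (snd c \<circ> \<xi>)" "0 \<le> p" "p < q" "q \<le> t"
proof -
  from assms(2) obtain c where c: "c \<in> \<A>" "\<xi> ` {p..q} \<subseteq> fst c" "0 \<le> p" "p < q" "q \<le> t"
    unfolding rational_chart_intervals_def by blast
  moreover have "abs_continuous_on p q (snd c \<circ> \<xi>)"
    using assms(1) c less_imp_le[OF c(4)] unfolding ac_arcs_def by blast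
  ultimately show thesis using that by blast
qed

lemma AE_velocity_tangent:
  assumes \<xi>: "\<xi> \<in> ac_arcs \<A> t x"
  shows "AE s in lebesgue. 0 < s \<and> s < t \<longrightarrow> velocity \<A> \<xi> s \<in> tangent_space \<A> (\<xi> s)"
proof -
  have "AE s in lebesgue. \<forall>pq\<in>rational_chart_intervals t \<xi>. fst pq < s \<and> s < snd pq \<longrightarrow> velocity \<A> \<xi> s \<in> tangent_space \<A> (\<xi> s)"
    unfolding AE_ball_countable[OF countable_rational_chart_intervals]
  proof
    fix pq assume "pq \<in> rational_chart_intervals t \<xi>"
    then obtain c where c: "c \<in> \<A>" "\<xi> ` {fst pq..snd pq} \<subseteq> fst c" "abs_continuous_on (fst pq) (snd pq) (snd c \<circ> \<xi>)"
      "0 \<le> fst pq" "fst pq < snd pq" "snd pq \<le> t"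
      using rational_chart_intervalsD[OF \<xi>, of "fst pq" "snd pq"] by auto
    show "AE s in lebesgue. fst pq < s \<and> s < snd pq \<longrightarrow> velocity \<A> \<xi> s \<in> tangent_space \<A> (\<xi> s)"
      using abs_continuous_on_differentiable[OF c(3)]
    proof eventually_elim
      case (elim s)
      show ?case
      proof
        assume s: "fst pq < s \<and> s < snd pq"
        then have "\<xi> s \<in> fst c" using c(2) by (auto simp: image_subset_iff)
        moreover have "isCont \<xi> s" using isCont_arc[OF \<xi>, of s] s c by auto
        ultimately show "velocity \<A> \<xi> s \<in> tangent_space \<A> (\<xi> s)"
          using velocity_tangent[OF c(1)] elim s by blast
      qed
    qed
  qed
  then show ?thesis
  proof eventually_elim
    case (elim s)
    then show ?case using rational_chart_intervals_cover[OF \<xi>, of s] by fastforce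
  qed
qed

end

section \<open>Contact Lagrangians that increase in u\<close>

text \<open>The setting of the entropy estimate: a contact Lagrangian whose derivative in \<open>u\<close>
  lies between \<open>lam > 0\<close> and \<open>\<kappa>\<close>.\<close>

locale increasing_contact_lagrangian = manifold_atlas \<A>
  for \<A> :: "('a::t2_space, 'e::euclidean_space) chart set" +
  fixes g :: "'a \<Rightarrow> ('a, 'e) tangent \<Rightarrow> ('a, 'e) tangent \<Rightarrow> real"
    and L :: "('a, 'e) lagrangian"
    and \<kappa> lam :: real
  assumes metric: "riemannian_metric \<A> g"
    and C2: "C2_lagrangian \<A> L"
    and superlinear: "L2_superlinear \<A> g L"
    and lam: "0 < lam" "lam \<le> \<kappa>"
    and L_u: "\<And>x v u. v \<in> tangent_space \<A> x \<Longrightarrow> lam \<le> deriv (L x v) u \<and> deriv (L x v) u \<le> \<kappa>"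
begin

lemma \<kappa>: "0 < \<kappa>" using lam by simp

lemma local_lagrangian_differentiable:
  assumes "c \<in> \<A>" "q \<in> snd c ` fst c"
  shows "(\<lambda>(q, w, u). local_lagrangian \<A> L c q w u) differentiable (at (q, w, u))"
proof -
  have "Ck_on (Suc (Suc 0)) ((snd c ` fst c) \<times> UNIV \<times> UNIV) (\<lambda>(q, w, u). local_lagrangian \<A> L c q w u)"
    using C2 assms(1) unfolding C2_lagrangian_def numeral_2_eq_2 by blast
  then have "\<forall>z\<in>(snd c ` fst c) \<times> UNIV \<times> UNIV. (\<lambda>(q, w, u). local_lagrangian \<A> L c q w u) differentiable (at z)"
    unfolding Ck_on.simps by (rule conjunct1)
  moreover have "(q, w, u) \<in> (snd c ` fst c) \<times> UNIV \<times> UNIV" using assms(2) by blast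
  ultimately show ?thesis by (rule bspec)
qed

lemma local_lagrangian_continuous:
  assumes "c \<in> \<A>"
  shows "continuous_on ((snd c ` fst c) \<times> UNIV \<times> UNIV) (\<lambda>(q, w, u). local_lagrangian \<A> L c q w u)"
proof (intro continuous_at_imp_continuous_on ballI)
  fix z assume "z \<in> (snd c ` fst c) \<times> (UNIV :: 'e set) \<times> (UNIV :: real set)"
  moreover obtain q w u where "z = (q, w, u)" by (cases z) auto
  ultimately show "isCont (\<lambda>(q, w, u). local_lagrangian \<A> L c q w u) z"
    using local_lagrangian_differentiable[OF assms, of q w u] by (auto intro: differentiable_imp_continuous_within)
qed

lemma lagrangian_eq_local:
  assumes "v \<in> tangent_space \<A> x" "c \<in> \<A>" "x \<in> fst c"
  shows "L x v u = local_lagrangian \<A> L c (snd c x) (v c) u"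
  using tangent_eq_tangent_of[OF assms] is_chartD(4)[OF chart[OF assms(2)] assms(3)]
  by (simp add: local_lagrangian_def)

text \<open>Bounds on \<open>deriv (L x v)\<close> are informative only where the derivative exists, which
  follows from the regularity of \<open>L\<close> in a chart around \<open>x\<close>.\<close>

lemma lagrangian_differentiable_u:
  assumes v: "v \<in> tangent_space \<A> x"
  shows "(L x v has_real_derivative deriv (L x v) u) (at u)"
proof -
  obtain c where c: "c \<in> \<A>" "x \<in> fst c" by (rule chart_at)
  let ?G = "\<lambda>(q, w, u). local_lagrangian \<A> L c q w u"
  have "?G differentiable (at (snd c x, v c, u))"
    using local_lagrangian_differentiable[OF c(1)] c(2) by blast
  then obtain G' where G': "(?G has_derivative G') (at (snd c x, v c, u))"
    unfolding differentiable_def by blast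
  have "((\<lambda>u. (snd c x, v c, u)) has_derivative (\<lambda>h. (0, 0, h))) (at u)"
    by (auto intro!: derivative_eq_intros)
  from diff_chain_at[OF this G']
  have "((?G \<circ> (\<lambda>u. (snd c x, v c, u))) has_derivative (G' \<circ> (\<lambda>h. (0, 0, h)))) (at u)" .
  moreover have "?G \<circ> (\<lambda>u. (snd c x, v c, u)) = L x v"
    using lagrangian_eq_local[OF v c] by auto
  ultimately have "L x v differentiable (at u)" unfolding differentiable_def by auto
  then show ?thesis using DERIV_deriv_iff_real_differentiable by blast
qed

lemma lagrangian_slope_bounds:
  assumes v: "v \<in> tangent_space \<A> x" and u: "u \<le> u'"
  shows "lam * (u' - u) \<le> L x v u' - L x v u" "L x v u' - L x v u \<le> \<kappa> * (u' - u)"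
proof -
  have "lam * (u' - u) \<le> L x v u' - L x v u \<and> L x v u' - L x v u \<le> \<kappa> * (u' - u)"
  proof (cases "u = u'")
    case False
    then have "u < u'" using u by simp
    then obtain z where "L x v u' - L x v u = (u' - u) * deriv (L x v) z"
      using MVT2[of u u' "L x v" "deriv (L x v)"] lagrangian_differentiable_u[OF v] by blast
    then have "L x v u' - L x v u = deriv (L x v) z * (u' - u)" by (simp only: mult.commute)
    moreover have "lam * (u' - u) \<le> deriv (L x v) z * (u' - u)" "deriv (L x v) z * (u' - u) \<le> \<kappa> * (u' - u)"
      using L_u[OF v, of z] u by (auto intro!: mult_right_mono)
    ultimately show ?thesis by simp
  qed simp
  then show "lam * (u' - u) \<le> L x v u' - L x v u" "L x v u' - L x v u \<le> \<kappa> * (u' - u)" by auto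
qed

lemma lagrangian_lipschitz:
  assumes v: "v \<in> tangent_space \<A> x"
  shows "\<bar>L x v u' - L x v u\<bar> \<le> \<kappa> * \<bar>u' - u\<bar>"
proof (cases "u \<le> u'")
  case True
  have "0 \<le> lam * (u' - u)" using lam True by simp
  then show ?thesis using lagrangian_slope_bounds[OF v True] True by linarith
next
  case False
  then have le: "u' \<le> u" by simp
  have "0 \<le> lam * (u - u')" using lam le by simp
  moreover have "\<kappa> * \<bar>u' - u\<bar> = \<kappa> * (u - u')" using le by simp
  ultimately show ?thesis using lagrangian_slope_bounds[OF v le] by linarith
qed

lemma lagrangian_bounded_below:
  obtains c\<^sub>0 where "0 \<le> c\<^sub>0" "\<And>x v. v \<in> tangent_space \<A> x \<Longrightarrow> - c\<^sub>0 \<le> L x v 0"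
proof -
  obtain \<theta>\<^sub>0 :: "real \<Rightarrow> real" and c\<^sub>0 where \<theta>: "\<And>r. 0 \<le> r \<Longrightarrow> 0 \<le> \<theta>\<^sub>0 r" "0 \<le> c\<^sub>0"
    "\<And>x v. v \<in> tangent_space \<A> x \<Longrightarrow> \<theta>\<^sub>0 (riemannian_norm g x v) - c\<^sub>0 \<le> L x v 0"
    using superlinear unfolding L2_superlinear_def by blast
  have "- c\<^sub>0 \<le> L x v 0" if v: "v \<in> tangent_space \<A> x" for x v
  proof -
    obtain c where c: "c \<in> \<A>" "x \<in> fst c" by (rule chart_at)
    have bil: "bilinear (\<lambda>w w'. g x (tangent_of \<A> c x w) (tangent_of \<A> c x w'))"
      "\<And>w. w \<noteq> 0 \<Longrightarrow> 0 < g x (tangent_of \<A> c x w) (tangent_of \<A> c x w)"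
      using metric c unfolding riemannian_metric_def by blast+
    then have "0 \<le> g x (tangent_of \<A> c x (v c)) (tangent_of \<A> c x (v c))"
      using bilinear_lzero[OF bil(1), of 0] bil(2)[of "v c"] by (cases "v c = 0") (auto simp: less_imp_le)
    then have "0 \<le> g x v v" using tangent_eq_tangent_of[OF v c] by simp
    then have "0 \<le> riemannian_norm g x v" by (simp add: riemannian_norm_def)
    then show ?thesis using \<theta>(1)[of "riemannian_norm g x v"] \<theta>(3)[OF v] by linarith
  qed
  then show thesis using that \<theta>(2) by blast
qed

lemma lagrangian_at_rest_bounded:
  obtains C where "0 \<le> C" "\<And>x. L x (\<lambda>_. 0) 0 \<le> C"
proof -
  have "continuous_on (\<Union>c\<in>\<A>. fst c) (\<lambda>x. L x (\<lambda>_. 0) 0)"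
  proof (rule continuous_on_open_UN)
    fix c assume c: "c \<in> \<A>"
    show "open (fst c)" by (rule is_chartD(1)[OF chart[OF c]])
    have "continuous_on (fst c) (\<lambda>x. (\<lambda>(q, w, u). local_lagrangian \<A> L c q w u) (snd c x, 0, 0))"
      by (rule continuous_on_compose2[OF local_lagrangian_continuous[OF c]])
         (auto intro!: continuous_intros is_chartD(3)[OF chart[OF c]])
    then show "continuous_on (fst c) (\<lambda>x. L x (\<lambda>_. 0) 0)"
      by (rule continuous_on_eq) (use lagrangian_eq_local[OF zero_tangent c] in simp)
  qed
  moreover have "(\<Union>c\<in>\<A>. fst c) = UNIV" "compact (UNIV :: 'a set)"
    using manifold unfolding compact_connected_manifold_def smooth_atlas_def by blast+
  ultimately have "bounded (range (\<lambda>x. L x (\<lambda>_. 0) 0))"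
    using compact_imp_bounded[OF compact_continuous_image] by metis
  then obtain C where "\<And>x. \<bar>L x (\<lambda>_. 0) 0\<bar> \<le> C" unfolding bounded_iff by auto
  then have "L x (\<lambda>_. 0) 0 \<le> max C 0" for x by (simp add: le_max_iff_disj abs_le_iff)
  then show thesis using that[of "max C 0"] by simp
qed

text \<open>In a chart the Lagrangian is continuous in position, velocity and \<open>u\<close>; position and
  \<open>u\<close> are continuous in time, and the velocity agrees almost everywhere with a Borel function.\<close>

lemma lagrangian_along_arc_measurable:
  assumes t: "0 < t" and \<xi>: "\<xi> \<in> ac_arcs \<A> t x" and u: "continuous_on {0..t} u"
  shows "(\<lambda>s. indicator {0..t} s * L (\<xi> s) (velocity \<A> \<xi> s) (u s)) \<in> borel_measurable lebesgue"
proof (rule borel_measurable_lebesgue_locally[OF t countable_rational_chart_intervals[of t \<xi>]])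
  show "\<exists>p q. (p, q) \<in> rational_chart_intervals t \<xi> \<and> p < s \<and> s < q" if "0 < s" "s < t" for s
    by (rule rational_chart_intervals_cover[OF \<xi> that])
  fix p q assume pq: "(p, q) \<in> rational_chart_intervals t \<xi>"
  obtain c where c: "c \<in> \<A>" "\<xi> ` {p..q} \<subseteq> fst c" "abs_continuous_on p q (snd c \<circ> \<xi>)" "0 \<le> p" "p < q" "q \<le> t"
    by (rule rational_chart_intervalsD[OF \<xi> pq])
  show "0 \<le> p \<and> q \<le> t" using c by simp
  obtain D where D: "D \<in> borel_measurable borel"
    "AE s in lebesgue. p < s \<and> s < q \<longrightarrow> D s = vector_derivative (snd c \<circ> \<xi>) (at s)"
    by (rule AE_derivative_measurable[OF c(5,3)])
  let ?G = "\<lambda>(q, w, u). local_lagrangian \<A> L c q w u"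
  let ?z = "\<lambda>s. ((snd c \<circ> \<xi>) s, D s, u s)"
  let ?R = "restrict_space borel {p<..<q} :: real measure"
  have cy: "continuous_on {p<..<q} (snd c \<circ> \<xi>)"
    by (rule continuous_on_subset[OF abs_continuous_on_continuous[OF c(3)]]) auto
  have cu: "continuous_on {p<..<q} u" by (rule continuous_on_subset[OF u]) (use c in auto)
  have "?z \<in> borel_measurable ?R"
    using borel_measurable_continuous_on_restrict[OF cy] borel_measurable_continuous_on_restrict[OF cu]
      measurable_restrict_space1[OF D(1)] by (intro borel_measurable_Pair)
  then have z: "?z \<in> measurable ?R (restrict_space borel ((snd c ` fst c) \<times> UNIV \<times> UNIV))"
    by (rule measurable_restrict_space2[rotated]) (use c(2) in \<open>auto simp: space_restrict_space image_subset_iff\<close>)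
  have "?G \<in> borel_measurable (restrict_space borel ((snd c ` fst c) \<times> UNIV \<times> UNIV))"
    by (rule borel_measurable_continuous_on_restrict[OF local_lagrangian_continuous[OF c(1)]])
  then have "(\<lambda>s. ?G (?z s)) \<in> borel_measurable ?R" by (rule measurable_compose[OF z])
  then have "(\<lambda>s. indicator {p<..<q} s *\<^sub>R ?G (?z s)) \<in> borel_measurable borel"
    by (subst (asm) borel_measurable_restrict_space_iff) auto
  then have "(\<lambda>s. indicator {p<..<q} s *\<^sub>R ?G (?z s)) \<in> borel_measurable lebesgue"
    by (intro measurable_completion) simp
  then show "(\<lambda>s. indicator {p<..<q} s * L (\<xi> s) (velocity \<A> \<xi> s) (u s)) \<in> borel_measurable lebesgue"
  proof (rule borel_measurable_lebesgue_AE)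
    show "AE s in lebesgue. indicator {p<..<q} s *\<^sub>R ?G (?z s) = indicator {p<..<q} s * L (\<xi> s) (velocity \<A> \<xi> s) (u s)"
      using D(2) AE_velocity_tangent[OF \<xi>]
    proof eventually_elim
      case (elim s)
      show ?case
      proof (cases "p < s \<and> s < q")
        case True
        then have "\<xi> s \<in> fst c" using c(2) by (auto simp: image_subset_iff)
        moreover have "velocity \<A> \<xi> s \<in> tangent_space \<A> (\<xi> s)" using elim(2) True c by auto
        ultimately have "L (\<xi> s) (velocity \<A> \<xi> s) (u s) = local_lagrangian \<A> L c (snd c (\<xi> s)) (velocity \<A> \<xi> s c) (u s)"
          using lagrangian_eq_local[OF _ c(1)] by blast
        moreover have "velocity \<A> \<xi> s c = D s"
          using elim(1) True \<open>\<xi> s \<in> fst c\<close> c(1) by (simp add: velocity_def)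
        ultimately show ?thesis by simp
      qed auto
    qed
  qed
qed

lemma caratheodory_arc:
  assumes t: "0 < t" and \<xi>: "\<xi> \<in> ac_arcs \<A> t x"
    and int: "set_integrable lebesgue {0..t} (\<lambda>s. L (\<xi> s) (velocity \<A> \<xi> s) 0)"
  shows "caratheodory (\<lambda>s. L (\<xi> s) (velocity \<A> \<xi> s)) t \<kappa>"
proof
  show "0 \<le> t" "0 \<le> \<kappa>" using t \<kappa> by simp_all
  show "(\<lambda>s. indicator {0..t} s * L (\<xi> s) (velocity \<A> \<xi> s) (u s)) \<in> borel_measurable lebesgue"
    if "continuous_on {0..t} u" for u by (rule lagrangian_along_arc_measurable[OF t \<xi> that])
  show "set_integrable lebesgue {0..t} (\<lambda>s. L (\<xi> s) (velocity \<A> \<xi> s) 0)" by (rule int)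
  show "AE s in lebesgue. 0 < s \<and> s < t \<longrightarrow>
      (\<forall>u u'. \<bar>L (\<xi> s) (velocity \<A> \<xi> s) u - L (\<xi> s) (velocity \<A> \<xi> s) u'\<bar> \<le> \<kappa> * \<bar>u - u'\<bar>)"
    using AE_velocity_tangent[OF \<xi>] by eventually_elim (use lagrangian_lipschitz in blast)
qed

text \<open>A solution exists, so the choice in the definition of \<open>u_arc\<close> does pick one.\<close>

lemma u_arc_solution:
  assumes t: "0 < t" and \<xi>: "\<xi> \<in> ac_arcs \<A> t x"
    and int: "set_integrable lebesgue {0..t} (\<lambda>s. L (\<xi> s) (velocity \<A> \<xi> s) 0)"
  shows "abs_continuous_on 0 t (u_arc \<A> L t \<phi> \<xi>)" "u_arc \<A> L t \<phi> \<xi> 0 = \<phi> (\<xi> 0)"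
    "AE s in lebesgue. 0 < s \<and> s < t \<longrightarrow>
       (u_arc \<A> L t \<phi> \<xi> has_real_derivative L (\<xi> s) (velocity \<A> \<xi> s) (u_arc \<A> L t \<phi> \<xi> s)) (at s)"
proof -
  have "\<exists>u. caratheodory_solution \<A> L t \<xi> (\<phi> (\<xi> 0)) u"
  proof (rule caratheodory.caratheodory_existence[OF caratheodory_arc[OF assms], of "\<phi> (\<xi> 0)"])
    fix u assume "abs_continuous_on 0 t u" "u 0 = \<phi> (\<xi> 0)"
      "AE s in lebesgue. s \<in> {0..t} \<longrightarrow> (u has_real_derivative L (\<xi> s) (velocity \<A> \<xi> s) (u s)) (at s within {0..t})"
    then show ?thesis unfolding caratheodory_solution_def by (intro exI[of _ u] conjI)
  qed
  then have sol: "caratheodory_solution \<A> L t \<xi> (\<phi> (\<xi> 0)) (u_arc \<A> L t \<phi> \<xi>)"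
    unfolding u_arc_def by (rule someI_ex)
  then show "abs_continuous_on 0 t (u_arc \<A> L t \<phi> \<xi>)" "u_arc \<A> L t \<phi> \<xi> 0 = \<phi> (\<xi> 0)"
    unfolding caratheodory_solution_def by blast+
  have "AE s in lebesgue. s \<in> {0..t} \<longrightarrow>
      (u_arc \<A> L t \<phi> \<xi> has_real_derivative L (\<xi> s) (velocity \<A> \<xi> s) (u_arc \<A> L t \<phi> \<xi> s)) (at s within {0..t})"
    using sol unfolding caratheodory_solution_def by blast
  then show "AE s in lebesgue. 0 < s \<and> s < t \<longrightarrow>
       (u_arc \<A> L t \<phi> \<xi> has_real_derivative L (\<xi> s) (velocity \<A> \<xi> s) (u_arc \<A> L t \<phi> \<xi> s)) (at s)"
  proof eventually_elim
    case (elim s)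
    then show ?case by (auto simp: at_within_Icc_at)
  qed
qed

text \<open>The action adds the initial value and the integral of \<open>u'\<close>, which is the final value
  of \<open>u\<close>.\<close>

lemma action_eq_u_arc:
  assumes t: "0 < t" and \<xi>: "\<xi> \<in> ac_arcs \<A> t x"
    and int: "set_integrable lebesgue {0..t} (\<lambda>s. L (\<xi> s) (velocity \<A> \<xi> s) 0)"
  shows "action \<A> L t \<phi> \<xi> = ereal (u_arc \<A> L t \<phi> \<xi> t)"
proof -
  let ?u = "u_arc \<A> L t \<phi> \<xi>"
  note sol = u_arc_solution[OF assms, of \<phi>]
  have i: "set_integrable lebesgue {0..t} (\<lambda>s. L (\<xi> s) (velocity \<A> \<xi> s) (?u s))"
    by (rule caratheodory.integrable_along[OF caratheodory_arc[OF assms] abs_continuous_on_continuous[OF sol(1)]])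
  have "(LINT s:{0..t}|lebesgue. L (\<xi> s) (velocity \<A> \<xi> s) (?u s)) = ?u t - ?u 0"
    by (rule abs_continuous_on_integral_derivative[OF _ sol(1) i sol(3)]) (use t in simp)
  then show ?thesis using int sol(2) by (simp add: action_def)
qed

text \<open>The barrier is the solution of \<open>b' = \<kappa> * b - c\<^sub>0\<close> with \<open>b 0 = -
  B\<close>. It is a subsolution along every arc, because \<open>b \<le> 0\<close>, \<open>L\<close> at \<open>u
  = 0\<close> is at least \<open>- c\<^sub>0\<close>, and \<open>L\<close> decreases by at most \<open>\<kappa>
  * \<bar>b\<bar>\<close> between \<open>0\<close> and \<open>b\<close>.\<close>

lemma u_arc_lower_bound:
  assumes t: "0 < t" and \<xi>: "\<xi> \<in> ac_arcs \<A> t x"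
    and int: "set_integrable lebesgue {0..t} (\<lambda>s. L (\<xi> s) (velocity \<A> \<xi> s) 0)"
    and c\<^sub>0: "0 \<le> c\<^sub>0" "\<And>x v. v \<in> tangent_space \<A> x \<Longrightarrow> - c\<^sub>0 \<le> L x v 0"
    and B: "0 \<le> B" "\<And>x. - B \<le> \<phi> x"
  shows "c\<^sub>0 / \<kappa> - (B + c\<^sub>0 / \<kappa>) * exp (\<kappa> * t) \<le> u_arc \<A> L t \<phi> \<xi> t"
proof -
  note sol = u_arc_solution[OF t \<xi> int, of \<phi>]
  let ?b = "\<lambda>s. c\<^sub>0 / \<kappa> - (B + c\<^sub>0 / \<kappa>) * exp (\<kappa> * s)"
  let ?F = "\<lambda>s. L (\<xi> s) (velocity \<A> \<xi> s)"
  have db: "(?b has_real_derivative \<kappa> * ?b s - c\<^sub>0) (at s within S)" for s S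
    using \<kappa> by (auto intro!: derivative_eq_intros simp: field_simps)
  have c0\<kappa>: "0 \<le> c\<^sub>0 / \<kappa>" using c\<^sub>0 \<kappa> by simp
  show "?b t \<le> u_arc \<A> L t \<phi> \<xi> t"
  proof (rule caratheodory_comparison[where F = ?F and k = \<kappa> and v = ?b and T = t and u = "u_arc \<A> L t \<phi> \<xi>"])
    show "0 \<le> t" "0 \<le> \<kappa>" using t \<kappa> by simp_all
    show "abs_continuous_on 0 t ?b" by (rule DERIV_imp_abs_continuous_on[OF db]) (auto intro!: continuous_intros)
    show "abs_continuous_on 0 t (u_arc \<A> L t \<phi> \<xi>)" by (rule sol)
    show "?b 0 \<le> u_arc \<A> L t \<phi> \<xi> 0" using sol(2) B(2)[of "\<xi> 0"] by simp
    show "AE s in lebesgue. 0 < s \<and> s < t \<longrightarrow> (\<forall>u u'. u \<le> u' \<longrightarrow> ?F s u' - ?F s u \<le> \<kappa> * (u' - u))"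
      using AE_velocity_tangent[OF \<xi>] by eventually_elim (use lagrangian_slope_bounds(2) in blast)
    show "AE s in lebesgue. 0 < s \<and> s < t \<longrightarrow>
        (\<exists>l\<ge>?F s (u_arc \<A> L t \<phi> \<xi> s). (u_arc \<A> L t \<phi> \<xi> has_real_derivative l) (at s))"
      using sol(3) by eventually_elim blast
    show "AE s in lebesgue. 0 < s \<and> s < t \<longrightarrow> (\<exists>l\<le>?F s (?b s). (?b has_real_derivative l) (at s))"
      using AE_velocity_tangent[OF \<xi>]
    proof eventually_elim
      case (elim s)
      show ?case
      proof
        assume s: "0 < s \<and> s < t"
        then have v: "velocity \<A> \<xi> s \<in> tangent_space \<A> (\<xi> s)" using elim by blast
        have "(B + c\<^sub>0 / \<kappa>) * 1 \<le> (B + c\<^sub>0 / \<kappa>) * exp (\<kappa> * s)"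
          using B(1) c0\<kappa> s \<kappa> by (intro mult_left_mono) auto
        then have "?b s \<le> 0" using B(1) by simp
        then have "?F s 0 - ?F s (?b s) \<le> \<kappa> * (0 - ?b s)" by (rule lagrangian_slope_bounds(2)[OF v])
        moreover have "\<kappa> * (0 - ?b s) = - (\<kappa> * ?b s)" by (simp only: diff_0 mult_minus_right)
        ultimately have "\<kappa> * ?b s - c\<^sub>0 \<le> ?F s (?b s)" using c\<^sub>0(2)[OF v] by linarith
        then show "\<exists>l\<le>?F s (?b s). (?b has_real_derivative l) (at s)" using db by blast
      qed
    qed
  qed
qed

text \<open>The growth of \<open>L\<close> in \<open>u\<close> at rate at least \<open>lam\<close> makes
  \<open>u s + \<delta> * exp (lam * s)\<close> a subsolution, since its derivative exceeds that of
  \<open>u\<close> by \<open>lam\<close> times its excess over \<open>u\<close>.\<close>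

lemma u_arc_expansion:
  assumes t: "0 < t" and \<xi>: "\<xi> \<in> ac_arcs \<A> t x"
    and int: "set_integrable lebesgue {0..t} (\<lambda>s. L (\<xi> s) (velocity \<A> \<xi> s) 0)"
    and \<delta>: "0 \<le> \<delta>"
  shows "u_arc \<A> L t \<phi> \<xi> t + \<delta> * exp (lam * t) \<le> u_arc \<A> L t (\<lambda>x. \<phi> x + \<delta>) \<xi> t"
proof -
  note sol = u_arc_solution[OF t \<xi> int]
  let ?F = "\<lambda>s. L (\<xi> s) (velocity \<A> \<xi> s)"
  let ?e = "\<lambda>s. \<delta> * exp (lam * s)"
  let ?v = "\<lambda>s. u_arc \<A> L t \<phi> \<xi> s + ?e s"
  let ?u = "u_arc \<A> L t (\<lambda>x. \<phi> x + \<delta>) \<xi>"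
  have de: "(?e has_real_derivative lam * ?e s) (at s within S)" for s S
    by (auto intro!: derivative_eq_intros)
  show "?v t \<le> ?u t"
  proof (rule caratheodory_comparison[where F = ?F and k = \<kappa> and v = ?v and T = t and u = ?u])
    show "0 \<le> t" "0 \<le> \<kappa>" using t \<kappa> by simp_all
    have "abs_continuous_on 0 t ?e" by (rule DERIV_imp_abs_continuous_on[OF de]) (auto intro!: continuous_intros)
    then show "abs_continuous_on 0 t ?v" by (rule abs_continuous_on_add[OF sol(1)])
    show "abs_continuous_on 0 t ?u" by (rule sol)
    show "?v 0 \<le> ?u 0" by (simp add: sol(2))
    show "AE s in lebesgue. 0 < s \<and> s < t \<longrightarrow> (\<forall>u u'. u \<le> u' \<longrightarrow> ?F s u' - ?F s u \<le> \<kappa> * (u' - u))"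
      using AE_velocity_tangent[OF \<xi>] by eventually_elim (use lagrangian_slope_bounds(2) in blast)
    show "AE s in lebesgue. 0 < s \<and> s < t \<longrightarrow> (\<exists>l\<ge>?F s (?u s). (?u has_real_derivative l) (at s))"
      using sol(3) by eventually_elim blast
    show "AE s in lebesgue. 0 < s \<and> s < t \<longrightarrow> (\<exists>l\<le>?F s (?v s). (?v has_real_derivative l) (at s))"
      using AE_velocity_tangent[OF \<xi>] sol(3)[of \<phi>]
    proof eventually_elim
      case (elim s)
      show ?case
      proof
        assume s: "0 < s \<and> s < t"
        then have v: "velocity \<A> \<xi> s \<in> tangent_space \<A> (\<xi> s)" using elim by blast
        have "(?v has_real_derivative ?F s (u_arc \<A> L t \<phi> \<xi> s) + lam * ?e s) (at s)"
          using elim(2) s by (intro DERIV_add de) auto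
        moreover have "u_arc \<A> L t \<phi> \<xi> s \<le> ?v s" using \<delta> by simp
        from lagrangian_slope_bounds(1)[OF v this]
        have "?F s (u_arc \<A> L t \<phi> \<xi> s) + lam * ?e s \<le> ?F s (?v s)" by (simp only: add_diff_cancel_left')
        ultimately show "\<exists>l\<le>?F s (?v s). (?v has_real_derivative l) (at s)" by blast
      qed
    qed
  qed
qed

section \<open>Expansion of the Lax-Oleinik semigroup\<close>

lemma rest_arc: "(\<lambda>_. x) \<in> ac_arcs \<A> t x"
  unfolding ac_arcs_def by (auto intro!: abs_continuous_on_lipschitz[of 0])

lemma velocity_rest: "velocity \<A> (\<lambda>_. x) s = (\<lambda>_. 0)"
  by (auto simp: velocity_def comp_def)

lemma rest_arc_integrable: "set_integrable lebesgue {0..t} (\<lambda>s. L x (velocity \<A> (\<lambda>_. x) s) 0)"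
  unfolding velocity_rest by (rule absolutely_integrable_continuous_real) (intro continuous_intros)

text \<open>The counterpart of the lower barrier along the arc at rest: here \<open>b' = \<kappa> * b +
  C\<close> and \<open>b 0 = B\<close>.\<close>

lemma u_arc_rest_upper_bound:
  assumes t: "0 < t" and C: "0 \<le> C" "\<And>x. L x (\<lambda>_. 0) 0 \<le> C"
    and B: "0 \<le> B" "\<And>x. \<phi> x \<le> B"
  shows "u_arc \<A> L t \<phi> (\<lambda>_. x) t \<le> (B + C / \<kappa>) * exp (\<kappa> * t) - C / \<kappa>"
proof -
  note sol = u_arc_solution[OF t rest_arc rest_arc_integrable, of \<phi> x]
  let ?b = "\<lambda>s. (B + C / \<kappa>) * exp (\<kappa> * s) - C / \<kappa>"
  let ?F = "\<lambda>s::real. L x (velocity \<A> (\<lambda>_. x) s)"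
  have db: "(?b has_real_derivative \<kappa> * ?b s + C) (at s within S)" for s S
    using \<kappa> by (auto intro!: derivative_eq_intros simp: field_simps)
  have C\<kappa>: "0 \<le> C / \<kappa>" using C \<kappa> by simp
  show "u_arc \<A> L t \<phi> (\<lambda>_. x) t \<le> ?b t"
  proof (rule caratheodory_comparison[where F = ?F and k = \<kappa> and u = ?b and T = t and v = "u_arc \<A> L t \<phi> (\<lambda>_. x)"])
    show "0 \<le> t" "0 \<le> \<kappa>" using t \<kappa> by simp_all
    show "abs_continuous_on 0 t ?b" by (rule DERIV_imp_abs_continuous_on[OF db]) (auto intro!: continuous_intros)
    show "abs_continuous_on 0 t (u_arc \<A> L t \<phi> (\<lambda>_. x))" by (rule sol)
    show "u_arc \<A> L t \<phi> (\<lambda>_. x) 0 \<le> ?b 0" using sol(2) B(2)[of x] by simp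
    show "AE s in lebesgue. 0 < s \<and> s < t \<longrightarrow> (\<forall>u u'. u \<le> u' \<longrightarrow> ?F s u' - ?F s u \<le> \<kappa> * (u' - u))"
      unfolding velocity_rest by (intro AE_I2 impI allI lagrangian_slope_bounds(2) zero_tangent)
    show "AE s in lebesgue. 0 < s \<and> s < t \<longrightarrow>
        (\<exists>l\<le>?F s (u_arc \<A> L t \<phi> (\<lambda>_. x) s). (u_arc \<A> L t \<phi> (\<lambda>_. x) has_real_derivative l) (at s))"
      using sol(3) by eventually_elim blast
    show "AE s in lebesgue. 0 < s \<and> s < t \<longrightarrow> (\<exists>l\<ge>?F s (?b s). (?b has_real_derivative l) (at s))"
    proof (intro AE_I2 impI)
      fix s assume s: "0 < s \<and> s < t"
      have "(B + C / \<kappa>) * 1 \<le> (B + C / \<kappa>) * exp (\<kappa> * s)"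
        using B(1) C\<kappa> s \<kappa> by (intro mult_left_mono) auto
      then have "0 \<le> ?b s" using B(1) by simp
      then have "L x (\<lambda>_. 0) (?b s) - L x (\<lambda>_. 0) 0 \<le> \<kappa> * (?b s - 0)"
        by (rule lagrangian_slope_bounds(2)[OF zero_tangent])
      then have "?F s (?b s) \<le> \<kappa> * ?b s + C" using C(2)[of x] unfolding velocity_rest diff_0_right by linarith
      then show "\<exists>l\<ge>?F s (?b s). (?b has_real_derivative l) (at s)" using db by blast
    qed
  qed
qed

text \<open>Bounds that are uniform in \<open>x\<close>. They make the infimum a real number, so that the
  conversion from the extended reals in the definition of the semigroup is harmless, and they show that the
  semigroup preserves boundedness.\<close>

lemma action_INF_bounds:
  assumes t: "0 < t" and \<phi>: "bounded (range \<phi>)"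
  obtains b where "\<And>x. ereal (- b) \<le> (INF \<xi>\<in>ac_arcs \<A> t x. action \<A> L t \<phi> \<xi>)"
    "\<And>x. (INF \<xi>\<in>ac_arcs \<A> t x. action \<A> L t \<phi> \<xi>) \<le> ereal b"
proof -
  obtain B where "\<And>x. \<bar>\<phi> x\<bar> \<le> B" using \<phi> unfolding bounded_iff by auto
  then have B: "0 \<le> B" "- B \<le> \<phi> x" "\<phi> x \<le> B" for x
    by (meson abs_ge_zero order_trans, metis abs_le_iff minus_le_iff, metis abs_le_iff)
  obtain c\<^sub>0 where c\<^sub>0: "0 \<le> c\<^sub>0" "\<And>x v. v \<in> tangent_space \<A> x \<Longrightarrow> - c\<^sub>0 \<le> L x v 0"
    using lagrangian_bounded_below by blast
  obtain C where C: "0 \<le> C" "\<And>x. L x (\<lambda>_. 0) 0 \<le> C" using lagrangian_at_rest_bounded by blast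
  \<comment> \<open>the barriers at time \<open>t\<close>\<close>
  define lo where "lo = c\<^sub>0 / \<kappa> - (B + c\<^sub>0 / \<kappa>) * exp (\<kappa> * t)"
  define hi where "hi = (B + C / \<kappa>) * exp (\<kappa> * t) - C / \<kappa>"
  have low: "ereal lo \<le> (INF \<xi>\<in>ac_arcs \<A> t x. action \<A> L t \<phi> \<xi>)" for x
  proof (rule INF_greatest)
    fix \<xi> assume \<xi>: "\<xi> \<in> ac_arcs \<A> t x"
    show "ereal lo \<le> action \<A> L t \<phi> \<xi>"
    proof (cases "set_integrable lebesgue {0..t} (\<lambda>s. L (\<xi> s) (velocity \<A> \<xi> s) 0)")
      case True
      then show ?thesis using u_arc_lower_bound[where \<phi> = \<phi>, OF t \<xi> True c\<^sub>0 B(1,2)]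
        by (simp add: action_eq_u_arc[OF t \<xi>] lo_def)
    qed (simp add: action_def)
  qed
  have high: "(INF \<xi>\<in>ac_arcs \<A> t x. action \<A> L t \<phi> \<xi>) \<le> ereal hi" for x
  proof (rule INF_lower2[OF rest_arc])
    show "action \<A> L t \<phi> (\<lambda>_. x) \<le> ereal hi"
      unfolding action_eq_u_arc[OF t rest_arc rest_arc_integrable] hi_def
      using u_arc_rest_upper_bound[OF t C B(1,3)] by simp
  qed
  show thesis
  proof (rule that[of "max \<bar>lo\<bar> \<bar>hi\<bar>"])
    show "ereal (- max \<bar>lo\<bar> \<bar>hi\<bar>) \<le> (INF \<xi>\<in>ac_arcs \<A> t x. action \<A> L t \<phi> \<xi>)" for x
      by (rule order_trans[OF _ low[of x]]) simp
    show "(INF \<xi>\<in>ac_arcs \<A> t x. action \<A> L t \<phi> \<xi>) \<le> ereal (max \<bar>lo\<bar> \<bar>hi\<bar>)" for x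
      by (rule order_trans[OF high[of x]]) (use abs_ge_self[of hi] in \<open>simp add: le_max_iff_disj\<close>)
  qed
qed

lemma lax_oleinik_eq_INF:
  assumes t: "0 < t" and \<phi>: "bounded (range \<phi>)"
  shows "ereal (lax_oleinik \<A> L t \<phi> x) = (INF \<xi>\<in>ac_arcs \<A> t x. action \<A> L t \<phi> \<xi>)"
proof -
  let ?I = "INF \<xi>\<in>ac_arcs \<A> t x. action \<A> L t \<phi> \<xi>"
  obtain b where "ereal (- b) \<le> ?I" "?I \<le> ereal b"
    using action_INF_bounds[OF assms] by metis
  then have "\<bar>?I\<bar> \<noteq> \<infinity>" by (cases ?I) auto
  then show ?thesis using t by (simp add: lax_oleinik_def ereal_real)
qed

lemma lax_oleinik_bounded:
  assumes t: "0 \<le> t" and \<phi>: "bounded (range \<phi>)"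
  shows "bounded (range (lax_oleinik \<A> L t \<phi>))"
proof (cases "t = 0")
  case True
  then show ?thesis using \<phi> by (simp add: lax_oleinik_def)
next
  case False
  then have t: "0 < t" using t by simp
  obtain b where b: "\<And>x. ereal (- b) \<le> (INF \<xi>\<in>ac_arcs \<A> t x. action \<A> L t \<phi> \<xi>)"
    "\<And>x. (INF \<xi>\<in>ac_arcs \<A> t x. action \<A> L t \<phi> \<xi>) \<le> ereal b"
    using action_INF_bounds[OF t \<phi>] by blast
  have "\<bar>lax_oleinik \<A> L t \<phi> x\<bar> \<le> b" for x
    using b[of x] unfolding lax_oleinik_eq_INF[OF t \<phi>, symmetric] by (simp add: abs_le_iff)
  then show ?thesis unfolding bounded_iff by (intro exI[of _ b]) simp
qed

text \<open>The estimate for single arcs passes to the infimum. Arcs along which \<open>L\<close> is not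
  integrable have infinite action for both initial functions.\<close>

lemma lax_oleinik_expansion:
  assumes t: "0 \<le> t" and \<phi>: "bounded (range \<phi>)" and \<delta>: "0 \<le> \<delta>"
  shows "lax_oleinik \<A> L t \<phi> x + \<delta> * exp (lam * t) \<le> lax_oleinik \<A> L t (\<lambda>x. \<phi> x + \<delta>) x"
proof (cases "t = 0")
  case True
  then show ?thesis by (simp add: lax_oleinik_def)
next
  case False
  then have t: "0 < t" using t by simp
  have \<phi>': "bounded (range (\<lambda>x. \<phi> x + \<delta>))"
    using bounded_translation[OF \<phi>, of \<delta>] by (simp add: image_image add.commute)
  have "ereal (lax_oleinik \<A> L t \<phi> x) + ereal (\<delta> * exp (lam * t)) \<le> ereal (lax_oleinik \<A> L t (\<lambda>x. \<phi> x + \<delta>) x)"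
    unfolding lax_oleinik_eq_INF[OF t \<phi>'] 
  proof (rule INF_greatest)
    fix \<xi> assume \<xi>: "\<xi> \<in> ac_arcs \<A> t x"
    show "ereal (lax_oleinik \<A> L t \<phi> x) + ereal (\<delta> * exp (lam * t)) \<le> action \<A> L t (\<lambda>x. \<phi> x + \<delta>) \<xi>"
    proof (cases "set_integrable lebesgue {0..t} (\<lambda>s. L (\<xi> s) (velocity \<A> \<xi> s) 0)")
      case True
      have "ereal (lax_oleinik \<A> L t \<phi> x) \<le> action \<A> L t \<phi> \<xi>"
        unfolding lax_oleinik_eq_INF[OF t \<phi>] by (rule INF_lower[OF \<xi>])
      then have "lax_oleinik \<A> L t \<phi> x \<le> u_arc \<A> L t \<phi> \<xi> t" by (simp add: action_eq_u_arc[OF t \<xi> True])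
      then show ?thesis using u_arc_expansion[OF t \<xi> True \<delta>, of \<phi>] by (simp add: action_eq_u_arc[OF t \<xi> True])
    qed (simp add: action_def)
  qed
  then show ?thesis by simp
qed

lemma mdist_lax_oleinik_translates:
  assumes t: "0 \<le> t" and \<phi>: "bounded (range \<phi>)"
  shows "exp (lam * t) * \<bar>\<delta> - \<delta>'\<bar> \<le> mdist CM (lax_oleinik \<A> L t (\<lambda>x. \<phi> x + \<delta>)) (lax_oleinik \<A> L t (\<lambda>x. \<phi> x + \<delta>'))"
proof -
  have tr: "bounded (range (\<lambda>x. \<phi> x + d))" for d
    using bounded_translation[OF \<phi>, of d] by (simp add: image_image add.commute)
  let ?T = "\<lambda>d. lax_oleinik \<A> L t (\<lambda>x. \<phi> x + d)"
  have le: "exp (lam * t) * (d' - d) \<le> ?T d' x - ?T d x" if "d \<le> d'" for d d' x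
    using lax_oleinik_expansion[OF t tr[of d], of "d' - d" x] that by (simp add: mult.commute)
  have "exp (lam * t) * \<bar>\<delta> - \<delta>'\<bar> \<le> \<bar>?T \<delta> x - ?T \<delta>' x\<bar>" for x
    using le[of \<delta> \<delta>' x] le[of \<delta>' \<delta> x] by (cases "\<delta> \<le> \<delta>'") (auto simp: abs_if)
  also have "\<bar>?T \<delta> x - ?T \<delta>' x\<bar> \<le> mdist CM (?T \<delta>) (?T \<delta>')" for x
    by (intro mdist_CM_ge lax_oleinik_bounded t tr)
  finally show ?thesis .
qed

lemma entropy_on_translates:
  assumes \<phi>: "\<phi> \<in> mspace CM" and a: "0 < a"
  shows "ereal lam \<le> entropy_on CM (lax_oleinik \<A> L) {(\<lambda>x. \<phi> x + \<delta>) | \<delta>. \<delta> \<in> {0..a}}"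
proof (rule entropy_on_expanding_arc[OF a lam(1)])
  have b: "bounded (range \<phi>)" using \<phi> mspace_CM_iff by blast
  have tr: "bounded (range (\<lambda>x. \<phi> x + d))" for d
    using bounded_translation[OF b, of d] by (simp add: image_image add.commute)
  fix t \<delta> \<delta>' :: real assume t: "0 \<le> t"
  show "exp (lam * t) * \<bar>\<delta> - \<delta>'\<bar> \<le> mdist CM (lax_oleinik \<A> L t (\<lambda>x. \<phi> x + \<delta>)) (lax_oleinik \<A> L t (\<lambda>x. \<phi> x + \<delta>'))"
    by (rule mdist_lax_oleinik_translates[OF t b])
  fix z :: "'a \<Rightarrow> real" assume "z \<in> mspace CM"
  then have z: "bounded (range z)" using mspace_CM_iff by blast
  show "mdist CM (lax_oleinik \<A> L t (\<lambda>x. \<phi> x + \<delta>)) (lax_oleinik \<A> L t (\<lambda>x. \<phi> x + \<delta>'))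
      \<le> mdist CM (lax_oleinik \<A> L t (\<lambda>x. \<phi> x + \<delta>)) (lax_oleinik \<A> L t z)
        + mdist CM (lax_oleinik \<A> L t (\<lambda>x. \<phi> x + \<delta>')) (lax_oleinik \<A> L t z)"
    by (intro mdist_CM_triangle lax_oleinik_bounded t tr z)
qed

end

theorem theorem3p1:
  fixes \<A> :: "('a::t2_space, 'e::euclidean_space) chart set"
    and g :: "'a \<Rightarrow> ('a, 'e) tangent \<Rightarrow> ('a, 'e) tangent \<Rightarrow> real"
    and L :: "('a, 'e) lagrangian"
    and \<kappa> lam :: real
  assumes "compact_connected_manifold \<A>"
    and "riemannian_metric \<A> g"
    and "C2_lagrangian \<A> L"
    and "L1_convex \<A> L"
    and "L2_superlinear \<A> g L"
    and "\<kappa> > 0"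
    and "\<And>x v u. v \<in> tangent_space \<A> x \<Longrightarrow> \<bar>deriv (L x v) u\<bar> \<le> \<kappa>"
    and "0 < lam" and "lam \<le> \<kappa>"
    and "\<And>x v u. v \<in> tangent_space \<A> x \<Longrightarrow> lam \<le> deriv (L x v) u \<and> deriv (L x v) u \<le> \<kappa>"
  shows "(\<forall>\<phi>\<^sub>0 a. \<phi>\<^sub>0 \<in> mspace CM \<and> a > 0 \<longrightarrow>
            entropy_on CM (lax_oleinik \<A> L) {(\<lambda>x. \<phi>\<^sub>0 x + \<delta>) |\<delta>. \<delta> \<in> {0..a}} \<ge> ereal lam)
         \<and> h_top CM (lax_oleinik \<A> L) \<ge> ereal lam"
proof -
  interpret increasing_contact_lagrangian \<A> g L \<kappa> lam
    by unfold_locales (rule assms)+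
  let ?K = "{(\<lambda>x::'a. 0 + \<delta>) | \<delta>. \<delta> \<in> {0..1::real}}"
  have "(\<lambda>_. 0) \<in> mspace (CM :: ('a \<Rightarrow> real) metric)" by (simp only: mspace_CM_iff) simp
  then have "ereal lam \<le> entropy_on CM (lax_oleinik \<A> L) ?K"
    by (rule entropy_on_translates) simp
  also have "\<dots> \<le> h_top CM (lax_oleinik \<A> L)"
    unfolding h_top_def by (rule SUP_upper) (use compactin_translates_of_zero in blast)
  finally have "ereal lam \<le> h_top CM (lax_oleinik \<A> L)" .
  then show ?thesis using entropy_on_translates by blast
qed

end
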